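(* Let $T$ be a complete NIP theory. If $A\subseteq B$ and $\pi(x)$ is a partial type over $A$, then $\mathrm{str}(\pi,A)=\mathrm{str}(\pi,B)$; that is, for every cardinal $\kappa$, $\mathrm{str}(\pi,A)<\kappa$ holds if and only if $\mathrm{str}(\pi,B)<\kappa$ holds.
   Context: $\mathcal U$ is a monster model; $I+J$ denotes concatenation, $I+b+J$ inserting a single tuple $b$. Sequences $(I_i)_i$ are mutually indiscernible over $C$ if each $I_i$ is indiscernible over $C\cup\bigcup_{j\ne i}I_j$. Stable dimension: for a partial type $\pi$ over $C$ and a cardinal $\kappa$, $\mathrm{str}(\pi,C)<\kappa$ means there do NOT exist: a tuple $a\models\pi$; sequences $(I_i:i<\kappa)$ and $(J_i:i<\kappa)$ without endpoints such that $(I_i+J_i:i<\kappa)$ are mutually indiscernible over $Ca$; and tuples $(b_i:i<\kappa)$ such that $(I_i+b_i+J_i:i<\kappa)$ are mutually indiscernible over $C$ but for each $i<\kappa$, $I_i+b_i+J_i$ is not indiscernible over $Ca$. *)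

theory Defs
  imports Main
begin

unbundle cardinal_syntax

section \<open>First-order languages, formulas and structures\<close>

text \<open>
  A language is a set of function symbols and a set of relation symbols, each given with its
  arity. Variables are named by an arbitrary type, so that tuples of variables indexed by any set
  are available. Formulas with parameters use variables from a sum type, see below.
\<close>

record ('f, 'r) lang =
  Funs :: "('f \<times> nat) set"
  Rels :: "('r \<times> nat) set"

datatype ('f, 'v) trm = Var 'v | Fn 'f "('f, 'v) trm list"

datatype ('f, 'r, 'v) fm =
    Eq "('f, 'v) trm" "('f, 'v) trm"
  | Rel 'r "('f, 'v) trm list"
  | Neg "('f, 'r, 'v) fm"
  | Conj "('f, 'r, 'v) fm" "('f, 'r, 'v) fm"
  | Ex 'v "('f, 'r, 'v) fm"

primrec wf_trm :: "('f, 'r) lang \<Rightarrow> ('f, 'v) trm \<Rightarrow> bool" where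
  "wf_trm L (Var x) \<longleftrightarrow> True"
| "wf_trm L (Fn f ts) \<longleftrightarrow> (f, length ts) \<in> Funs L \<and> list_all (wf_trm L) ts"

primrec wf_fm :: "('f, 'r) lang \<Rightarrow> ('f, 'r, 'v) fm \<Rightarrow> bool" where
  "wf_fm L (Eq s t) \<longleftrightarrow> wf_trm L s \<and> wf_trm L t"
| "wf_fm L (Rel R ts) \<longleftrightarrow> (R, length ts) \<in> Rels L \<and> list_all (wf_trm L) ts"
| "wf_fm L (Neg \<phi>) \<longleftrightarrow> wf_fm L \<phi>"
| "wf_fm L (Conj \<phi> \<psi>) \<longleftrightarrow> wf_fm L \<phi> \<and> wf_fm L \<psi>"
| "wf_fm L (Ex x \<phi>) \<longleftrightarrow> wf_fm L \<phi>"

primrec fv_trm :: "('f, 'v) trm \<Rightarrow> 'v set" where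
  "fv_trm (Var x) = {x}"
| "fv_trm (Fn f ts) = \<Union> (set (map fv_trm ts))"

primrec fv :: "('f, 'r, 'v) fm \<Rightarrow> 'v set" where
  "fv (Eq s t) = fv_trm s \<union> fv_trm t"
| "fv (Rel R ts) = \<Union> (set (map fv_trm ts))"
| "fv (Neg \<phi>) = fv \<phi>"
| "fv (Conj \<phi> \<psi>) = fv \<phi> \<union> fv \<psi>"
| "fv (Ex x \<phi>) = fv \<phi> - {x}"

record ('f, 'r, 'u) struct =
  Dom :: "'u set"
  fun_int :: "'f \<Rightarrow> 'u list \<Rightarrow> 'u"
  rel_int :: "'r \<Rightarrow> 'u list \<Rightarrow> bool"

definition is_struct :: "('f, 'r) lang \<Rightarrow> ('f, 'r, 'u) struct \<Rightarrow> bool" where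
  "is_struct L M \<longleftrightarrow> Dom M \<noteq> {} \<and>
     (\<forall>(f, n) \<in> Funs L. \<forall>xs. length xs = n \<and> set xs \<subseteq> Dom M \<longrightarrow> fun_int M f xs \<in> Dom M)"

primrec val :: "('f, 'r, 'u) struct \<Rightarrow> ('v \<Rightarrow> 'u) \<Rightarrow> ('f, 'v) trm \<Rightarrow> 'u" where
  "val M v (Var x) = v x"
| "val M v (Fn f ts) = fun_int M f (map (val M v) ts)"

primrec sat :: "('f, 'r, 'u) struct \<Rightarrow> ('v \<Rightarrow> 'u) \<Rightarrow> ('f, 'r, 'v) fm \<Rightarrow> bool" where
  "sat M v (Eq s t) \<longleftrightarrow> val M v s = val M v t"
| "sat M v (Rel R ts) \<longleftrightarrow> rel_int M R (map (val M v) ts)"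
| "sat M v (Neg \<phi>) \<longleftrightarrow> \<not> sat M v \<phi>"
| "sat M v (Conj \<phi> \<psi>) \<longleftrightarrow> sat M v \<phi> \<and> sat M v \<psi>"
| "sat M v (Ex x \<phi>) \<longleftrightarrow> (\<exists>a \<in> Dom M. sat M (v(x := a)) \<phi>)"


section \<open>Theories\<close>

definition sentences :: "('f, 'r) lang \<Rightarrow> ('f, 'r, nat) fm set" where
  "sentences L = {\<sigma>. wf_fm L \<sigma> \<and> fv \<sigma> = {}}"

definition models :: "('f, 'r) lang \<Rightarrow> ('f, 'r, 'u) struct \<Rightarrow> ('f, 'r, nat) fm set \<Rightarrow> bool" where
  "models L M T \<longleftrightarrow> is_struct L M \<and> (\<forall>\<sigma> \<in> T. \<forall>v. range v \<subseteq> Dom M \<longrightarrow> sat M v \<sigma>)"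

text \<open>
  Consistency and semantic consequence refer to models of arbitrary size. By the downward
  Loewenheim-Skolem theorem it is enough to consider models whose domain is a subset of a type of
  cardinality at least that of the language plus \<open>\<aleph>\<^sub>0\<close>; the type of formulas itself is one.
\<close>

definition entails :: "('f, 'r) lang \<Rightarrow> ('f, 'r, nat) fm set \<Rightarrow> ('f, 'r, nat) fm \<Rightarrow> bool" where
  "entails L T \<sigma> \<longleftrightarrow>
     (\<forall>M :: ('f, 'r, ('f, 'r, nat) fm) struct. models L M T \<longrightarrow> models L M {\<sigma>})"

definition complete_theory :: "('f, 'r) lang \<Rightarrow> ('f, 'r, nat) fm set \<Rightarrow> bool" where
  "complete_theory L T \<longleftrightarrow> T \<subseteq> sentences L \<and>
     (\<exists>M :: ('f, 'r, ('f, 'r, nat) fm) struct. models L M T) \<and>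
     (\<forall>\<sigma> \<in> sentences L. entails L T \<sigma> \<or> entails L T (Neg \<sigma>))"


section \<open>Formulas with parameters and partial types\<close>

text \<open>
  In a formula over \<open>'x + 'u\<close>, a free variable \<open>Inl x\<close> is a genuine variable, while
  a free variable \<open>Inr c\<close> stands for the parameter \<open>c\<close>. Thus \<open>pfms L X C\<close>
  is the set of \<open>L(C)\<close>-formulas in the variables \<open>X\<close>.
\<close>

definition pfms :: "('f, 'r) lang \<Rightarrow> 'x set \<Rightarrow> 'u set \<Rightarrow> ('f, 'r, 'x + 'u) fm set" where
  "pfms L X C = {\<phi>. wf_fm L \<phi> \<and> fv \<phi> \<subseteq> Inl ` X \<union> Inr ` C}"

definition psat :: "('f, 'r, 'u) struct \<Rightarrow> ('x \<Rightarrow> 'u) \<Rightarrow> ('f, 'r, 'x + 'u) fm \<Rightarrow> bool" where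
  "psat M v \<phi> \<longleftrightarrow> sat M (case_sum v id) \<phi>"

text \<open>An \<open>X\<close>-tuple is a function of which only the values on \<open>X\<close> matter.\<close>

definition tuples :: "('f, 'r, 'u) struct \<Rightarrow> 'x set \<Rightarrow> ('x \<Rightarrow> 'u) set" where
  "tuples M X = {a. a ` X \<subseteq> Dom M}"

definition realizes :: "('f, 'r, 'u) struct \<Rightarrow> 'x set \<Rightarrow> ('x \<Rightarrow> 'u) \<Rightarrow>
    ('f, 'r, 'x + 'u) fm set \<Rightarrow> bool" where
  "realizes M X a p \<longleftrightarrow> a \<in> tuples M X \<and> (\<forall>\<phi> \<in> p. psat M a \<phi>)"

definition partial_type :: "('f, 'r) lang \<Rightarrow> ('f, 'r, 'u) struct \<Rightarrow> 'x set \<Rightarrow> 'u set \<Rightarrow>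
    ('f, 'r, 'x + 'u) fm set \<Rightarrow> bool" where
  "partial_type L M X C p \<longleftrightarrow> p \<subseteq> pfms L X C \<and>
     (\<forall>q. finite q \<and> q \<subseteq> p \<longrightarrow> (\<exists>a. realizes M X a q))"


section \<open>Monster models\<close>

definition saturated :: "('f, 'r) lang \<Rightarrow> ('f, 'r, 'u) struct \<Rightarrow> 'c rel \<Rightarrow> bool" where
  "saturated L M \<mu> \<longleftrightarrow>
     (\<forall>C p. C \<subseteq> Dom M \<and> |C| <o \<mu> \<and> partial_type L M {0::nat} C p \<longrightarrow> (\<exists>a. realizes M {0} a p))"

definition elementary_map :: "('f, 'r) lang \<Rightarrow> ('f, 'r, 'u) struct \<Rightarrow> 'u set \<Rightarrow> ('u \<Rightarrow> 'u) \<Rightarrow> bool" where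
  "elementary_map L M C f \<longleftrightarrow> C \<subseteq> Dom M \<and> f ` C \<subseteq> Dom M \<and>
     (\<forall>(\<phi> :: ('f, 'r, nat) fm) v. wf_fm L \<phi> \<and> range v \<subseteq> C \<longrightarrow> (sat M v \<phi> \<longleftrightarrow> sat M (f \<circ> v) \<phi>))"

definition automorphism :: "('f, 'r) lang \<Rightarrow> ('f, 'r, 'u) struct \<Rightarrow> ('u \<Rightarrow> 'u) \<Rightarrow> bool" where
  "automorphism L M g \<longleftrightarrow> bij_betw g (Dom M) (Dom M) \<and>
     (\<forall>(f, n) \<in> Funs L. \<forall>xs. length xs = n \<and> set xs \<subseteq> Dom M \<longrightarrow>
        fun_int M f (map g xs) = g (fun_int M f xs)) \<and>
     (\<forall>(R, n) \<in> Rels L. \<forall>xs. length xs = n \<and> set xs \<subseteq> Dom M \<longrightarrow>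
        (rel_int M R (map g xs) \<longleftrightarrow> rel_int M R xs))"

definition strongly_homogeneous :: "('f, 'r) lang \<Rightarrow> ('f, 'r, 'u) struct \<Rightarrow> 'c rel \<Rightarrow> bool" where
  "strongly_homogeneous L M \<mu> \<longleftrightarrow>
     (\<forall>C f. |C| <o \<mu> \<and> elementary_map L M C f \<longrightarrow>
        (\<exists>g. automorphism L M g \<and> (\<forall>c \<in> C. g c = f c)))"

text \<open>
  ``Small'' means of cardinality less than \<open>\<mu>\<close>. As there are infinitely many formulas,
  the cardinality condition makes \<open>\<mu>\<close> uncountable and larger than the language.
\<close>

definition monster_model :: "('f, 'r) lang \<Rightarrow> ('f, 'r, nat) fm set \<Rightarrow> ('f, 'r, 'u) struct \<Rightarrow>
    'c rel \<Rightarrow> bool" where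
  "monster_model L T M \<mu> \<longleftrightarrow> models L M T \<and> Card_order \<mu> \<and>
     |{\<phi> :: ('f, 'r, nat) fm. wf_fm L \<phi>}| <o \<mu> \<and>
     saturated L M \<mu> \<and> strongly_homogeneous L M \<mu>"

text \<open>
  \<open>\<phi>(x;y)\<close> is a formula over \<open>nat + nat\<close>: the variables \<open>Inl k\<close> form
  \<open>x\<close> and the variables \<open>Inr k\<close> form \<open>y\<close>; only finitely many of them occur.
  The theory is NIP if no \<open>\<phi>(x;y)\<close> shatters an infinite set of tuples of its monster model.
\<close>

definition NIP :: "('f, 'r) lang \<Rightarrow> ('f, 'r, 'u) struct \<Rightarrow> bool" where
  "NIP L M \<longleftrightarrow> (\<forall>\<phi> :: ('f, 'r, nat + nat) fm. wf_fm L \<phi> \<longrightarrow>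
     \<not> (\<exists>(a :: nat \<Rightarrow> nat \<Rightarrow> 'u) (b :: nat set \<Rightarrow> nat \<Rightarrow> 'u).
         (\<forall>i. a i \<in> tuples M UNIV) \<and> (\<forall>S. b S \<in> tuples M UNIV) \<and>
         (\<forall>i S. sat M (case_sum (a i) (b S)) \<phi> \<longleftrightarrow> i \<in> S)))"


section \<open>Indiscernible sequences\<close>

text \<open>
  A sequence of \<open>Y\<close>-tuples is a (reflexive) linear order on some index set, together with
  a function giving the tuples.
\<close>

type_synonym ('i, 'y, 'u) tseq = "'i rel \<times> ('i \<Rightarrow> 'y \<Rightarrow> 'u)"

definition is_seq :: "('f, 'r, 'u) struct \<Rightarrow> 'y set \<Rightarrow> ('i, 'y, 'u) tseq \<Rightarrow> bool" where
  "is_seq M Y I \<longleftrightarrow> Linear_order (fst I) \<and> (\<forall>t \<in> Field (fst I). snd I t \<in> tuples M Y)"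

definition without_endpoints :: "('i, 'y, 'u) tseq \<Rightarrow> bool" where
  "without_endpoints I \<longleftrightarrow> Field (fst I) \<noteq> {} \<and>
     (\<forall>t \<in> Field (fst I). (\<exists>s. s \<noteq> t \<and> (s, t) \<in> fst I) \<and> (\<exists>s. s \<noteq> t \<and> (t, s) \<in> fst I))"

definition ord_sum :: "'i rel \<Rightarrow> 'j rel \<Rightarrow> ('i + 'j) rel" where
  "ord_sum r s = {(Inl x, Inl y) | x y. (x, y) \<in> r} \<union> {(Inr x, Inr y) | x y. (x, y) \<in> s} \<union>
     {(Inl x, Inr y) | x y. x \<in> Field r \<and> y \<in> Field s}"

definition seq_append :: "('i, 'y, 'u) tseq \<Rightarrow> ('j, 'y, 'u) tseq \<Rightarrow> ('i + 'j, 'y, 'u) tseq"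
    (infixr "\<oplus>" 65) where
  "I \<oplus> J = (ord_sum (fst I) (fst J), case_sum (snd I) (snd J))"

definition seq_single :: "('y \<Rightarrow> 'u) \<Rightarrow> (unit, 'y, 'u) tseq" where
  "seq_single b = ({((), ())}, \<lambda>_. b)"

definition seq_elems :: "'y set \<Rightarrow> ('i, 'y, 'u) tseq \<Rightarrow> 'u set" where
  "seq_elems Y I = (\<Union>t \<in> Field (fst I). snd I t ` Y)"

definition increasing :: "'i rel \<Rightarrow> nat \<Rightarrow> (nat \<Rightarrow> 'i) \<Rightarrow> bool" where
  "increasing r n t \<longleftrightarrow> (\<forall>k < n. t k \<in> Field r) \<and>
     (\<forall>k l. k < l \<and> l < n \<longrightarrow> (t k, t l) \<in> r \<and> t k \<noteq> t l)"

text \<open>In \<open>\<phi>\<close>, the variable \<open>(k, y)\<close> is the coordinate \<open>y\<close> of the \<open>k\<close>-th tuple.\<close>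

definition indiscernible :: "('f, 'r) lang \<Rightarrow> ('f, 'r, 'u) struct \<Rightarrow> 'y set \<Rightarrow> 'u set \<Rightarrow>
    ('i, 'y, 'u) tseq \<Rightarrow> bool" where
  "indiscernible L M Y C I \<longleftrightarrow>
     (\<forall>n. \<forall>\<phi> \<in> pfms L ({..<n} \<times> Y) C. \<forall>s t.
        increasing (fst I) n s \<and> increasing (fst I) n t \<longrightarrow>
        (psat M (\<lambda>(k, y). snd I (s k) y) \<phi> \<longleftrightarrow> psat M (\<lambda>(k, y). snd I (t k) y) \<phi>))"

definition mutually_indiscernible :: "('f, 'r) lang \<Rightarrow> ('f, 'r, 'u) struct \<Rightarrow> 'k set \<Rightarrow>
    ('k \<Rightarrow> 'y set) \<Rightarrow> 'u set \<Rightarrow> ('k \<Rightarrow> ('i, 'y, 'u) tseq) \<Rightarrow> bool" where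
  "mutually_indiscernible L M K Y C I \<longleftrightarrow>
     (\<forall>i \<in> K. indiscernible L M (Y i) (C \<union> (\<Union>j \<in> K - {i}. seq_elems (Y j) (I j))) (I i))"


section \<open>Stable dimension\<close>

text \<open>
  \<open>str_less L M \<mu> X \<pi> C \<kappa>\<close> is \<open>str(\<pi>, C) < \<kappa>\<close> for a partial type \<open>\<pi>\<close> in the variables \<open>X\<close>.
  The tuples and sequences are small. Their index sets are subsets of the type underlying
  \<open>\<mu>\<close>, which is no restriction: every linear order of cardinality less than \<open>\<mu>\<close>
  is isomorphic to one on a subset of \<open>Field \<mu>\<close>. The tuples of the \<open>i\<close>-th sequence are
  indexed by \<open>Y i\<close>.
\<close>

definition str_less :: "('f, 'r) lang \<Rightarrow> ('f, 'r, 'u) struct \<Rightarrow> 'c rel \<Rightarrow> 'c set \<Rightarrow>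
    ('f, 'r, 'c + 'u) fm set \<Rightarrow> 'u set \<Rightarrow> 'k rel \<Rightarrow> bool" where
  "str_less L M \<mu> X \<pi> C \<kappa> \<longleftrightarrow>
     \<not> (\<exists>(a :: 'c \<Rightarrow> 'u) (Y :: 'k \<Rightarrow> 'c set) (I :: 'k \<Rightarrow> ('c, 'c, 'u) tseq)
          (J :: 'k \<Rightarrow> ('c, 'c, 'u) tseq) (b :: 'k \<Rightarrow> 'c \<Rightarrow> 'u).
         realizes M X a \<pi> \<and>
         (\<forall>i \<in> Field \<kappa>. |Y i| <o \<mu> \<and>
            is_seq M (Y i) (I i) \<and> |Field (fst (I i))| <o \<mu> \<and> without_endpoints (I i) \<and>
            is_seq M (Y i) (J i) \<and> |Field (fst (J i))| <o \<mu> \<and> without_endpoints (J i) \<and>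
            b i \<in> tuples M (Y i)) \<and>
         mutually_indiscernible L M (Field \<kappa>) Y (C \<union> a ` X) (\<lambda>i. I i \<oplus> J i) \<and>
         mutually_indiscernible L M (Field \<kappa>) Y C (\<lambda>i. I i \<oplus> seq_single (b i) \<oplus> J i) \<and>
         (\<forall>i \<in> Field \<kappa>.
            \<not> indiscernible L M (Y i) (C \<union> a ` X) (I i \<oplus> seq_single (b i) \<oplus> J i)))"

end

(*
Passing from B down to a subset A, the parameters in B are added as constant coordinates to the
tuples of the sequences.

Passing from A up to B, suppose (D_q), q rational, is mutually indiscernible over A, is mutually
indiscernible over Aa off the cut q = 0, and D_0 breaks indiscernibility over Aa. By Ramsey we may
take (D_q) mutually indiscernible over B, and we look for a copy of a over A and D such that (D_q)
off 0 is mutually indiscernible over Ba. If there is none, then by compactness a formula Theta over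
B holds of every block of D and says that every a of the right type over that block has some
B-formula changing its truth value at the centre of the block. But a can be kept while the centre
is moved: delete the point at its centre and insert, in a far away cut, another point playing the
same role. By NIP a changes truth values at few places only, so at a suitable cut Theta fails for
the block with the new centre. Repeating this with new realizations of the type of a gives an
A-mutually indiscernible sequence along which Theta alternates as often as we like, contradicting
NIP.

The same shattering argument shows that kappa must be smaller than mu, so that every set of
parameters that occurs is small. Points of the sequences occurring in the formula witnessed by b_i
are moved to the base first.
*)
theory Submission
  imports Defs "HOL-Library.Ramsey" "HOL-Library.Countable_Set"
begin

text \<open>The obstacle: an inserted centre is chosen by its type over \<open>A\<close>, the tuple
  and the rest of the array, so indiscernibility over \<open>B\<close> is lost at every insertion.
  What survives is indiscernibility over \<open>A\<close>, which says nothing about parameters from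
  \<open>B\<close>; in the last application of NIP the parameters of Theta therefore count as
  quantified variables. The old centre has to go before a new one comes because the tuple tolerates
  a single special position: the array is indiscernible over \<open>Aa\<close> only off 0. With
  exactly one such position left, the new array has the \<open>A\<close>-type of the old one and the
  move can be repeated. Everything is carried out with predicates on assignments instead of
  formulas. Parameters, coordinates of the tuple and coordinates of array entries are all variables,
  so types over any mixture of them are compared by the one relation \<open>tpeq\<close>, and moving
  points of a sequence is a renaming of variables. Positions are rational so that translations can
  put the centre anywhere.\<close>

section \<open>Formulas: free variables, renaming and substitution\<close>

lemma finite_vars_trm: "finite (set2_trm t)"
  by (induction t) auto

lemma finite_vars_fm: "finite (set3_fm \<phi>)"
  by (induction \<phi>) (auto simp: finite_vars_trm)

lemma fv_trm_vars: "fv_trm t = set2_trm t"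
  by (induction t) auto

lemma fv_vars: "fv \<phi> \<subseteq> set3_fm \<phi>"
  by (induction \<phi>) (auto simp: fv_trm_vars)

lemma finite_fv: "finite (fv \<phi>)"
  using finite_subset[OF fv_vars finite_vars_fm] .

lemma val_cong: "(\<And>x. x \<in> fv_trm t \<Longrightarrow> v x = w x) \<Longrightarrow> val M v t = val M w t"
proof (induction t)
  case (Fn f ts)
  then have "map (val M v) ts = map (val M w) ts" by (intro map_cong) auto
  then show ?case by (simp only: val.simps)
qed simp

lemma sat_cong: "(\<And>x. x \<in> fv \<phi> \<Longrightarrow> v x = w x) \<Longrightarrow> sat M v \<phi> = sat M w \<phi>"
proof (induction \<phi> arbitrary: v w)
  case (Eq s t)
  then show ?case using val_cong[of s v w M] val_cong[of t v w M] by simp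
next
  case (Rel R ts)
  then have "map (val M v) ts = map (val M w) ts" by (auto intro!: val_cong)
  then show ?case by (simp only: sat.simps)
next
  case (Neg \<phi>)
  then have "sat M v \<phi> = sat M w \<phi>" by (intro Neg.IH) simp
  then show ?case by simp
next
  case (Conj \<phi> \<psi>)
  have "sat M v \<phi> = sat M w \<phi>" "sat M v \<psi> = sat M w \<psi>"
    by (rule Conj.IH; use Conj.prems in simp)+
  then show ?case by simp
next
  case (Ex x \<phi>)
  have "sat M (v(x := a)) \<phi> = sat M (w(x := a)) \<phi>" for a
    using Ex.prems by (intro Ex.IH) auto
  then show ?case by simp
qed

lemma val_map: "val M v (map_trm (\<lambda>a. a) f t) = val M (v \<circ> f) t"
  by (induction t) (auto intro!: arg_cong[where f = "fun_int M _"])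

lemma wf_trm_map: "wf_trm L (map_trm (\<lambda>a. a) f t) = wf_trm L t"
  by (induction t) (auto simp: list_all_iff)

lemma wf_fm_map: "wf_fm L (map_fm (\<lambda>a. a) (\<lambda>a. a) f \<phi>) = wf_fm L \<phi>"
  by (induction \<phi>) (auto simp: wf_trm_map list_all_iff)

lemma fv_trm_map: "fv_trm (map_trm (\<lambda>a. a) f t) = f ` fv_trm t"
  by (induction t) auto

text \<open>Injectivity is asked on all occurring variables, the bound ones included: this is what
  excludes capture.\<close>

lemma fv_map: "inj_on f (set3_fm \<phi>) \<Longrightarrow> fv (map_fm (\<lambda>a. a) (\<lambda>a. a) f \<phi>) = f ` fv \<phi>"
proof (induction \<phi>)
  case (Conj \<phi> \<psi>)
  then show ?case by (simp add: inj_on_Un image_Un)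
next
  case (Ex x \<phi>)
  have i: "inj_on f (insert x (set3_fm \<phi>))" using Ex.prems by simp
  have "f ` (fv \<phi> - {x}) = f ` fv \<phi> - f ` {x}"
    by (rule inj_on_image_set_diff[OF i]) (use fv_vars[of \<phi>] in auto)
  with Ex show ?case by (simp add: inj_on_insert)
qed (auto simp: fv_trm_map)

lemma sat_map: "inj_on f (set3_fm \<phi>) \<Longrightarrow> sat M v (map_fm (\<lambda>a. a) (\<lambda>a. a) f \<phi>) = sat M (v \<circ> f) \<phi>"
proof (induction \<phi> arbitrary: v)
  case (Rel R ts)
  have "map (val M v) (map (map_trm (\<lambda>a. a) f) ts) = map (val M (v \<circ> f)) ts" by (simp add: val_map)
  then show ?case by (simp only: sat.simps fm.map)
next
  case (Conj \<phi> \<psi>)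
  then show ?case by (simp add: inj_on_Un)
next
  case (Ex x \<phi>)
  have i: "inj_on f (insert x (set3_fm \<phi>))" using Ex.prems by simp
  have "sat M (v(f x := a) \<circ> f) \<phi> = sat M ((v \<circ> f)(x := a)) \<phi>" for a
    using i fv_vars[of \<phi>] by (intro sat_cong) (auto simp: inj_on_def)
  then show ?case using Ex.IH i by (simp only: fm.map sat.simps inj_on_insert)
qed (auto simp: val_map)

lemma inj_on_avoiding:
  assumes "finite A" "finite B" "infinite (UNIV :: 'w set)"
  obtains \<rho> :: "'v \<Rightarrow> 'w" where "inj_on \<rho> A" "\<rho> ` A \<inter> B = {}"
proof -
  have "infinite (- B)" using assms by (simp add: Compl_eq_Diff_UNIV)
  then obtain C where C: "C \<subseteq> - B" "finite C" "card C = card A"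
    using infinite_arbitrarily_large by blast
  then obtain \<rho> where "bij_betw \<rho> A C"
    using assms(1) finite_same_card_bij by metis
  then show ?thesis using that C unfolding bij_betw_def by (metis ComplD Int_emptyI subset_iff)
qed

text \<open>
  Renaming along a non-injective \<open>h\<close> may capture; instead the free variables are renamed
  apart and then tied to their targets by equations under existential quantifiers.
\<close>

fun tie :: "('v \<Rightarrow> 'w) \<Rightarrow> ('v \<Rightarrow> 'w) \<Rightarrow> ('f, 'r, 'w) fm \<Rightarrow> 'v list \<Rightarrow> ('f, 'r, 'w) fm" where
  "tie \<rho> h \<phi> [] = \<phi>"
| "tie \<rho> h \<phi> (j # js) = Ex (\<rho> j) (Conj (Eq (Var (\<rho> j)) (Var (h j))) (tie \<rho> h \<phi> js))"

lemma wf_tie: "wf_fm L (tie \<rho> h \<phi> js) = wf_fm L \<phi>"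
  by (induction js) auto

lemma fv_tie: "fv (tie \<rho> h \<phi> js) \<subseteq> (fv \<phi> - \<rho> ` set js) \<union> h ` set js"
  by (induction js) auto

lemma sat_tie:
  assumes "distinct js" "inj_on \<rho> (set js)" "\<rho> ` set js \<inter> h ` set js = {}"
    and "\<And>j. j \<in> set js \<Longrightarrow> v (h j) \<in> Dom M"
  shows "sat M v (tie \<rho> h \<phi> js) =
    sat M (\<lambda>w. if w \<in> \<rho> ` set js then v (h (inv_into (set js) \<rho> w)) else v w) \<phi>"
  using assms
proof (induction js arbitrary: v)
  case Nil
  then show ?case by simp
next
  case (Cons j js)
  have ne: "\<rho> j \<noteq> h j'" if "j' \<in> set (j # js)" for j' using Cons.prems(3) that by auto
  let ?v = "v(\<rho> j := v (h j))"
  have "sat M v (tie \<rho> h \<phi> (j # js)) = sat M ?v (tie \<rho> h \<phi> js)"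
    using Cons.prems(4)[of j] ne[of j] by (auto simp: fun_upd_def)
  also have "\<dots> = sat M (\<lambda>w. if w \<in> \<rho> ` set js then ?v (h (inv_into (set js) \<rho> w)) else ?v w) \<phi>"
    using Cons.prems ne by (intro Cons.IH) (auto simp: inj_on_def)
  also have "(\<lambda>w. if w \<in> \<rho> ` set js then ?v (h (inv_into (set js) \<rho> w)) else ?v w) =
    (\<lambda>w. if w \<in> \<rho> ` set (j # js) then v (h (inv_into (set (j # js)) \<rho> w)) else v w)"
  proof
    fix w
    have i1: "inv_into (set (j # js)) \<rho> (\<rho> j') = j'" if "j' \<in> set (j # js)" for j'
      using Cons.prems(2) that by (rule inv_into_f_f)
    have i2: "inv_into (set js) \<rho> (\<rho> j') = j'" if "j' \<in> set js" for j'
      using Cons.prems(2) that by (intro inv_into_f_f) (auto simp: inj_on_def)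
    have d: "\<rho> j \<notin> \<rho> ` set js" using Cons.prems(1,2) by (auto simp: inj_on_def)
    show "(if w \<in> \<rho> ` set js then ?v (h (inv_into (set js) \<rho> w)) else ?v w) =
      (if w \<in> \<rho> ` set (j # js) then v (h (inv_into (set (j # js)) \<rho> w)) else v w)"
    proof (cases "w \<in> \<rho> ` set js")
      case True
      then obtain j' where "j' \<in> set js" "w = \<rho> j'" by auto
      with True show ?thesis using i1[of j'] i2[of j'] ne[of j'] by auto
    next
      case False
      then show ?thesis using i1[of j] by auto
    qed
  qed
  finally show ?case .
qed

text \<open>The free variables are renamed injectively away from their targets and then tied to
  them, so \<open>h\<close> may identify variables. The values have to lie in \<open>Dom M\<close>
  since the tying quantifiers range over it.\<close>

lemma formula_subst:
  fixes \<phi> :: "('f, 'r, 'v) fm" and h :: "'v \<Rightarrow> 'w"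
  assumes wf: "wf_fm L \<phi>" and inf: "infinite (UNIV :: 'w set)"
  obtains \<psi> :: "('f, 'r, 'w) fm" where "wf_fm L \<psi>" "fv \<psi> \<subseteq> h ` fv \<phi>"
    "\<And>v. (\<And>x. x \<in> fv \<phi> \<Longrightarrow> v (h x) \<in> Dom M) \<Longrightarrow> sat M v \<psi> = sat M (v \<circ> h) \<phi>"
proof -
  obtain \<rho> :: "'v \<Rightarrow> 'w" where \<rho>: "inj_on \<rho> (set3_fm \<phi>)" "\<rho> ` set3_fm \<phi> \<inter> h ` fv \<phi> = {}"
    using inj_on_avoiding[OF finite_vars_fm finite_imageI[OF finite_fv] inf] by metis
  obtain js where js: "distinct js" "set js = fv \<phi>"
    using finite_distinct_list[OF finite_fv] by metis
  have inj: "inj_on \<rho> (fv \<phi>)" using \<rho>(1) fv_vars by (rule inj_on_subset)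
  define \<psi> where "\<psi> = tie \<rho> h (map_fm (\<lambda>a. a) (\<lambda>a. a) \<rho> \<phi>) js"
  show ?thesis
  proof (rule that)
    show "wf_fm L \<psi>" using wf by (simp add: \<psi>_def wf_tie wf_fm_map)
    show "fv \<psi> \<subseteq> h ` fv \<phi>"
      using fv_tie[of \<rho> h "map_fm (\<lambda>a. a) (\<lambda>a. a) \<rho> \<phi>" js] \<rho>(1) js by (simp add: \<psi>_def fv_map)
    fix v assume v: "\<And>x. x \<in> fv \<phi> \<Longrightarrow> v (h x) \<in> Dom M"
    have d: "\<rho> ` set js \<inter> h ` set js = {}" using \<rho>(2) fv_vars[of \<phi>] js(2) by blast
    have "sat M v \<psi> = sat M (\<lambda>w. if w \<in> \<rho> ` fv \<phi> then v (h (inv_into (fv \<phi>) \<rho> w)) else v w)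
        (map_fm (\<lambda>a. a) (\<lambda>a. a) \<rho> \<phi>)"
      unfolding \<psi>_def js(2)[symmetric] using js(1) inj d v by (intro sat_tie) (simp_all add: js(2))
    also have "\<dots> = sat M (v \<circ> h) \<phi>"
      unfolding sat_map[OF \<rho>(1)] using inj by (intro sat_cong) simp
    finally show "sat M v \<psi> = sat M (v \<circ> h) \<phi>" .
  qed
qed

section \<open>Definable predicates on assignments\<close>

text \<open>Formulas up to equivalence in \<open>M\<close>. The type \<open>'v\<close> is arbitrary,
  possibly finite, because the formula has its own variables, which \<open>g\<close> sends to
  \<open>S\<close>, not necessarily injectively. Only assignments into \<open>Dom M\<close> are
  compared, as the quantifiers range over the domain.\<close>

definition dfn :: "('f, 'r) lang \<Rightarrow> ('f, 'r, 'u) struct \<Rightarrow> 'v set \<Rightarrow> (('v \<Rightarrow> 'u) \<Rightarrow> bool) \<Rightarrow> bool" where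
  "dfn L M S P \<longleftrightarrow> (\<exists>(\<phi> :: ('f, 'r, nat) fm) g. wf_fm L \<phi> \<and> g ` fv \<phi> \<subseteq> S \<and>
     (\<forall>v. v ` S \<subseteq> Dom M \<longrightarrow> (P v \<longleftrightarrow> sat M (v \<circ> g) \<phi>)))"

lemma dfn_formula:
  fixes \<phi> :: "('f, 'r, 'w) fm"
  assumes "wf_fm L \<phi>" "g ` fv \<phi> \<subseteq> S"
  shows "dfn L M S (\<lambda>v. sat M (v \<circ> g) \<phi>)"
proof -
  obtain \<rho> :: "'w \<Rightarrow> nat" where \<rho>: "inj_on \<rho> (fv \<phi>)"
    using inj_on_avoiding[OF finite_fv finite.emptyI infinite_UNIV_nat] by metis
  obtain \<psi> :: "('f, 'r, nat) fm" where \<psi>: "wf_fm L \<psi>" "fv \<psi> \<subseteq> \<rho> ` fv \<phi>"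
    "\<And>v. (\<And>x. x \<in> fv \<phi> \<Longrightarrow> v (\<rho> x) \<in> Dom M) \<Longrightarrow> sat M v \<psi> = sat M (v \<circ> \<rho>) \<phi>"
    using formula_subst[OF assms(1) infinite_UNIV_nat, of \<rho> M] by metis
  let ?k = "g \<circ> inv_into (fv \<phi>) \<rho>"
  have "?k ` fv \<psi> \<subseteq> S" using \<psi>(2) assms(2) \<rho> by fastforce
  moreover have "sat M (v \<circ> g) \<phi> = sat M (v \<circ> ?k) \<psi>" if "v ` S \<subseteq> Dom M" for v
  proof -
    have "sat M (v \<circ> ?k) \<psi> = sat M (v \<circ> ?k \<circ> \<rho>) \<phi>"
      using that assms(2) \<rho> by (intro \<psi>(3)) (auto simp: image_subset_iff)
    also have "\<dots> = sat M (v \<circ> g) \<phi>" using \<rho> by (intro sat_cong) simp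
    finally show ?thesis by simp
  qed
  ultimately show ?thesis unfolding dfn_def using \<psi>(1) by blast
qed

lemma dfn_to_formula:
  fixes h :: "'v \<Rightarrow> 'w"
  assumes "dfn L M S P" "infinite (UNIV :: 'w set)"
  obtains \<psi> :: "('f, 'r, 'w) fm" where "wf_fm L \<psi>" "fv \<psi> \<subseteq> h ` S"
    "\<And>v. v ` h ` S \<subseteq> Dom M \<Longrightarrow> sat M v \<psi> = P (v \<circ> h)"
proof -
  obtain \<phi> :: "('f, 'r, nat) fm" and g where \<phi>: "wf_fm L \<phi>" "g ` fv \<phi> \<subseteq> S"
    "\<And>v. v ` S \<subseteq> Dom M \<Longrightarrow> P v \<longleftrightarrow> sat M (v \<circ> g) \<phi>" using assms(1) unfolding dfn_def by blast
  obtain \<psi> :: "('f, 'r, 'w) fm" where \<psi>: "wf_fm L \<psi>" "fv \<psi> \<subseteq> (h \<circ> g) ` fv \<phi>"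
    "\<And>v. (\<And>x. x \<in> fv \<phi> \<Longrightarrow> v ((h \<circ> g) x) \<in> Dom M) \<Longrightarrow> sat M v \<psi> = sat M (v \<circ> (h \<circ> g)) \<phi>"
    using formula_subst[OF \<phi>(1) assms(2), of "h \<circ> g" M] by metis
  show ?thesis
  proof (rule that[OF \<psi>(1)])
    show "fv \<psi> \<subseteq> h ` S" using \<psi>(2) \<phi>(2) by fastforce
    fix v assume "v ` h ` S \<subseteq> Dom M"
    then show "sat M v \<psi> = P (v \<circ> h)"
      using \<phi>(2) \<phi>(3)[of "v \<circ> h"] \<psi>(3)[of v] by (auto simp: image_comp o_assoc)
  qed
qed

lemma dfn_mono:
  assumes "dfn L M S P" "S \<subseteq> S'"
  shows "dfn L M S' P"
proof -
  obtain \<phi> :: "('a, 'b, nat) fm" and g where \<phi>: "wf_fm L \<phi>" "g ` fv \<phi> \<subseteq> S"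
    "\<And>v. v ` S \<subseteq> Dom M \<Longrightarrow> P v \<longleftrightarrow> sat M (v \<circ> g) \<phi>" using assms(1) unfolding dfn_def by blast
  moreover have "v ` S \<subseteq> Dom M" if "v ` S' \<subseteq> Dom M" for v using that assms(2) by auto
  ultimately show ?thesis unfolding dfn_def using assms(2) by (intro exI[of _ \<phi>] exI[of _ g]) auto
qed

lemma dfn_cong_pred:
  assumes "dfn L M S P" "\<And>v. v ` S \<subseteq> Dom M \<Longrightarrow> P v = P' v"
  shows "dfn L M S P'"
proof -
  obtain \<phi> :: "('a, 'b, nat) fm" and g where \<phi>: "wf_fm L \<phi>" "g ` fv \<phi> \<subseteq> S"
    "\<And>v. v ` S \<subseteq> Dom M \<Longrightarrow> P v \<longleftrightarrow> sat M (v \<circ> g) \<phi>" using assms(1) unfolding dfn_def by blast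
  then show ?thesis unfolding dfn_def using assms(2) by (intro exI[of _ \<phi>] exI[of _ g]) simp
qed

lemma dfn_cong:
  assumes "dfn L M S P" "v ` S \<subseteq> Dom M" "\<And>x. x \<in> S \<Longrightarrow> v x = w x"
  shows "P v = P w"
proof -
  obtain \<phi> :: "('a, 'b, nat) fm" and g where \<phi>: "wf_fm L \<phi>" "g ` fv \<phi> \<subseteq> S"
    "\<And>v. v ` S \<subseteq> Dom M \<Longrightarrow> P v \<longleftrightarrow> sat M (v \<circ> g) \<phi>" using assms(1) unfolding dfn_def by blast
  have "w ` S \<subseteq> Dom M" using assms(2,3) by auto
  moreover have "sat M (v \<circ> g) \<phi> = sat M (w \<circ> g) \<phi>" using \<phi>(2) assms(3) by (intro sat_cong) auto
  ultimately show ?thesis using \<phi>(3) assms(2) by simp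
qed

text \<open>A formula has finitely many free variables. A new predicate \<open>P'\<close> appears
  because \<open>P\<close> is controlled only where all of \<open>S\<close> is sent into the domain,
  whereas \<open>P'\<close> must be controlled wherever \<open>S0\<close> is.\<close>

lemma dfn_finite:
  assumes "dfn L M S P"
  obtains S0 P' where "finite S0" "S0 \<subseteq> S" "dfn L M S0 P'" "\<And>v. v ` S \<subseteq> Dom M \<Longrightarrow> P v = P' v"
proof -
  obtain \<phi> :: "('a, 'b, nat) fm" and g where \<phi>: "wf_fm L \<phi>" "g ` fv \<phi> \<subseteq> S"
    "\<And>v. v ` S \<subseteq> Dom M \<Longrightarrow> P v \<longleftrightarrow> sat M (v \<circ> g) \<phi>" using assms(1) unfolding dfn_def by blast
  show ?thesis
    using \<phi> by (intro that[of "g ` fv \<phi>" "\<lambda>v. sat M (v \<circ> g) \<phi>"] dfn_formula)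
      (simp_all add: finite_fv)
qed

lemma dfn_subst:
  assumes "dfn L M S P"
  shows "dfn L M (h ` S) (\<lambda>v. P (v \<circ> h))"
proof -
  obtain \<phi> :: "('a, 'b, nat) fm" and g where \<phi>: "wf_fm L \<phi>" "g ` fv \<phi> \<subseteq> S"
    "\<And>v. v ` S \<subseteq> Dom M \<Longrightarrow> P v \<longleftrightarrow> sat M (v \<circ> g) \<phi>" using assms unfolding dfn_def by blast
  have "dfn L M (h ` S) (\<lambda>v. sat M (v \<circ> (h \<circ> g)) \<phi>)"
    using \<phi>(1,2) by (intro dfn_formula) auto
  then show ?thesis
    by (rule dfn_cong_pred) (use \<phi>(3) in \<open>simp add: image_comp comp_assoc\<close>)
qed

lemma dfn_subst': "dfn L M S P \<Longrightarrow> h ` S \<subseteq> S' \<Longrightarrow> dfn L M S' (\<lambda>v. P (v \<circ> h))"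
  by (rule dfn_mono[OF dfn_subst])

lemma dfn_Not:
  assumes "dfn L M S P"
  shows "dfn L M S (\<lambda>v. \<not> P v)"
proof -
  obtain \<phi> :: "('a, 'b, nat) fm" and g where \<phi>: "wf_fm L \<phi>" "g ` fv \<phi> \<subseteq> S"
    "\<And>v. v ` S \<subseteq> Dom M \<Longrightarrow> P v \<longleftrightarrow> sat M (v \<circ> g) \<phi>" using assms unfolding dfn_def by blast
  have "dfn L M S (\<lambda>v. sat M (v \<circ> g) (Neg \<phi>))"
    using \<phi>(1,2) by (intro dfn_formula) auto
  then show ?thesis
    by (rule dfn_cong_pred) (use \<phi>(3) in simp)
qed

lemma dfn_And:
  assumes "dfn L M S P" "dfn L M S Q"
  shows "dfn L M S (\<lambda>v. P v \<and> Q v)"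
proof -
  obtain \<phi> :: "('a, 'b, nat) fm" and g where \<phi>: "wf_fm L \<phi>" "g ` fv \<phi> \<subseteq> S"
    "\<And>v. v ` S \<subseteq> Dom M \<Longrightarrow> P v \<longleftrightarrow> sat M (v \<circ> g) \<phi>" using assms(1) unfolding dfn_def by blast
  obtain \<psi> :: "('a, 'b, nat) fm" and k where \<psi>: "wf_fm L \<psi>" "k ` fv \<psi> \<subseteq> S"
    "\<And>v. v ` S \<subseteq> Dom M \<Longrightarrow> Q v \<longleftrightarrow> sat M (v \<circ> k) \<psi>" using assms(2) unfolding dfn_def by blast
  \<comment> \<open>The two formulas get disjoint copies of their variables, which \<open>g\<close>
    and \<open>k\<close> send back to \<open>S\<close>.\<close>
  let ?\<theta> = "Conj (map_fm (\<lambda>a. a) (\<lambda>a. a) Inl \<phi>) (map_fm (\<lambda>a. a) (\<lambda>a. a) Inr \<psi>)"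
  have "wf_fm L ?\<theta>" using \<phi>(1) \<psi>(1) by (simp add: wf_fm_map)
  moreover have "case_sum g k ` fv ?\<theta> \<subseteq> S" using \<phi>(2) \<psi>(2) by (auto simp: fv_map)
  ultimately have "dfn L M S (\<lambda>v. sat M (v \<circ> case_sum g k) ?\<theta>)" by (rule dfn_formula)
  moreover have "v \<circ> case_sum g k \<circ> Inl = v \<circ> g" "v \<circ> case_sum g k \<circ> Inr = v \<circ> k" for v :: "'d \<Rightarrow> 'c"
    by (simp_all add: fun_eq_iff)
  ultimately show ?thesis
    by (elim dfn_cong_pred) (simp only: sat.simps sat_map \<phi>(3) \<psi>(3) inj_on_subset[OF inj_Inl subset_UNIV] inj_on_subset[OF inj_Inr subset_UNIV])
qed

text \<open>Witnessed by a sentence, so that \<open>S\<close> may be empty.\<close>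

lemma dfn_True: "dfn L M S (\<lambda>v. True)"
  by (rule dfn_cong_pred[OF dfn_mono[OF dfn_formula[OF _ subset_refl], of L
     "Neg (Ex () (Neg (Eq (Var ()) (Var ()))))" "\<lambda>_. undefined" S M]])
     auto

lemma dfn_Or: "dfn L M S P \<Longrightarrow> dfn L M S Q \<Longrightarrow> dfn L M S (\<lambda>v. P v \<or> Q v)"
  using dfn_Not[OF dfn_And[OF dfn_Not dfn_Not], of L M S P Q] by simp

lemma dfn_Imp: "dfn L M S P \<Longrightarrow> dfn L M S Q \<Longrightarrow> dfn L M S (\<lambda>v. P v \<longrightarrow> Q v)"
  by (rule dfn_cong_pred[OF dfn_Or[OF dfn_Not]]) auto

lemma dfn_Iff: "dfn L M S P \<Longrightarrow> dfn L M S Q \<Longrightarrow> dfn L M S (\<lambda>v. P v = Q v)"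
  by (rule dfn_cong_pred[OF dfn_And[OF dfn_Imp[of L M S P Q] dfn_Imp[of L M S Q P]]]) auto

lemma dfn_Ball:
  "finite A \<Longrightarrow> (\<And>a. a \<in> A \<Longrightarrow> dfn L M S (P a)) \<Longrightarrow> dfn L M S (\<lambda>v. \<forall>a \<in> A. P a v)"
  by (induction A rule: finite_induct) (simp_all add: dfn_True dfn_And)

lemma dfn_Ex:
  assumes "dfn L M S P"
  shows "dfn L M (S - {x}) (\<lambda>v. \<exists>a \<in> Dom M. P (v(x := a)))"
proof -
  obtain \<psi> :: "('a, 'b, nat) fm" and g where \<psi>: "wf_fm L \<psi>" "g ` fv \<psi> \<subseteq> S"
    "\<And>v. v ` S \<subseteq> Dom M \<Longrightarrow> P v \<longleftrightarrow> sat M (v \<circ> g) \<psi>" using assms unfolding dfn_def by blast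
  \<comment> \<open>Several variables of \<open>\<psi>\<close> may stand for \<open>x\<close>; they
    all become the bound variable 0.\<close>
  define h where "h = (\<lambda>j. if g j = x then 0 else Suc j)"
  obtain \<chi> :: "('a, 'b, nat) fm" where \<chi>: "wf_fm L \<chi>" "fv \<chi> \<subseteq> h ` fv \<psi>"
    "\<And>v. (\<And>j. j \<in> fv \<psi> \<Longrightarrow> v (h j) \<in> Dom M) \<Longrightarrow> sat M v \<chi> = sat M (v \<circ> h) \<psi>"
    by (rule formula_subst[OF \<psi>(1) infinite_UNIV_nat, of h M]) blast
  let ?g = "case_nat x g"
  have "?g ` fv (Ex 0 \<chi>) \<subseteq> S - {x}"
    using \<chi>(2) \<psi>(2) by (fastforce simp: h_def split: if_splits)
  then have "dfn L M (S - {x}) (\<lambda>v. sat M (v \<circ> ?g) (Ex 0 \<chi>))"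
    using \<chi>(1) by (intro dfn_formula) auto
  then show ?thesis
  proof (rule dfn_cong_pred)
    fix v assume v: "v ` (S - {x}) \<subseteq> Dom M"
    have "sat M ((v \<circ> ?g)(0 := a)) \<chi> = P (v(x := a))" if a: "a \<in> Dom M" for a
    proof -
      have "sat M ((v \<circ> ?g)(0 := a)) \<chi> = sat M ((v \<circ> ?g)(0 := a) \<circ> h) \<psi>"
        using v a \<psi>(2) by (intro \<chi>(3)) (auto simp: h_def)
      also have "(v \<circ> ?g)(0 := a) \<circ> h = v(x := a) \<circ> g" by (auto simp: fun_eq_iff h_def)
      also have "sat M (v(x := a) \<circ> g) \<psi> = P (v(x := a))"
        using v a by (intro \<psi>(3)[symmetric]) auto
      finally show ?thesis .
    qed
    then show "sat M (v \<circ> ?g) (Ex 0 \<chi>) = (\<exists>a \<in> Dom M. P (v(x := a)))" by simp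
  qed
qed

lemma dfn_Ex_finite:
  assumes "finite Z" "dfn L M S P"
  shows "dfn L M (S - Z) (\<lambda>v. \<exists>z. z ` Z \<subseteq> Dom M \<and> P (override_on v z Z))"
  using assms
proof (induction Z rule: finite_induct)
  case empty
  then show ?case by simp
next
  case (insert x Z)
  have "dfn L M (S - Z - {x})
    (\<lambda>v. \<exists>a \<in> Dom M. \<exists>z. z ` Z \<subseteq> Dom M \<and> P (override_on (v(x := a)) z Z))"
    using insert.IH[OF insert.prems] by (rule dfn_Ex)
  moreover have "(\<exists>a \<in> Dom M. \<exists>z. z ` Z \<subseteq> Dom M \<and> P (override_on (v(x := a)) z Z)) =
    (\<exists>z. z ` insert x Z \<subseteq> Dom M \<and> P (override_on v z (insert x Z)))" for v
  proof
    assume "\<exists>a \<in> Dom M. \<exists>z. z ` Z \<subseteq> Dom M \<and> P (override_on (v(x := a)) z Z)"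
    then obtain a z where az: "a \<in> Dom M" "z ` Z \<subseteq> Dom M" "P (override_on (v(x := a)) z Z)" by blast
    have "override_on (v(x := a)) z Z = override_on v (z(x := a)) (insert x Z)"
      using insert.hyps(2) by (auto simp: override_on_def fun_eq_iff)
    then show "\<exists>z. z ` insert x Z \<subseteq> Dom M \<and> P (override_on v z (insert x Z))"
      using az by (intro exI[of _ "z(x := a)"]) auto
  next
    assume "\<exists>z. z ` insert x Z \<subseteq> Dom M \<and> P (override_on v z (insert x Z))"
    then obtain z where z: "z ` insert x Z \<subseteq> Dom M" "P (override_on v z (insert x Z))" by blast
    have "override_on (v(x := z x)) z Z = override_on v z (insert x Z)"
      by (auto simp: override_on_def fun_eq_iff)
    then show "\<exists>a \<in> Dom M. \<exists>z. z ` Z \<subseteq> Dom M \<and> P (override_on (v(x := a)) z Z)"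
      using z by (intro bexI[of _ "z x"] exI[of _ z]) auto
  qed
  moreover have "S - Z - {x} = S - insert x Z" by auto
  ultimately show ?case by simp
qed

section \<open>Equality of types of assignments\<close>

text \<open>The assignments realize the same complete type in the variables \<open>S\<close>.
  Parameters enter as variables on which both assignments agree.\<close>

definition tpeq :: "('f, 'r) lang \<Rightarrow> ('f, 'r, 'u) struct \<Rightarrow> 'v set \<Rightarrow> ('v \<Rightarrow> 'u) \<Rightarrow> ('v \<Rightarrow> 'u) \<Rightarrow> bool" where
  "tpeq L M S v w \<longleftrightarrow> v ` S \<subseteq> Dom M \<and> w ` S \<subseteq> Dom M \<and> (\<forall>P. dfn L M S P \<longrightarrow> P v = P w)"

lemma tpeqD: "tpeq L M S v w \<Longrightarrow> dfn L M S P \<Longrightarrow> P v = P w"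
  by (simp add: tpeq_def)

lemma tpeq_dom: "tpeq L M S v w \<Longrightarrow> v ` S \<subseteq> Dom M" "tpeq L M S v w \<Longrightarrow> w ` S \<subseteq> Dom M"
  by (simp_all add: tpeq_def)

text \<open>One direction suffices, as it can also be applied to the negated predicate.\<close>

lemma tpeqI:
  assumes "v ` S \<subseteq> Dom M" "w ` S \<subseteq> Dom M" "\<And>P. dfn L M S P \<Longrightarrow> P v \<Longrightarrow> P w"
  shows "tpeq L M S v w"
proof -
  have "P v = P w" if "dfn L M S P" for P
    using assms(3)[OF that] assms(3)[OF dfn_Not[OF that]] by (cases "P v") simp_all
  then show ?thesis using assms(1,2) by (simp add: tpeq_def)
qed

lemma tpeq_mono:
  assumes "tpeq L M S v w" "S' \<subseteq> S"
  shows "tpeq L M S' v w"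
proof (rule tpeqI)
  show "v ` S' \<subseteq> Dom M" "w ` S' \<subseteq> Dom M" using tpeq_dom[OF assms(1)] assms(2) by blast+
  show "P w" if "dfn L M S' P" "P v" for P
    using tpeqD[OF assms(1) dfn_mono[OF that(1) assms(2)]] that(2) by simp
qed

lemma tpeq_sym:
  assumes "tpeq L M S v w"
  shows "tpeq L M S w v"
  by (rule tpeqI) (simp_all add: tpeq_dom[OF assms] tpeqD[OF assms])

lemma tpeq_trans:
  assumes "tpeq L M S v w" "tpeq L M S w x"
  shows "tpeq L M S v x"
  by (rule tpeqI) (simp_all add: tpeq_dom[OF assms(1)] tpeq_dom[OF assms(2)]
     tpeqD[OF assms(1)] tpeqD[OF assms(2)])

lemma tpeq_subst:
  assumes "tpeq L M S v w" "h ` S' \<subseteq> S"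
  shows "tpeq L M S' (v \<circ> h) (w \<circ> h)"
proof (rule tpeqI)
  show "(v \<circ> h) ` S' \<subseteq> Dom M" "(w \<circ> h) ` S' \<subseteq> Dom M"
    using tpeq_dom[OF assms(1)] assms(2) by (simp_all add: image_subset_iff)
  show "P (w \<circ> h)" if "dfn L M S' P" "P (v \<circ> h)" for P
    using tpeqD[OF assms(1) dfn_subst'[OF that(1) assms(2)]] that(2) by simp
qed

lemma tpeq_cong:
  assumes "tpeq L M S v w" "\<And>x. x \<in> S \<Longrightarrow> v x = v' x" "\<And>x. x \<in> S \<Longrightarrow> w x = w' x"
  shows "tpeq L M S v' w'"
proof (rule tpeqI)
  show "v' ` S \<subseteq> Dom M" "w' ` S \<subseteq> Dom M"
    using tpeq_dom[OF assms(1)] assms(2,3) by (auto simp: image_subset_iff)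
  show "P w'" if P: "dfn L M S P" "P v'" for P
  proof -
    have "P v = P v'" by (rule dfn_cong[OF P(1) tpeq_dom(1)[OF assms(1)] assms(2)])
    moreover have "P w = P w'" by (rule dfn_cong[OF P(1) tpeq_dom(2)[OF assms(1)] assms(3)])
    ultimately show ?thesis using tpeqD[OF assms(1) P(1)] P(2) by simp
  qed
qed

lemma tpeq_refl:
  assumes "v ` S \<subseteq> Dom M" "\<And>x. x \<in> S \<Longrightarrow> v x = w x"
  shows "tpeq L M S v w"
proof (rule tpeq_cong[of L M S v v])
  show "tpeq L M S v v" using assms(1) by (simp add: tpeq_def)
qed (use assms(2) in simp_all)

lemma override_on_image_subset:
  assumes "v ` S \<subseteq> D" "w ` V \<subseteq> D" "S0 \<subseteq> S \<union> V"
  shows "override_on v w V ` S0 \<subseteq> D"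
proof (rule image_subsetI)
  fix x assume "x \<in> S0"
  then have "x \<in> V \<or> x \<in> S" using assms(3) by auto
  then show "override_on v w V x \<in> D" using assms(1,2) by (cases "x \<in> V") auto
qed

section \<open>Saturation, smallness and compactness\<close>

locale saturated_structure =
  fixes L :: "('f, 'r) lang" and U :: "('f, 'r, 'u) struct" and \<mu> :: "'c rel"
  assumes struct: "is_struct L U" and card_order: "Card_order \<mu>"
    and formulas_small: "|{\<phi> :: ('f, 'r, nat) fm. wf_fm L \<phi>}| <o \<mu>"
    and saturation: "saturated L U \<mu>"
begin

lemma Dom_nonempty: "Dom U \<noteq> {}"
  using struct by (simp add: is_struct_def)

lemma nat_small: "|UNIV :: nat set| <o \<mu>"
proof -
  let ?f = "\<lambda>n :: nat. Eq (Var n) (Var n) :: ('f, 'r, nat) fm"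
  have "|UNIV :: nat set| \<le>o |{\<phi> :: ('f, 'r, nat) fm. wf_fm L \<phi>}|"
    by (rule card_of_ordLeqI[of ?f]) (auto simp: inj_on_def)
  then show ?thesis using formulas_small by (rule ordLeq_ordLess_trans)
qed

lemma infinite_Field: "\<not> finite (Field \<mu>)"
proof
  assume "finite (Field \<mu>)"
  moreover have "|UNIV :: nat set| \<le>o |Field \<mu>|"
    using nat_small card_of_Field_ordIso[OF card_order]
    by (meson ordIso_symmetric ordLess_imp_ordLeq ordLeq_ordIso_trans)
  ultimately have "finite (UNIV :: nat set)" by (rule card_of_ordLeq_finite[rotated])
  then show False by simp
qed

lemma small_Un: "|A| <o \<mu> \<Longrightarrow> |B| <o \<mu> \<Longrightarrow> |A \<union> B| <o \<mu>"
  using card_of_Un_ordLess_infinite_Field[OF infinite_Field card_order] .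

lemma small_image: "|A| <o \<mu> \<Longrightarrow> |f ` A| <o \<mu>"
  using card_of_image ordLeq_ordLess_trans by blast

lemma small_subset: "|B| <o \<mu> \<Longrightarrow> A \<subseteq> B \<Longrightarrow> |A| <o \<mu>"
  using card_of_mono1 ordLeq_ordLess_trans by blast

lemma small_Plus:
  assumes "|A| <o \<mu>" "|B| <o \<mu>"
  shows "|A <+> B| <o \<mu>"
proof -
  have "A <+> B = Inl ` A \<union> Inr ` B" by auto
  then show ?thesis using assms small_Un small_image by metis
qed

lemma small_UN_countable:
  assumes "|A| <o \<mu>" "\<And>a. a \<in> A \<Longrightarrow> |B a| \<le>o |UNIV :: nat set|"
  shows "|\<Union>a \<in> A. B a| <o \<mu>"
proof -
  let ?C = "A <+> (UNIV :: nat set)"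
  have "|?C| <o \<mu>" using assms(1) nat_small by (rule small_Plus)
  moreover have "|\<Union>a \<in> A. B a| \<le>o |?C|"
  proof (rule card_of_UNION_ordLeq_infinite)
    show "\<not> finite ?C" by (metis finite_Plus_iff infinite_UNIV_nat)
    show "|A| \<le>o |?C|" by (rule card_of_Plus1)
    show "\<forall>a \<in> A. |B a| \<le>o |?C|" using assms(2) card_of_Plus2 ordLeq_transitive by blast
  qed
  ultimately show ?thesis by (rule ordLeq_ordLess_trans[rotated])
qed

lemma small_countable:
  assumes "inj_on f A" "f ` A \<subseteq> (UNIV :: nat set)"
  shows "|A| <o \<mu>"
  using card_of_ordLeqI[OF assms(1), of UNIV] nat_small assms(2) ordLeq_ordLess_trans by blast

lemma small_finite: "finite A \<Longrightarrow> |A| <o \<mu>"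
  using finite_imp_inj_to_nat_seg[of A] small_countable by blast

text \<open>Saturation speaks of one variable only, so the variables in \<open>V\<close> are given
  values one at a time. By Zorn there is a maximal partial assignment that keeps
  \<open>\<Phi>\<close> finitely satisfiable. It is total, since the possible values of one more
  variable are described by a 1-type over fewer than \<open>\<mu>\<close> parameters.\<close>

lemma compactness:
  fixes \<Phi> :: "(('v \<Rightarrow> 'u) \<Rightarrow> bool) set"
  assumes \<Phi>: "\<And>P. P \<in> \<Phi> \<Longrightarrow> dfn L U (S \<union> V) P"
    and small: "|S| <o \<mu>" "|V| <o \<mu>" and v0: "v0 ` S \<subseteq> Dom U"
    and fs: "\<And>\<Phi>0. finite \<Phi>0 \<Longrightarrow> \<Phi>0 \<subseteq> \<Phi> \<Longrightarrow>
      \<exists>w. w ` V \<subseteq> Dom U \<and> (\<forall>P \<in> \<Phi>0. P (override_on v0 w V))"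
  obtains w where "w ` V \<subseteq> Dom U" "\<And>P. P \<in> \<Phi> \<Longrightarrow> P (override_on v0 w V)"
proof -
  \<comment> \<open>Partial assignments are graphs. Only finitely many of their values are tested at
    a time, so unions of chains stay finitely satisfiable.\<close>
  define FS where "FS = (\<lambda>G. G \<subseteq> V \<times> Dom U \<and>
    (\<forall>\<Phi>0 G0. finite \<Phi>0 \<and> \<Phi>0 \<subseteq> \<Phi> \<and> finite G0 \<and> G0 \<subseteq> G \<longrightarrow>
      (\<exists>w. w ` V \<subseteq> Dom U \<and> (\<forall>(x, a) \<in> G0. w x = a) \<and> (\<forall>P \<in> \<Phi>0. P (override_on v0 w V)))))"
  have FSD: "\<exists>w. w ` V \<subseteq> Dom U \<and> (\<forall>(x, a) \<in> G0. w x = a) \<and> (\<forall>P \<in> \<Phi>0. P (override_on v0 w V))"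
    if "FS G" "finite \<Phi>0" "\<Phi>0 \<subseteq> \<Phi>" "finite G0" "G0 \<subseteq> G" for G \<Phi>0 G0
    using that unfolding FS_def by blast
  have "FS {}" unfolding FS_def using fs by simp
  have chain: "\<Union> \<C> \<in> Collect FS" if \<C>: "subset.chain (Collect FS) \<C>" for \<C>
  proof (cases "\<C> = {}")
    case True
    then show ?thesis using \<open>FS {}\<close> by simp
  next
    case False
    have FC: "FS G" if "G \<in> \<C>" for G using \<C> that unfolding subset.chain_def by auto
    have "\<exists>w. w ` V \<subseteq> Dom U \<and> (\<forall>(x, a) \<in> G0. w x = a) \<and> (\<forall>P \<in> \<Phi>0. P (override_on v0 w V))"
      if a: "finite \<Phi>0" "\<Phi>0 \<subseteq> \<Phi>" "finite G0" "G0 \<subseteq> \<Union> \<C>" for \<Phi>0 G0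
    proof -
      obtain G where "G \<in> \<C>" "G0 \<subseteq> G"
        using finite_subset_Union_chain[OF a(3,4) False \<C>] by blast
      then show ?thesis using FSD[OF FC[OF \<open>G \<in> \<C>\<close>] a(1-3)] by simp
    qed
    moreover have "\<Union> \<C> \<subseteq> V \<times> Dom U" using FC unfolding FS_def by blast
    ultimately show ?thesis unfolding FS_def by simp
  qed
  obtain G where G: "FS G" and max: "\<And>G'. FS G' \<Longrightarrow> G \<subseteq> G' \<Longrightarrow> G' = G"
    using subset_Zorn'[OF chain] by auto
  have GV: "G \<subseteq> V \<times> Dom U" using G unfolding FS_def by blast
  have single: "a = b" if "(x, a) \<in> G" "(x, b) \<in> G" for x a b
    using FSD[OF G, of "{}" "{(x, a), (x, b)}"] that by auto
  define m where "m = (\<lambda>x. SOME a. (x, a) \<in> G)"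
  have m: "(x, m x) \<in> G" if "x \<in> fst ` G" for x
    using that unfolding m_def by (auto intro: someI)
  have m_eq: "m x = a" if "(x, a) \<in> G" for x a
    using single[OF m that] that by force
  have m_snd: "m x \<in> snd ` G" if "x \<in> fst ` G" for x
    using imageI[OF m[OF that], of snd] by simp
  have m_Dom: "m x \<in> Dom U" if "x \<in> fst ` G" for x
    using GV m[OF that] by auto
  have supp: "\<exists>S0 P'. finite S0 \<and> S0 \<subseteq> S \<union> V \<and> dfn L U S0 P' \<and>
      (\<forall>w. w ` V \<subseteq> Dom U \<longrightarrow> (\<forall>P \<in> \<Phi>0. P (override_on v0 w V)) = P' (override_on v0 w V))"
    if "finite \<Phi>0" "\<Phi>0 \<subseteq> \<Phi>" for \<Phi>0
  proof -
    have "dfn L U (S \<union> V) (\<lambda>v. \<forall>P \<in> \<Phi>0. P v)"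
      using that by (intro dfn_Ball[of _ L U _ "\<lambda>P. P"]) (auto intro: \<Phi>)
    then obtain S0 P' where "finite S0" "S0 \<subseteq> S \<union> V" "dfn L U S0 P'"
      and e: "\<And>v. v ` (S \<union> V) \<subseteq> Dom U \<Longrightarrow> (\<forall>P \<in> \<Phi>0. P v) = P' v"
      by (rule dfn_finite) blast
    moreover have "override_on v0 w V ` (S \<union> V) \<subseteq> Dom U" if "w ` V \<subseteq> Dom U" for w
      using that v0 by (auto simp: override_on_def)
    ultimately show ?thesis by (intro exI[of _ S0] exI[of _ P']) simp
  qed
  have "V \<subseteq> fst ` G"
  proof (rule ccontr)
    assume "\<not> V \<subseteq> fst ` G"
    then obtain x where x: "x \<in> V" "x \<notin> fst ` G" by blast
    let ?C = "v0 ` (S - V) \<union> snd ` G"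
    have C: "?C \<subseteq> Dom U" using v0 GV by auto
    have "|G| \<le>o |V|"
      by (rule card_of_ordLeqI[of fst]) (use GV single in \<open>auto simp: inj_on_def\<close>)
    then have "|G| <o \<mu>" using small(2) ordLeq_ordLess_trans by blast
    then have Csmall: "|?C| <o \<mu>" using small_subset[OF small(1)] by (intro small_Un small_image) auto
    let ?S1 = "(S - V) \<union> fst ` G \<union> {x}"
    \<comment> \<open>The variable \<open>x\<close> becomes the variable of the 1-type; all others
      that may occur free become parameters, with the value from \<open>G\<close> or from
      \<open>v0\<close>.\<close>
    define h where "h = (\<lambda>y. if y = x then Inl (0 :: nat) else if y \<in> fst ` G then Inr (m y) else Inr (v0 y))"
    have hS1: "h ` ?S1 \<subseteq> Inl ` {0} \<union> Inr ` ?C"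
      using m_snd by (auto simp: h_def)
    \<comment> \<open>The formula in the triple says that the variables still without value, other
      than \<open>x\<close>, can be filled so that \<open>\<Phi>0\<close> holds. The finite support
      \<open>S0\<close> leaves only finitely many of them to quantify.\<close>
    define good where "good = (\<lambda>\<Phi>0 (\<psi> :: ('f, 'r, nat + 'u) fm, S0, P'). wf_fm L \<psi> \<and>
      fv \<psi> \<subseteq> Inl ` {0} \<union> Inr ` ?C \<and> finite S0 \<and> S0 \<subseteq> S \<union> V \<and> dfn L U S0 P' \<and>
      (\<forall>w. w ` V \<subseteq> Dom U \<longrightarrow> (\<forall>P \<in> \<Phi>0. P (override_on v0 w V)) = P' (override_on v0 w V)) \<and>
      (\<forall>a \<in> Dom U. sat U (case_sum (\<lambda>_. a) id) \<psi> =
        (\<exists>z. z ` (S0 \<inter> V - fst ` G - {x}) \<subseteq> Dom U \<and>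
           P' (override_on (case_sum (\<lambda>_. a) id \<circ> h) z (S0 \<inter> V - fst ` G - {x})))))"
    have ex_good: "\<exists>t. good \<Phi>0 t" if \<Phi>0: "finite \<Phi>0" "\<Phi>0 \<subseteq> \<Phi>" for \<Phi>0
    proof -
      obtain S0 P' where S0: "finite S0" "S0 \<subseteq> S \<union> V" "dfn L U S0 P'"
        "\<forall>w. w ` V \<subseteq> Dom U \<longrightarrow> (\<forall>P \<in> \<Phi>0. P (override_on v0 w V)) = P' (override_on v0 w V)"
        using supp[OF \<Phi>0] by blast
      let ?Z = "S0 \<inter> V - fst ` G - {x}"
      have "dfn L U (S0 - ?Z) (\<lambda>v. \<exists>z. z ` ?Z \<subseteq> Dom U \<and> P' (override_on v z ?Z))"
        using S0(1,3) by (intro dfn_Ex_finite) auto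
      then have "dfn L U ?S1 (\<lambda>v. \<exists>z. z ` ?Z \<subseteq> Dom U \<and> P' (override_on v z ?Z))"
        by (rule dfn_mono) (use S0(2) in auto)
      moreover have "infinite (UNIV :: (nat + 'u) set)" by (simp add: finite_Plus_UNIV_iff)
      ultimately obtain \<psi> :: "('f, 'r, nat + 'u) fm" where \<psi>: "wf_fm L \<psi>" "fv \<psi> \<subseteq> h ` ?S1"
        "\<And>v. v ` h ` ?S1 \<subseteq> Dom U \<Longrightarrow>
          sat U v \<psi> = (\<exists>z. z ` ?Z \<subseteq> Dom U \<and> P' (override_on (v \<circ> h) z ?Z))"
        by (rule dfn_to_formula[where h = h]) blast
      have "case_sum (\<lambda>_. a) id ` h ` ?S1 \<subseteq> Dom U" if "a \<in> Dom U" for a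
      proof -
        have "case_sum (\<lambda>_. a) id ` h ` ?S1 \<subseteq> case_sum (\<lambda>_. a) id ` (Inl ` {0 :: nat} \<union> Inr ` ?C)"
          using hS1 by (rule image_mono)
        also have "\<dots> \<subseteq> Dom U" using C that by auto
        finally show ?thesis .
      qed
      then have "good \<Phi>0 (\<psi>, S0, P')" unfolding good_def
        using \<psi>(1) subset_trans[OF \<psi>(2) hS1] S0 by (simp add: \<psi>(3))
      then show ?thesis by (rule exI)
    qed
    define \<psi> where "\<psi> = (\<lambda>\<Phi>0. fst (SOME t. good \<Phi>0 t))"
    define S0 where "S0 = (\<lambda>\<Phi>0. fst (snd (SOME t. good \<Phi>0 t)))"
    define P' where "P' = (\<lambda>\<Phi>0. snd (snd (SOME t. good \<Phi>0 t)))"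
    have "good \<Phi>0 (\<psi> \<Phi>0, S0 \<Phi>0, P' \<Phi>0)" if "finite \<Phi>0" "\<Phi>0 \<subseteq> \<Phi>" for \<Phi>0
      using someI_ex[OF ex_good[OF that]] by (simp add: \<psi>_def S0_def P'_def)
    note g = this[unfolded good_def prod.case]
    have \<psi>: "\<And>\<Phi>0. finite \<Phi>0 \<Longrightarrow> \<Phi>0 \<subseteq> \<Phi> \<Longrightarrow> wf_fm L (\<psi> \<Phi>0)"
        "\<And>\<Phi>0. finite \<Phi>0 \<Longrightarrow> \<Phi>0 \<subseteq> \<Phi> \<Longrightarrow> fv (\<psi> \<Phi>0) \<subseteq> Inl ` {0} \<union> Inr ` ?C"
        "\<And>\<Phi>0. finite \<Phi>0 \<Longrightarrow> \<Phi>0 \<subseteq> \<Phi> \<Longrightarrow> finite (S0 \<Phi>0)"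
        "\<And>\<Phi>0. finite \<Phi>0 \<Longrightarrow> \<Phi>0 \<subseteq> \<Phi> \<Longrightarrow> S0 \<Phi>0 \<subseteq> S \<union> V"
        "\<And>\<Phi>0. finite \<Phi>0 \<Longrightarrow> \<Phi>0 \<subseteq> \<Phi> \<Longrightarrow> dfn L U (S0 \<Phi>0) (P' \<Phi>0)"
        "\<And>\<Phi>0 w. finite \<Phi>0 \<Longrightarrow> \<Phi>0 \<subseteq> \<Phi> \<Longrightarrow> w ` V \<subseteq> Dom U \<Longrightarrow>
          (\<forall>P \<in> \<Phi>0. P (override_on v0 w V)) = P' \<Phi>0 (override_on v0 w V)"
        "\<And>\<Phi>0 a. finite \<Phi>0 \<Longrightarrow> \<Phi>0 \<subseteq> \<Phi> \<Longrightarrow> a \<in> Dom U \<Longrightarrow> sat U (case_sum (\<lambda>_. a) id) (\<psi> \<Phi>0) =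
          (\<exists>z. z ` (S0 \<Phi>0 \<inter> V - fst ` G - {x}) \<subseteq> Dom U \<and>
             P' \<Phi>0 (override_on (case_sum (\<lambda>_. a) id \<circ> h) z (S0 \<Phi>0 \<inter> V - fst ` G - {x})))"
      using g by simp_all
    have agree: "P' \<Phi>0 (override_on (case_sum (\<lambda>_. a) id \<circ> h) z (S0 \<Phi>0 \<inter> V - fst ` G - {x})) =
        P' \<Phi>0 (override_on v0 w V)"
      if "finite \<Phi>0" "\<Phi>0 \<subseteq> \<Phi>" "w ` V \<subseteq> Dom U" "w x = a"
        "\<And>y. y \<in> fst ` G \<Longrightarrow> y \<in> S0 \<Phi>0 \<Longrightarrow> w y = m y"
        "\<And>y. y \<in> S0 \<Phi>0 \<inter> V - fst ` G - {x} \<Longrightarrow> w y = z y" for \<Phi>0 a w z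
    proof -
      have gV: "fst ` G \<subseteq> V" using GV by auto
      have "P' \<Phi>0 (override_on v0 w V) =
        P' \<Phi>0 (override_on (case_sum (\<lambda>_. a) id \<circ> h) z (S0 \<Phi>0 \<inter> V - fst ` G - {x}))"
      proof (rule dfn_cong[OF \<psi>(5)[OF that(1,2)]])
        show "override_on v0 w V ` S0 \<Phi>0 \<subseteq> Dom U"
          by (rule override_on_image_subset[OF v0 that(3) \<psi>(4)[OF that(1,2)]])
        fix y assume y: "y \<in> S0 \<Phi>0"
        show "override_on v0 w V y =
          override_on (case_sum (\<lambda>_. a) id \<circ> h) z (S0 \<Phi>0 \<inter> V - fst ` G - {x}) y"
          using that(4) that(5)[OF _ y] that(6)[of y] y x gV
          by (auto simp: override_on_def h_def)
      qed
      then show ?thesis by simp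
    qed
    define p where "p = \<psi> ` {\<Phi>0. finite \<Phi>0 \<and> \<Phi>0 \<subseteq> \<Phi>}"
    have "partial_type L U {0} ?C p"
      unfolding partial_type_def
    proof (intro conjI allI impI)
      show "p \<subseteq> pfms L {0} ?C" using \<psi>(1,2) by (auto simp: p_def pfms_def)
      fix q assume "finite q \<and> q \<subseteq> p"
      then obtain \<F> where \<F>: "finite \<F>" "\<F> \<subseteq> {\<Phi>0. finite \<Phi>0 \<and> \<Phi>0 \<subseteq> \<Phi>}" "q = \<psi> ` \<F>"
        unfolding p_def by (meson finite_subset_image)
      have u: "finite (\<Union> \<F>)" "\<Union> \<F> \<subseteq> \<Phi>" using \<F> by auto
      have f0: "finite {(y, m y) | y. y \<in> fst ` G \<and> y \<in> (\<Union>\<Phi>0 \<in> \<F>. S0 \<Phi>0)}" (is "finite ?G0")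
      proof (rule finite_subset)
        show "?G0 \<subseteq> (\<lambda>y. (y, m y)) ` (\<Union>\<Phi>0 \<in> \<F>. S0 \<Phi>0)" by auto
        show "finite ((\<lambda>y. (y, m y)) ` (\<Union>\<Phi>0 \<in> \<F>. S0 \<Phi>0))" 
          using \<F>(1,2) \<psi>(3) by (intro finite_imageI finite_UN_I) auto
      qed
      have g0: "?G0 \<subseteq> G" using m by auto
      obtain w where w: "w ` V \<subseteq> Dom U" "\<forall>(y, a) \<in> ?G0. w y = a"
        "\<forall>P \<in> \<Union> \<F>. P (override_on v0 w V)"
        using FSD[OF G u f0 g0] by (elim exE conjE) (rule that)
      have wx: "w x \<in> Dom U" using w(1) x(1) by auto
      have "psat U (\<lambda>_. w x) \<phi>" if \<phi>q: "\<phi> \<in> q" for \<phi>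
      proof -
        obtain \<Phi>0 where \<Phi>0: "\<Phi>0 \<in> \<F>" "\<phi> = \<psi> \<Phi>0" using \<F>(3) \<phi>q by auto
        then have f: "finite \<Phi>0" "\<Phi>0 \<subseteq> \<Phi>" using \<F>(2) by auto
        have "P' \<Phi>0 (override_on v0 w V)" using \<psi>(6)[OF f w(1)] w(3) \<Phi>0(1) by blast
        moreover have "P' \<Phi>0 (override_on (case_sum (\<lambda>_. w x) id \<circ> h) w (S0 \<Phi>0 \<inter> V - fst ` G - {x}))
            = P' \<Phi>0 (override_on v0 w V)"
          using w(2) \<Phi>0(1) by (intro agree[OF f w(1)]) auto
        moreover have "w ` (S0 \<Phi>0 \<inter> V - fst ` G - {x}) \<subseteq> Dom U" using w(1) by auto
        ultimately show ?thesis unfolding psat_def \<Phi>0(2) \<psi>(7)[OF f wx] by blast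
      qed
      then show "\<exists>a. realizes U {0} a q"
        using wx by (intro exI[of _ "\<lambda>_. w x"]) (auto simp: realizes_def tuples_def)
    qed
    then obtain a where a: "realizes U {0} a p"
      using saturation C Csmall unfolding saturated_def by blast
    then have a0: "a 0 \<in> Dom U" by (simp add: realizes_def tuples_def)
    obtain d0 where d0: "d0 \<in> Dom U" using Dom_nonempty by blast
    \<comment> \<open>A realization of the 1-type extends \<open>G\<close>, against
      maximality.\<close>
    have "FS (insert (x, a 0) G)"
      unfolding FS_def
    proof (intro conjI allI impI)
      show "insert (x, a 0) G \<subseteq> V \<times> Dom U" using GV x(1) a0 by auto
      fix \<Phi>0 G0 assume "finite \<Phi>0 \<and> \<Phi>0 \<subseteq> \<Phi> \<and> finite G0 \<and> G0 \<subseteq> insert (x, a 0) G"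
      then have f: "finite \<Phi>0" "\<Phi>0 \<subseteq> \<Phi>" and G0: "G0 \<subseteq> insert (x, a 0) G" by auto
      have "psat U a (\<psi> \<Phi>0)" using a f unfolding realizes_def p_def by blast
      moreover have "sat U (case_sum a id) (\<psi> \<Phi>0) = sat U (case_sum (\<lambda>_. a 0) id) (\<psi> \<Phi>0)"
        using \<psi>(2)[OF f] by (intro sat_cong) auto
      ultimately obtain z where z: "z ` (S0 \<Phi>0 \<inter> V - fst ` G - {x}) \<subseteq> Dom U"
        "P' \<Phi>0 (override_on (case_sum (\<lambda>_. a 0) id \<circ> h) z (S0 \<Phi>0 \<inter> V - fst ` G - {x}))"
        unfolding psat_def \<psi>(7)[OF f a0] by blast
      define w where "w = (\<lambda>y. if y \<in> S0 \<Phi>0 \<inter> V - fst ` G - {x} then z y else if y = x then a 0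
        else if y \<in> fst ` G then m y else d0)"
      have w: "w ` V \<subseteq> Dom U" using z(1) a0 d0 m_Dom by (auto simp: w_def)
      have wG: "w y = b" if "(y, b) \<in> G0" for y b
      proof (cases "(y, b) \<in> G")
        case True
        then have "y \<in> fst ` G" by force
        then show ?thesis using x(2) m_eq[OF True] by (auto simp: w_def)
      next
        case False
        then show ?thesis using that G0 by (auto simp: w_def)
      qed
      have "w x = a 0" by (simp add: w_def)
      moreover have "w y = m y" if "y \<in> fst ` G" for y using that x(2) by (auto simp: w_def)
      moreover have "w y = z y" if "y \<in> S0 \<Phi>0 \<inter> V - fst ` G - {x}" for y
        using that by (simp add: w_def)
      ultimately have "P' \<Phi>0 (override_on v0 w V)" using z(2) agree[OF f w] by simp
      then have "\<forall>P \<in> \<Phi>0. P (override_on v0 w V)" using \<psi>(6)[OF f w] by blast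
      then show "\<exists>w. w ` V \<subseteq> Dom U \<and> (\<forall>(x, a) \<in> G0. w x = a) \<and> (\<forall>P \<in> \<Phi>0. P (override_on v0 w V))"
        using w wG by blast
    qed
    from max[OF this] have "(x, a 0) \<in> G" by blast
    then show False using x(2) by force
  qed
  then have mV: "m ` V \<subseteq> Dom U" using m_Dom by auto
  show ?thesis
  proof (rule that[OF mV])
    fix P assume P: "P \<in> \<Phi>"
    then obtain S0 P' where S0: "finite S0" "S0 \<subseteq> S \<union> V" "dfn L U S0 P'"
      "\<And>w. w ` V \<subseteq> Dom U \<Longrightarrow> P (override_on v0 w V) = P' (override_on v0 w V)"
      using supp[of "{P}"] by auto
    have fg: "finite ((\<lambda>y. (y, m y)) ` (S0 \<inter> V))" "(\<lambda>y. (y, m y)) ` (S0 \<inter> V) \<subseteq> G"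
      using S0(1) m subsetD[OF \<open>V \<subseteq> fst ` G\<close>] by auto
    have "finite {P}" "{P} \<subseteq> \<Phi>" using P by simp_all
    from FSD[OF G this fg] obtain w where w: "w ` V \<subseteq> Dom U" "\<forall>(y, a) \<in> (\<lambda>y. (y, m y)) ` (S0 \<inter> V). w y = a"
        "\<forall>P \<in> {P}. P (override_on v0 w V)"
      by (elim exE conjE) (rule that)
    have "P' (override_on v0 w V) = P' (override_on v0 m V)"
    proof (rule dfn_cong[OF S0(3)])
      show "override_on v0 w V ` S0 \<subseteq> Dom U" by (rule override_on_image_subset[OF v0 w(1) S0(2)])
      show "override_on v0 w V y = override_on v0 m V y" if "y \<in> S0" for y
        using w(2) that by (auto simp: override_on_def)
    qed
    then show "P (override_on v0 m V)" using S0(4) w mV by simp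
  qed
qed

text \<open>Homogeneity by compactness: finitely many predicates true of \<open>v\<close> on
  \<open>S \<union> V\<close> become one predicate on \<open>S\<close> when the finitely many
  variables from \<open>V\<close> in them are quantified, and this passes to
  \<open>w\<close>.\<close>

lemma extension:
  assumes vw: "tpeq L U S v w" and v: "v ` V \<subseteq> Dom U" and small: "|S| <o \<mu>" "|V| <o \<mu>" and "S \<inter> V = {}"
  obtains w' where "tpeq L U (S \<union> V) v w'" "\<And>x. x \<notin> V \<Longrightarrow> w' x = w x"
proof -
  let ?\<Phi> = "{P. dfn L U (S \<union> V) P \<and> P v}"
  have vd: "v ` (S \<union> V) \<subseteq> Dom U" using tpeq_dom(1)[OF vw] v by auto
  obtain u where u: "u ` V \<subseteq> Dom U" "\<And>P. P \<in> ?\<Phi> \<Longrightarrow> P (override_on w u V)"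
  proof (rule compactness[of ?\<Phi> S V w])
    fix \<Phi>0 assume \<Phi>0: "finite \<Phi>0" "\<Phi>0 \<subseteq> ?\<Phi>"
    have "dfn L U (S \<union> V) (\<lambda>v. \<forall>P \<in> \<Phi>0. P v)"
      using dfn_Ball[OF \<Phi>0(1), of L U "S \<union> V" "\<lambda>P. P"] \<Phi>0(2) by blast
    then obtain S0 P' where S0: "finite S0" "S0 \<subseteq> S \<union> V" "dfn L U S0 P'"
      and e: "\<And>v. v ` (S \<union> V) \<subseteq> Dom U \<Longrightarrow> (\<forall>P \<in> \<Phi>0. P v) = P' v"
      by (rule dfn_finite) blast
    let ?Z = "S0 \<inter> V"
    let ?Q = "\<lambda>v. \<exists>z. z ` ?Z \<subseteq> Dom U \<and> P' (override_on v z ?Z)"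
    have "dfn L U (S0 - ?Z) ?Q" using S0(1,3) by (intro dfn_Ex_finite) auto
    then have Q: "dfn L U S ?Q" by (rule dfn_mono) (use S0(2) in auto)
    have "(\<forall>P \<in> \<Phi>0. P v)" using \<Phi>0(2) by blast
    then have "P' (override_on v v ?Z)" using e[OF vd] by (simp add: override_on_def)
    then have "?Q v" using v by blast
    then have "?Q w" using tpeqD[OF vw Q] by simp
    then obtain z where z: "z ` ?Z \<subseteq> Dom U" "P' (override_on w z ?Z)" by blast
    obtain d0 where d0: "d0 \<in> Dom U" using Dom_nonempty by blast
    define u where "u = override_on (\<lambda>_. d0) z ?Z"
    have u: "u ` V \<subseteq> Dom U" using z d0 by (auto simp: u_def override_on_def)
    have "P' (override_on w z ?Z) = P' (override_on w u V)"
    proof (rule dfn_cong[OF S0(3)])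
      show "override_on w z ?Z ` S0 \<subseteq> Dom U"
        by (rule override_on_image_subset[OF tpeq_dom(2)[OF vw] z(1)]) (use S0(2) in auto)
    qed (auto simp: u_def override_on_def)
    moreover have "override_on w u V ` (S \<union> V) \<subseteq> Dom U"
      using u tpeq_dom(2)[OF vw] by (auto simp: override_on_def)
    ultimately show "\<exists>w'. w' ` V \<subseteq> Dom U \<and> (\<forall>P \<in> \<Phi>0. P (override_on w w' V))"
      using e z(2) u by (intro exI[of _ u]) simp
  qed (use small tpeq_dom(2)[OF vw] in auto)
  show ?thesis
  proof (rule that)
    show "tpeq L U (S \<union> V) v (override_on w u V)"
    proof (rule tpeqI[OF vd])
      show "override_on w u V ` (S \<union> V) \<subseteq> Dom U"
        using u(1) tpeq_dom(2)[OF vw] by (auto simp: override_on_def)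
      show "P (override_on w u V)" if "dfn L U (S \<union> V) P" "P v" for P
        using u(2)[of P] that by simp
    qed
  qed simp
qed

end

section \<open>Shattering and the finite form of NIP\<close>

text \<open>The variables in \<open>Z\<close> act as the second group of variables of a partitioned
  formula; all other values come from \<open>w l\<close>.\<close>

definition shatters :: "('f, 'r, 'u) struct \<Rightarrow> 'v set \<Rightarrow> (('v \<Rightarrow> 'u) \<Rightarrow> bool) \<Rightarrow> ('l \<Rightarrow> 'v \<Rightarrow> 'u) \<Rightarrow> 'l set \<Rightarrow> bool" where
  "shatters M Z P w \<Lambda> \<longleftrightarrow> (\<forall>T \<subseteq> \<Lambda>. \<exists>z. z ` Z \<subseteq> Dom M \<and> (\<forall>l \<in> \<Lambda>. P (override_on (w l) z Z) \<longleftrightarrow> l \<in> T))"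

lemma shattersD:
  assumes "shatters M Z P w \<Lambda>" "T \<subseteq> \<Lambda>"
  obtains z where "z ` Z \<subseteq> Dom M" "\<And>l. l \<in> \<Lambda> \<Longrightarrow> P (override_on (w l) z Z) \<longleftrightarrow> l \<in> T"
proof -
  have "\<exists>z. z ` Z \<subseteq> Dom M \<and> (\<forall>l \<in> \<Lambda>. P (override_on (w l) z Z) \<longleftrightarrow> l \<in> T)"
    using assms unfolding shatters_def by simp
  then show ?thesis using that by (elim exE conjE) simp
qed

definition nip_bound :: "('f, 'r, 'u) struct \<Rightarrow> 'v set \<Rightarrow> 'v set \<Rightarrow> (('v \<Rightarrow> 'u) \<Rightarrow> bool) \<Rightarrow> nat \<Rightarrow> bool" where
  "nip_bound M S Z P N \<longleftrightarrow>
     \<not> (\<exists>w :: nat \<Rightarrow> 'v \<Rightarrow> 'u. (\<forall>l < N. w l ` S \<subseteq> Dom M) \<and> shatters M Z P w {..<N})"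

lemma nip_bound_card:
  assumes N: "nip_bound M S Z P N" and \<Lambda>: "finite \<Lambda>" "shatters M Z P w \<Lambda>"
    and w: "\<And>l. l \<in> \<Lambda> \<Longrightarrow> w l ` S \<subseteq> Dom M"
  shows "card \<Lambda> < N"
proof (rule ccontr)
  assume "\<not> card \<Lambda> < N"
  then obtain \<Lambda>' where \<Lambda>': "\<Lambda>' \<subseteq> \<Lambda>" "card \<Lambda>' = N" "finite \<Lambda>'"
    using obtain_subset_with_card_n[of N \<Lambda>] by (metis leI)
  then obtain e where e: "bij_betw e {..<N} \<Lambda>'"
    using ex_bij_betw_nat_finite[of \<Lambda>'] by (auto simp: atLeast0LessThan)
  have "shatters M Z P (w \<circ> e) {..<N}"
    unfolding shatters_def
  proof (intro allI impI)
    fix T assume T: "T \<subseteq> {..<N}"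
    have "e ` T \<subseteq> \<Lambda>" using T e \<Lambda>'(1) by (auto simp: bij_betw_def)
    with \<Lambda>(2) obtain z where z: "z ` Z \<subseteq> Dom M"
      "\<And>l. l \<in> \<Lambda> \<Longrightarrow> P (override_on (w l) z Z) \<longleftrightarrow> l \<in> e ` T"
      by (rule shattersD) blast
    have "P (override_on ((w \<circ> e) l) z Z) \<longleftrightarrow> l \<in> T" if "l \<in> {..<N}" for l
    proof -
      have "e l \<in> \<Lambda>" using that e \<Lambda>'(1) by (auto simp: bij_betw_def)
      moreover have "e l \<in> e ` T \<longleftrightarrow> l \<in> T"
        using inj_on_image_mem_iff[OF bij_betw_imp_inj_on[OF e] that T] .
      ultimately show ?thesis using z(2) by simp
    qed
    then show "\<exists>z. z ` Z \<subseteq> Dom M \<and> (\<forall>l \<in> {..<N}. P (override_on ((w \<circ> e) l) z Z) \<longleftrightarrow> l \<in> T)"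
      using z(1) by (intro exI[of _ z]) simp
  qed
  moreover have "(w \<circ> e) l ` S \<subseteq> Dom M" if "l < N" for l
    using w[of "e l"] that e \<Lambda>'(1) by (auto simp: bij_betw_def)
  ultimately have "\<exists>w :: nat \<Rightarrow> _. (\<forall>l < N. w l ` S \<subseteq> Dom M) \<and> shatters M Z P w {..<N}"
    by (intro exI[of _ "w \<circ> e"] conjI allI impI)
  with N show False unfolding nip_bound_def by (rule notE)
qed

locale nip_structure = saturated_structure L U \<mu>
  for L :: "('f, 'r) lang" and U :: "('f, 'r, 'u) struct" and \<mu> :: "'c rel" +
  assumes nip: "NIP L U"
begin

text \<open>\<open>NIP\<close> forbids shattering an infinite set; compactness turns this into a
  finite bound. If arbitrarily long finite sequences were shattered, there would be an infinite
  sequence all of whose finite pieces are shattered, and then every subset of it would be cut out by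
  a single tuple.\<close>

lemma ex_nip_bound:
  fixes P :: "('v \<Rightarrow> 'u) \<Rightarrow> bool"
  assumes P: "dfn L U S P"
  shows "\<exists>N. nip_bound U S Z P N"
proof (rule ccontr)
  assume "\<not> ?thesis"
  then have sh: "\<exists>w :: nat \<Rightarrow> 'v \<Rightarrow> 'u. (\<forall>l < N. w l ` S \<subseteq> Dom U) \<and> shatters U Z P w {..<N}" for N
    unfolding nip_bound_def by simp
  obtain \<phi> :: "('f, 'r, nat) fm" and g where \<phi>: "wf_fm L \<phi>" "g ` fv \<phi> \<subseteq> S"
    "\<And>v. v ` S \<subseteq> Dom U \<Longrightarrow> P v \<longleftrightarrow> sat U (v \<circ> g) \<phi>" using P unfolding dfn_def by blast
  define Z0 where "Z0 = {j \<in> fv \<phi>. g j \<in> Z}"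
  have Z0: "finite Z0" using finite_fv[of \<phi>] by (simp add: Z0_def)
  obtain d0 where d0: "d0 \<in> Dom U" using Dom_nonempty by blast
  \<comment> \<open>The variables in \<open>Z0\<close> are shared by all \<open>l\<close>; the
    others have one copy for each \<open>l\<close>.\<close>
  define k :: "nat \<Rightarrow> nat \<Rightarrow> (nat \<times> nat) + nat" where
    "k = (\<lambda>l j. if j \<in> Z0 then Inr j else Inl (l, j))"
  define V :: "((nat \<times> nat) + nat) set" where "V = Inl ` (UNIV \<times> fv \<phi>)"
  have kV: "k l ` fv \<phi> \<subseteq> V \<union> Inr ` Z0" for l by (auto simp: k_def V_def)
  define \<Psi> where "\<Psi> = (\<lambda>n T v. \<exists>z. z ` Inr ` Z0 \<subseteq> Dom U \<and>
    (\<forall>l \<in> {..<n}. sat U (override_on v z (Inr ` Z0) \<circ> k l) \<phi> = (l \<in> T)))"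
  have dl: "dfn L U (V \<union> Inr ` Z0) (\<lambda>v. sat U (v \<circ> k l) \<phi> = (l \<in> T))" for l T
    using dfn_formula[OF \<phi>(1) kV[of l], of U] dfn_Not by (cases "l \<in> T") auto
  have "dfn L U (V \<union> Inr ` Z0 - Inr ` Z0) (\<Psi> n T)" for n T
    unfolding \<Psi>_def image_comp[symmetric]
    by (rule dfn_Ex_finite[where P = "\<lambda>v. \<forall>l \<in> {..<n}. sat U (v \<circ> k l) \<phi> = (l \<in> T)"])
      (simp_all add: Z0 dfn_Ball dl)
  moreover have "V \<union> Inr ` Z0 - Inr ` Z0 = V" by (auto simp: V_def)
  ultimately have d\<Psi>: "dfn L U V (\<Psi> n T)" for n T by simp
  have Vsmall: "|V| <o \<mu>"
    by (rule small_countable[of to_nat]) (auto simp: V_def inj_on_def)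
  let ?\<Phi> = "{\<Psi> n T | n T. T \<subseteq> {..<n}}"
  \<comment> \<open>First use of compactness: infinitely many points such that all finite pieces are
    shattered.\<close>
  obtain u where u: "u ` V \<subseteq> Dom U" "\<And>P. P \<in> ?\<Phi> \<Longrightarrow> P (override_on (\<lambda>_. d0) u V)"
  proof (rule compactness[of ?\<Phi> "{}" V "\<lambda>_. d0"])
    show "dfn L U ({} \<union> V) P" if "P \<in> ?\<Phi>" for P using that d\<Psi> by auto
    fix \<Phi>0 assume "finite \<Phi>0" "\<Phi>0 \<subseteq> ?\<Phi>"
    moreover have "?\<Phi> = (\<lambda>(n, T). \<Psi> n T) ` {(n, T). T \<subseteq> {..<n}}" by auto
    ultimately obtain \<I> where \<I>: "finite \<I>" "\<I> \<subseteq> {(n, T). T \<subseteq> {..<n}}" "\<Phi>0 = (\<lambda>(n, T). \<Psi> n T) ` \<I>"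
      by (metis (no_types, lifting) finite_subset_image)
    define N where "N = Max (insert 0 (fst ` \<I>))"
    have N: "n \<le> N" if "(n, T) \<in> \<I>" for n T
      unfolding N_def using \<I>(1) that by (intro Max_ge) force+
    obtain w :: "nat \<Rightarrow> 'v \<Rightarrow> 'u" where w: "\<And>l. l < N \<Longrightarrow> w l ` S \<subseteq> Dom U" "shatters U Z P w {..<N}"
      using sh[of N] by blast
    define u :: "(nat \<times> nat) + nat \<Rightarrow> 'u" where "u = (\<lambda>x. case x of Inl (l, j) \<Rightarrow> if l < N then w l (g j) else d0 | Inr j \<Rightarrow> d0)"
    have u: "u ` V \<subseteq> Dom U"
    proof (rule image_subsetI)
      fix x assume "x \<in> V"
      then obtain l j where x: "x = Inl (l, j)" "j \<in> fv \<phi>" by (auto simp: V_def)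
      then have "g j \<in> S" using \<phi>(2) by auto
      then show "u x \<in> Dom U" using x(1) w(1)[of l] d0 by (auto simp: u_def)
    qed
    have "\<Psi> n T (override_on (\<lambda>_. d0) u V)" if nT: "(n, T) \<in> \<I>" for n T
    proof -
      have "T \<subseteq> {..<n}" using nT \<I>(2) by auto
      with N[OF nT] have "T \<subseteq> {..<N}" by auto
      with w(2) obtain z where z: "z ` Z \<subseteq> Dom U"
        "\<And>l. l \<in> {..<N} \<Longrightarrow> P (override_on (w l) z Z) = (l \<in> T)"
        by (rule shattersD) blast
      let ?z = "\<lambda>x. case x of Inl _ \<Rightarrow> d0 | Inr j \<Rightarrow> z (g j)"
      have "?z ` Inr ` Z0 \<subseteq> Dom U" using z(1) by (auto simp: Z0_def)
      moreover have "sat U (override_on (override_on (\<lambda>_. d0) u V) ?z (Inr ` Z0) \<circ> k l) \<phi> = (l \<in> T)"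
        if l: "l \<in> {..<n}" for l
      proof -
        have lN: "l < N" using l N[OF nT] by auto
        have "sat U (override_on (override_on (\<lambda>_. d0) u V) ?z (Inr ` Z0) \<circ> k l) \<phi> =
          sat U (override_on (w l) z Z \<circ> g) \<phi>"
          using lN by (intro sat_cong) (auto simp: k_def Z0_def V_def u_def override_on_def)
        also have "\<dots> = P (override_on (w l) z Z)"
          using override_on_image_subset[OF w(1)[OF lN] z(1)] by (intro \<phi>(3)[symmetric]) auto
        finally show ?thesis using z(2) lN by simp
      qed
      ultimately show ?thesis unfolding \<Psi>_def by (intro exI[of _ ?z]) simp
    qed
    then show "\<exists>w. w ` V \<subseteq> Dom U \<and> (\<forall>P \<in> \<Phi>0. P (override_on (\<lambda>_. d0) w V))"
      using u \<I>(3) by (intro exI[of _ u]) auto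
  qed (use Vsmall small_finite in auto)
  define v where "v = override_on (\<lambda>_. d0) u V"
  have v: "v ` A \<subseteq> Dom U" for A using u(1) d0 by (auto simp: v_def override_on_def)
  have v\<Psi>: "\<Psi> n T v" if "T \<subseteq> {..<n}" for n T using u(2)[of "\<Psi> n T"] that by (auto simp: v_def)
  \<comment> \<open>Second use: one tuple for an arbitrary, possibly infinite, set
    \<open>T\<close>.\<close>
  have "\<exists>w. w ` Inr ` Z0 \<subseteq> Dom U \<and> (\<forall>l. sat U (override_on v w (Inr ` Z0) \<circ> k l) \<phi> = (l \<in> T))" for T
  proof -
    let ?\<Phi> = "range (\<lambda>l v. sat U (v \<circ> k l) \<phi> = (l \<in> T))"
    obtain w where w: "w ` Inr ` Z0 \<subseteq> Dom U" "\<And>P. P \<in> ?\<Phi> \<Longrightarrow> P (override_on v w (Inr ` Z0))"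
    proof (rule compactness[of ?\<Phi> V "Inr ` Z0" v])
      show "dfn L U (V \<union> Inr ` Z0) P" if "P \<in> ?\<Phi>" for P using that dl by auto
      fix \<Phi>0 assume \<Phi>0: "finite \<Phi>0" "\<Phi>0 \<subseteq> ?\<Phi>"
      obtain \<I> where \<I>: "finite \<I>" "\<Phi>0 = (\<lambda>l v. sat U (v \<circ> k l) \<phi> = (l \<in> T)) ` \<I>"
        using finite_subset_image[OF \<Phi>0] by (elim exE conjE) (rule that)
      obtain n where n: "\<I> \<subseteq> {..<n}" using finite_nat_bounded[OF \<I>(1)] by blast
      have "\<Psi> n (T \<inter> {..<n}) v" by (rule v\<Psi>) simp
      then obtain z where "z ` Inr ` Z0 \<subseteq> Dom U"
        "\<forall>l \<in> {..<n}. sat U (override_on v z (Inr ` Z0) \<circ> k l) \<phi> = (l \<in> T \<inter> {..<n})"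
        unfolding \<Psi>_def by (elim exE conjE) (rule that)
      then show "\<exists>w. w ` Inr ` Z0 \<subseteq> Dom U \<and> (\<forall>P \<in> \<Phi>0. P (override_on v w (Inr ` Z0)))"
        using n \<I>(2) by (intro exI[of _ z]) auto
    qed (use Vsmall small_finite Z0 v in auto)
    then show ?thesis using w(2)[OF rangeI] by (intro exI[of _ w]) simp
  qed
  then obtain b where b: "\<And>T. b T ` Inr ` Z0 \<subseteq> Dom U"
    "\<And>T l. sat U (override_on v (b T) (Inr ` Z0) \<circ> k l) \<phi> = (l \<in> T)" by metis
  \<comment> \<open>Back to the shape of \<open>NIP\<close>: the shared variables form the second
    group.\<close>
  let ?f = "\<lambda>j. if j \<in> Z0 then Inr j else Inl j :: nat + nat"
  let ?a = "\<lambda>i j. v (Inl (i, j))"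
  let ?b = "\<lambda>T j. if j \<in> Z0 then b T (Inr j) else d0"
  have "sat U (case_sum (?a i) (?b T)) (map_fm (\<lambda>a. a) (\<lambda>a. a) ?f \<phi>) \<longleftrightarrow> i \<in> T" for i T
  proof -
    have "inj_on ?f (set3_fm \<phi>)" by (auto simp: inj_on_def)
    then have "sat U (case_sum (?a i) (?b T)) (map_fm (\<lambda>a. a) (\<lambda>a. a) ?f \<phi>) =
      sat U (case_sum (?a i) (?b T) \<circ> ?f) \<phi>" by (rule sat_map)
    also have "\<dots> = sat U (override_on v (b T) (Inr ` Z0) \<circ> k i) \<phi>"
      by (intro sat_cong) (auto simp: k_def override_on_def)
    finally show ?thesis using b(2) by simp
  qed
  moreover have "?a i \<in> tuples U UNIV" for i using v[of UNIV] by (auto simp: tuples_def)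
  moreover have "?b T \<in> tuples U UNIV" for T using b(1)[of T] d0 by (auto simp: tuples_def)
  ultimately have "\<exists>(a :: nat \<Rightarrow> nat \<Rightarrow> 'u) (b :: nat set \<Rightarrow> nat \<Rightarrow> 'u).
      (\<forall>i. a i \<in> tuples U UNIV) \<and> (\<forall>S. b S \<in> tuples U UNIV) \<and>
      (\<forall>i S. sat U (case_sum (a i) (b S)) (map_fm (\<lambda>a. a) (\<lambda>a. a) ?f \<phi>) \<longleftrightarrow> i \<in> S)"
    by (intro exI[of _ ?a] exI[of _ ?b] conjI allI)
  moreover have "wf_fm L (map_fm (\<lambda>a. a) (\<lambda>a. a) ?f \<phi>)" using \<phi>(1) by (simp add: wf_fm_map)
  note mp[OF spec[OF nip[unfolded NIP_def]] this]
  ultimately show False by (rule notE[rotated])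
qed

end

section \<open>Arrays of tuples\<close>

text \<open>Parameters are variables that name themselves, so a type over parameters and over a
  tuple is again the type of an assignment. \<open>Arr i q y\<close> is coordinate \<open>y\<close>
  of the point at position \<open>q\<close> in sequence \<open>i\<close>.\<close>

datatype ('u, 'x, 'k, 'o) vr = Par 'u | Xv 'x | Arr 'k 'o 'x

fun asg :: "('x \<Rightarrow> 'u) \<Rightarrow> ('k \<Rightarrow> 'o \<Rightarrow> 'x \<Rightarrow> 'u) \<Rightarrow> ('u, 'x, 'k, 'o) vr \<Rightarrow> 'u" where
  "asg a E (Par c) = c"
| "asg a E (Xv x) = a x"
| "asg a E (Arr i q y) = E i q y"

fun ren :: "('k \<Rightarrow> 'o \<Rightarrow> 'p) \<Rightarrow> ('u, 'x, 'k, 'o) vr \<Rightarrow> ('u, 'x, 'k, 'p) vr" where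
  "ren f (Par c) = Par c"
| "ren f (Xv x) = Xv x"
| "ren f (Arr i q y) = Arr i (f i q) y"

definition arr :: "'k set \<Rightarrow> ('k \<Rightarrow> 'x set) \<Rightarrow> ('k \<Rightarrow> 'o set) \<Rightarrow> ('u, 'x, 'k, 'o) vr set" where
  "arr K Y F = {Arr i q y | i q y. i \<in> K \<and> q \<in> F i \<and> y \<in> Y i}"

text \<open>Moving the points of an array is the composition of an assignment with a renaming, to
  which \<open>dfn_subst\<close> and \<open>tpeq_subst\<close> apply.\<close>

lemma asg_ren: "asg a E \<circ> ren f = asg a (\<lambda>i q. E i (f i q))"
  (is "?l = ?r")
proof
  show "?l x = ?r x" for x by (cases x) auto
qed

lemma arr_iff [simp]: "Arr i q y \<in> arr K Y F \<longleftrightarrow> i \<in> K \<and> q \<in> F i \<and> y \<in> Y i"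
  "Par c \<notin> arr K Y F" "Xv x \<notin> arr K Y F"
  by (auto simp: arr_def)

lemma arr_mono: "(\<And>i. i \<in> K \<Longrightarrow> F i \<subseteq> G i) \<Longrightarrow> arr K Y F \<subseteq> arr K Y G"
  by (fastforce simp: arr_def)

lemma asg_eta: "(\<And>c. v (Par c) = c) \<Longrightarrow> (\<And>x. v (Xv x) = a x) \<Longrightarrow>
    v = asg a (\<lambda>i q y. v (Arr i q y))"
proof
  show "v x = asg a (\<lambda>i q y. v (Arr i q y)) x"
    if "\<And>c. v (Par c) = c" "\<And>x. v (Xv x) = a x" for x
    using that by (cases x) auto
qed

section \<open>Ramsey's theorem for arrays\<close>

text \<open>The rank of \<open>h s\<close> in the image is the number of elements of
  \<open>S\<close> below \<open>s\<close>, which does not depend on \<open>h\<close>.\<close>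

lemma order_map_unique:
  fixes h h' :: "'s \<Rightarrow> nat"
  assumes fin: "finite S" and total: "\<And>s s'. s \<in> S \<Longrightarrow> s' \<in> S \<Longrightarrow> s \<noteq> s' \<Longrightarrow> r s s' \<or> r s' s"
    and h: "\<And>s s'. s \<in> S \<Longrightarrow> s' \<in> S \<Longrightarrow> r s s' \<Longrightarrow> h s < h s'"
    and h': "\<And>s s'. s \<in> S \<Longrightarrow> s' \<in> S \<Longrightarrow> r s s' \<Longrightarrow> h' s < h' s'"
    and im: "h ` S = h' ` S" and s: "s \<in> S"
  shows "h s = h' s"
proof -
  have c: "card {x \<in> g ` S. x < g s} = card {s' \<in> S. r s' s}"
    if g: "\<And>s s'. s \<in> S \<Longrightarrow> s' \<in> S \<Longrightarrow> r s s' \<Longrightarrow> g s < g s'" for g :: "'s \<Rightarrow> nat"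
  proof -
    have "{x \<in> g ` S. x < g s} = g ` {s' \<in> S. r s' s}"
    proof (intro equalityI subsetI)
      fix x assume "x \<in> {x \<in> g ` S. x < g s}"
      then obtain s' where s': "s' \<in> S" "x = g s'" "g s' < g s" by auto
      then have "r s' s" using total[OF s'(1) s] g[OF s s'(1)] by force
      then show "x \<in> g ` {s' \<in> S. r s' s}" using s' by auto
    qed (use g s in auto)
    moreover have "inj_on g {s' \<in> S. r s' s}"
      using total g by (intro inj_onI) (metis (mono_tags, lifting) less_irrefl mem_Collect_eq)
    ultimately show ?thesis by (simp add: card_image)
  qed
  have lt: False if "x \<in> X" "finite X" "x < y" "card {z \<in> X. z < x} = card {z \<in> X. z < y}" for x y :: nat and X
  proof -
    have "{z \<in> X. z < x} \<subset> {z \<in> X. z < y}" using that(1,3) by auto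
    then have "card {z \<in> X. z < x} < card {z \<in> X. z < y}" using that(2) by (intro psubset_card_mono) auto
    then show False using that(4) by simp
  qed
  have "card {x \<in> h ` S. x < h s} = card {x \<in> h ` S. x < h' s}"
    using c[of h, OF h] c[of h', OF h'] im by simp
  moreover have "h s \<in> h ` S" "h' s \<in> h ` S" "finite (h ` S)" using im s fin by auto
  ultimately show ?thesis using lt[of "h s" "h ` S" "h' s"] lt[of "h' s" "h ` S" "h s"]
    by (metis linorder_neqE_nat)
qed

text \<open>One colouring after the other, each homogeneous set being chosen inside the previous
  one.\<close>

lemma Ramsey_finitely_many:
  fixes \<rho> :: "'t \<Rightarrow> nat" and col :: "'t \<Rightarrow> nat set \<Rightarrow> bool"
  assumes "finite J"
  shows "\<exists>H. infinite H \<and> (\<forall>t \<in> J. \<forall>X X'. X \<subseteq> H \<and> X' \<subseteq> H \<and> finite X \<and> finite X' \<and>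
    card X = \<rho> t \<and> card X' = \<rho> t \<longrightarrow> col t X = col t X')"
  using assms
proof (induction J rule: finite_induct)
  case empty
  show ?case by (intro exI[of _ UNIV]) auto
next
  case (insert t J)
  then obtain H where H: "infinite H" and JH: "\<forall>t \<in> J. \<forall>X X'. X \<subseteq> H \<and> X' \<subseteq> H \<and> finite X \<and> finite X' \<and>
    card X = \<rho> t \<and> card X' = \<rho> t \<longrightarrow> col t X = col t X'" by blast
  have "\<forall>X. X \<subseteq> H \<and> finite X \<and> card X = \<rho> t \<longrightarrow> (of_bool (col t X) :: nat) < 2" by auto
  from Ramsey[OF H this] obtain H' c where H': "H' \<subseteq> H" "infinite H'"
    "\<forall>X. X \<subseteq> H' \<and> finite X \<and> card X = \<rho> t \<longrightarrow> (of_bool (col t X) :: nat) = c"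
    by (elim exE conjE) (rule that)
  have "col t X = col t X'" if "X \<subseteq> H'" "X' \<subseteq> H'" "finite X" "finite X'" "card X = \<rho> t" "card X' = \<rho> t" for X X'
    using H'(3)[rule_format, of X] H'(3)[rule_format, of X'] that
    by (auto simp: of_bool_def split: if_splits)
  moreover have "col u X = col u X'" if "u \<in> J" "X \<subseteq> H'" "X' \<subseteq> H'" "finite X" "finite X'"
      "card X = \<rho> u" "card X' = \<rho> u" for u X X'
    using JH[rule_format, OF that(1), of X X'] that H'(1) by auto
  ultimately show ?case using H'(2) by (intro exI[of _ H']) auto
qed

text \<open>With the rows placed one behind the other in the natural numbers, a finite set of array
  positions is coded by a set of numbers. A row-wise increasing map preserves the lexicographic
  order, so moved positions are listed in the same order as the original ones and have a code of the
  same size, on which the colouring agrees. One ordinary Ramsey argument thus serves all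
  rows.\<close>

lemma Ramsey_array:
  fixes K0 :: "'k set" and R :: "rat set" and t :: "'t \<Rightarrow> ('k \<Rightarrow> rat \<Rightarrow> rat) \<Rightarrow> bool"
    and S :: "'t \<Rightarrow> ('k \<times> rat) set"
  assumes fin: "finite K0" "finite R" "finite J" and S: "\<And>j. j \<in> J \<Longrightarrow> S j \<subseteq> K0 \<times> R"
    and t: "\<And>j g g'. j \<in> J \<Longrightarrow> (\<And>i q. (i, q) \<in> S j \<Longrightarrow> g i q = g' i q) \<Longrightarrow> t j g = t j g'"
  obtains g :: "'k \<Rightarrow> rat \<Rightarrow> rat" where "\<And>i. i \<in> K0 \<Longrightarrow> strict_mono_on R (g i)"
    "\<And>j f. j \<in> J \<Longrightarrow> (\<And>i. strict_mono_on {q. (i, q) \<in> S j} (f i)) \<Longrightarrow>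
      (\<And>i q. (i, q) \<in> S j \<Longrightarrow> f i q \<in> R) \<Longrightarrow> t j (\<lambda>i q. g i (f i q)) = t j g"
proof -
  obtain \<nu> :: "'k \<Rightarrow> nat" where \<nu>: "inj_on \<nu> K0"
    using finite_imp_inj_to_nat_seg[OF fin(1)] by blast
  define r where "r = (\<lambda>(i, q) (i', q'). \<nu> i < \<nu> i' \<or> i = i' \<and> q < (q' :: rat))"
  have total: "r s s' \<or> r s' s" if "s \<in> K0 \<times> R" "s' \<in> K0 \<times> R" "s \<noteq> s'" for s s'
  proof -
    obtain i q i' q' where s: "s = (i, q)" "s' = (i', q')" by fastforce
    show ?thesis
    proof (cases "i = i'")
      case True
      then show ?thesis using that s by (auto simp: r_def)
    next
      case False
      then have "\<nu> i \<noteq> \<nu> i'" using that s \<nu> by (auto simp: inj_on_def)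
      then show ?thesis using s by (auto simp: r_def)
    qed
  qed
  have trans: "r s s''" if "r s s'" "r s' s''" for s s' s''
    using that by (auto simp: r_def split: prod.splits)
  have irr: "\<not> r s s" for s by (auto simp: r_def split: prod.splits)
  define mono where "mono = (\<lambda>A (h :: 'k \<times> rat \<Rightarrow> nat). \<forall>s \<in> A. \<forall>s' \<in> A. r s s' \<longrightarrow> h s < h s')"
  \<comment> \<open>The colour of \<open>X\<close> is the outcome of the test when the positions in
    \<open>S j\<close> are listed along \<open>X\<close>. By \<open>order_map_unique\<close> there
    is only one such listing.\<close>
  define col where "col = (\<lambda>j X. \<exists>h. mono (S j) h \<and> h ` S j = X \<and> t j (\<lambda>i q. rat_of_nat (h (i, q))))"
  obtain H where H1: "infinite H" and H2: "\<forall>j \<in> J. \<forall>X X'. X \<subseteq> H \<and> X' \<subseteq> H \<and> finite X \<and> finite X' \<and>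
      card X = card (S j) \<and> card X' = card (S j) \<longrightarrow> col j X = col j X'"
    using Ramsey_finitely_many[OF fin(3), of "\<lambda>j. card (S j)" col] by (elim exE conjE) (rule that)
  have H: "col j X = col j X'" if "j \<in> J" "X \<subseteq> H" "X' \<subseteq> H" "finite X" "finite X'"
      "card X = card (S j)" "card X' = card (S j)" for j X X'
    using H2[rule_format, OF that(1), of X X'] that by simp
  have finS: "finite (S j)" if "j \<in> J" for j using S[OF that] fin finite_subset by blast
  have col: "col j (h ` S j) = t j (\<lambda>i q. rat_of_nat (h (i, q)))"
    if j: "j \<in> J" and h: "mono (S j) h" for j h
  proof -
    have eq: "t j (\<lambda>i q. rat_of_nat (h' (i, q))) = t j (\<lambda>i q. rat_of_nat (h (i, q)))"
      if h': "mono (S j) h'" "h' ` S j = h ` S j" for h'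
    proof (rule t[OF j])
      fix i q assume "(i, q) \<in> S j"
      then have "h' (i, q) = h (i, q)"
        using order_map_unique[of "S j" r h' h "(i, q)"] finS[OF j] total S[OF j] h h'
        unfolding mono_def by blast
      then show "rat_of_nat (h' (i, q)) = rat_of_nat (h (i, q))" by simp
    qed
    show ?thesis
    proof
      assume "col j (h ` S j)"
      then obtain h' where "mono (S j) h'" "h' ` S j = h ` S j" "t j (\<lambda>i q. rat_of_nat (h' (i, q)))"
        unfolding col_def by (elim exE conjE) (rule that)
      then show "t j (\<lambda>i q. rat_of_nat (h (i, q)))" using eq by simp
    next
      assume "t j (\<lambda>i q. rat_of_nat (h (i, q)))"
      then show "col j (h ` S j)" unfolding col_def using h by (intro exI[of _ h] conjI refl)
    qed
  qed
  define pos where "pos = (\<lambda>s. card {s' \<in> K0 \<times> R. r s' s})"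
  have pos: "pos s < pos s'" if "s \<in> K0 \<times> R" "r s s'" for s s'
  proof -
    have "{x \<in> K0 \<times> R. r x s} \<subset> {x \<in> K0 \<times> R. r x s'}" using that trans irr by blast
    then show ?thesis unfolding pos_def using fin by (intro psubset_card_mono) auto
  qed
  \<comment> \<open>The whole finite array, laid out along \<open>H\<close> in lexicographic
    order.\<close>
  define G where "G = (\<lambda>s. enumerate H (pos s))"
  have G: "G s < G s'" if "s \<in> K0 \<times> R" "r s s'" for s s'
    unfolding G_def using pos[OF that] by (simp add: enumerate_mono H1)
  show ?thesis
  proof (rule that[of "\<lambda>i q. rat_of_nat (G (i, q))"])
    fix i assume "i \<in> K0"
    then show "strict_mono_on R (\<lambda>q. rat_of_nat (G (i, q)))"
      using G by (auto intro!: strict_mono_onI simp: r_def)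
  next
    fix j f assume j: "j \<in> J" and f: "\<And>i. strict_mono_on {q. (i, q) \<in> S j} (f i)"
      "\<And>i q. (i, q) \<in> S j \<Longrightarrow> f i q \<in> R"
    let ?h = "\<lambda>(i, q). G (i, f i q)"
    have inj: "inj_on h (S j)" if "mono (S j) h" for h
      using that total S[OF j] unfolding mono_def by (intro inj_onI) (metis less_irrefl subsetD)
    have m1: "mono (S j) G" using G S[OF j] unfolding mono_def by blast
    have m2: "mono (S j) ?h" unfolding mono_def
    proof (intro ballI impI)
      fix s s' assume s: "s \<in> S j" "s' \<in> S j" "r s s'"
      obtain i q i' q' where e: "s = (i, q)" "s' = (i', q')" by fastforce
      have "r (i, f i q) (i', f i' q')"
        using s e f(1)[of i] by (auto simp: r_def strict_mono_on_def)
      moreover have "(i, f i q) \<in> K0 \<times> R" using f(2)[of i q] s(1) e S[OF j] by auto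
      ultimately show "?h s < ?h s'" using G e by simp
    qed
    have "G ` S j \<subseteq> H" "?h ` S j \<subseteq> H" using enumerate_in_set[OF H1] by (auto simp: G_def)
    then have "col j (G ` S j) = col j (?h ` S j)"
      using finS[OF j] by (intro H[OF j]) (auto simp: card_image inj[OF m1] inj[OF m2])
    then have "t j (\<lambda>i q. rat_of_nat (G (i, q))) = t j (\<lambda>i q. rat_of_nat (?h (i, q)))"
      using col[OF j m1] col[OF j m2] by simp
    then show "t j (\<lambda>i q. rat_of_nat (G (i, f i q))) = t j (\<lambda>i q. rat_of_nat (G (i, q)))" by simp
  qed
qed

lemma ren_Un_arr:
  assumes "S0 \<subseteq> range Par \<union> range Xv" "\<And>i. i \<in> K \<Longrightarrow> f i ` F i \<subseteq> G i"
  shows "ren f ` (S0 \<union> arr K Y F) \<subseteq> S0 \<union> arr K Y G"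
proof (rule image_subsetI)
  fix x assume x: "x \<in> S0 \<union> arr K Y F"
  show "ren f x \<in> S0 \<union> arr K Y G"
  proof (cases x)
    case (Arr i q y)
    then show ?thesis using x assms by auto
  qed (use x in auto)
qed

section \<open>Mutually indiscernible arrays\<close>

locale array_structure = nip_structure L U \<mu>
  for L :: "('f, 'r) lang" and U :: "('f, 'r, 'u) struct" and \<mu> :: "'c rel" +
  fixes K :: "'k set" and Y :: "'k \<Rightarrow> 'c set"
  assumes small_arr: "|arr K Y (\<lambda>_. UNIV) :: ('u, 'c, 'k, rat) vr set| <o \<mu>"
begin

abbreviation Ar :: "('k \<Rightarrow> rat set) \<Rightarrow> ('u, 'c, 'k, rat) vr set" where
  "Ar \<equiv> arr K Y"

abbreviation At :: "rat set \<Rightarrow> ('u, 'c, 'k, rat) vr set" where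
  "At G \<equiv> arr K Y (\<lambda>_. G)"

definition into :: "rat set \<Rightarrow> ('k \<Rightarrow> rat set) \<Rightarrow> ('k \<Rightarrow> rat \<Rightarrow> rat) \<Rightarrow> bool" where
  "into G F f \<longleftrightarrow> (\<forall>i \<in> K. strict_mono_on (F i) (f i) \<and> f i ` F i \<subseteq> G)"

text \<open>Mutual indiscernibility over \<open>S0\<close> of the part of the array at positions in
  \<open>G\<close>, stated with all rows moving at once and independently. With the complement of 0
  for \<open>G\<close>, the centre is left out.\<close>

definition rmi :: "rat set \<Rightarrow> ('u, 'c, 'k, rat) vr set \<Rightarrow> ('c \<Rightarrow> 'u) \<Rightarrow> ('k \<Rightarrow> rat \<Rightarrow> 'c \<Rightarrow> 'u) \<Rightarrow> bool" where
  "rmi G S0 a E \<longleftrightarrow> (\<forall>F f. (\<forall>i \<in> K. F i \<subseteq> G) \<and> into G F f \<longrightarrow>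
     tpeq L U (S0 \<union> Ar F) (asg a E) (asg a (\<lambda>i q. E i (f i q))))"

lemma rmiD: "rmi G S0 a E \<Longrightarrow> (\<And>i. i \<in> K \<Longrightarrow> F i \<subseteq> G) \<Longrightarrow> into G F f \<Longrightarrow>
    tpeq L U (S0 \<union> Ar F) (asg a E) (asg a (\<lambda>i q. E i (f i q)))"
  unfolding rmi_def by simp

text \<open>The map \<open>h\<close> that undoes \<open>f\<close> and then follows \<open>g\<close>
  is itself increasing on the image of \<open>f\<close>.\<close>

lemma rmi_maps:
  assumes rmi: "rmi G S0 a E" and S0: "S0 \<subseteq> range Par \<union> range Xv" and f: "into G F f" and g: "into G F g"
  shows "tpeq L U (S0 \<union> Ar F) (asg a (\<lambda>i q. E i (f i q))) (asg a (\<lambda>i q. E i (g i q)))"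
proof -
  define h where "h = (\<lambda>i x. g i (inv_into (F i) (f i) x))"
  have inj: "inj_on (f i) (F i)" if "i \<in> K" for i
    using f that strict_mono_on_imp_inj_on unfolding into_def by blast
  have hf: "h i (f i q) = g i q" if "i \<in> K" "q \<in> F i" for i q
    using inj[OF that(1)] that(2) by (simp add: h_def)
  have "into G (\<lambda>i. f i ` F i) h" unfolding into_def
  proof (intro ballI conjI)
    fix i assume i: "i \<in> K"
    show "strict_mono_on (f i ` F i) (h i)"
    proof (rule strict_mono_onI)
      fix x y assume "x \<in> f i ` F i" "y \<in> f i ` F i" "x < y"
      then obtain q q' where q: "q \<in> F i" "q' \<in> F i" "x = f i q" "y = f i q'" by auto
      then have "q < q'" using \<open>x < y\<close> f i unfolding into_def
        by (metis linorder_neqE order_less_asym strict_mono_onD)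
      then show "h i x < h i y" using hf[OF i] q g i unfolding into_def strict_mono_on_def by auto
    qed
    show "h i ` f i ` F i \<subseteq> G" using hf[OF i] g i unfolding into_def by auto
  qed
  then have "tpeq L U (S0 \<union> Ar (\<lambda>i. f i ` F i)) (asg a E) (asg a (\<lambda>i q. E i (h i q)))"
    using f by (intro rmiD[OF rmi]) (auto simp: into_def)
  moreover have "ren f ` (S0 \<union> Ar F) \<subseteq> S0 \<union> Ar (\<lambda>i. f i ` F i)"
    using S0 by (intro ren_Un_arr) auto
  ultimately have "tpeq L U (S0 \<union> Ar F) (asg a E \<circ> ren f) (asg a (\<lambda>i q. E i (h i q)) \<circ> ren f)"
    by (rule tpeq_subst)
  then show ?thesis unfolding asg_ren
  proof (rule tpeq_cong)
    fix x assume "x \<in> S0 \<union> Ar F"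
    then show "asg a (\<lambda>i q. E i (h i (f i q))) x = asg a (\<lambda>i q. E i (g i q)) x"
      using S0 hf by (cases x) auto
  qed simp
qed

text \<open>Indiscernibility depends only on the type of the array.\<close>

lemma rmi_tpeq:
  assumes rmi: "rmi G S0 a E" and S0: "S0 \<subseteq> range Par \<union> range Xv"
    and eq: "tpeq L U (S0 \<union> At G) (asg a E) (asg a' E')"
  shows "rmi G S0 a' E'"
  unfolding rmi_def
proof (intro allI impI, elim conjE)
  fix F f assume F: "\<forall>i \<in> K. F i \<subseteq> G" and f: "into G F f"
  have "S0 \<union> Ar F \<subseteq> S0 \<union> At G" using F arr_mono[of K F "\<lambda>_. G" Y] by auto
  then have "tpeq L U (S0 \<union> Ar F) (asg a E) (asg a' E')" by (rule tpeq_mono[OF eq])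
  moreover have "tpeq L U (S0 \<union> Ar F) (asg a E) (asg a (\<lambda>i q. E i (f i q)))"
    using F f by (intro rmiD[OF rmi]) auto
  moreover have "ren f ` (S0 \<union> Ar F) \<subseteq> S0 \<union> At G"
    using S0 f by (intro ren_Un_arr) (auto simp: into_def)
  then have "tpeq L U (S0 \<union> Ar F) (asg a E \<circ> ren f) (asg a' E' \<circ> ren f)" by (rule tpeq_subst[OF eq])
  ultimately show "tpeq L U (S0 \<union> Ar F) (asg a' E') (asg a' (\<lambda>i q. E' i (f i q)))"
    unfolding asg_ren by (meson tpeq_sym tpeq_trans)
qed

lemma rmi_dom: "rmi G S0 a E \<Longrightarrow> asg a E ` (S0 \<union> At G) \<subseteq> Dom U"
  using tpeq_dom(1)[OF rmiD[of G S0 a E "\<lambda>_. G" "\<lambda>_ q. q"]]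
  by (simp add: into_def strict_mono_on_def)

text \<open>The standard extraction of indiscernibles: compactness leaves finitely many tests of
  invariance over \<open>B\<close>, and Ramsey finds positions \<open>g\<close> at which
  \<open>E\<close> passes them. Moving \<open>E\<close> along \<open>g\<close> does not change its
  type over \<open>A\<close>, since \<open>E\<close> is indiscernible there.\<close>

lemma rmi_extract:
  assumes AB: "A \<subseteq> B" "B \<subseteq> Dom U" and small: "|B| <o \<mu>" and E: "rmi UNIV (Par ` A) a E"
  obtains D where "tpeq L U (Par ` A \<union> At UNIV) (asg a E) (asg a D)" "rmi UNIV (Par ` B) a D"
proof -
  let ?S = "Par ` B :: ('u, 'c, 'k, rat) vr set" and ?V = "At UNIV"
  \<comment> \<open>A test consists of a predicate over \<open>B\<close>, the positions it may look
    at and an increasing map of them; \<open>cond\<close> says that the map does not change the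
    truth value.\<close>
  define tr where "tr = (\<lambda>(P :: (('u, 'c, 'k, rat) vr \<Rightarrow> 'u) \<Rightarrow> bool, F :: 'k \<Rightarrow> rat set, f).
    dfn L U (?S \<union> Ar F) P \<and> into UNIV F f)"
  define cond where "cond = (\<lambda>(P :: (('u, 'c, 'k, rat) vr \<Rightarrow> 'u) \<Rightarrow> bool, F :: 'k \<Rightarrow> rat set, f) v.
    P v = P (v \<circ> ren f))"
  let ?\<Phi>1 = "{P. dfn L U (Par ` A \<union> ?V) P \<and> P (asg a E)}"
  let ?\<Phi> = "?\<Phi>1 \<union> cond ` Collect tr"
  have dcond: "dfn L U (?S \<union> ?V) (cond j)" if "tr j" for j
  proof -
    obtain P F f where j: "j = (P, F, f)" by (cases j) auto
    have "dfn L U (?S \<union> Ar F) P" using that j by (simp add: tr_def)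
    moreover have "?S \<union> Ar F \<subseteq> ?S \<union> ?V" using arr_mono[of K F "\<lambda>_. UNIV" Y] by auto
    moreover have "ren f ` (?S \<union> Ar F) \<subseteq> ?S \<union> ?V" by (rule ren_Un_arr) auto
    ultimately have "dfn L U (?S \<union> ?V) P" "dfn L U (?S \<union> ?V) (\<lambda>v. P (v \<circ> ren f))"
      by - (assumption | erule (1) dfn_mono | erule (1) dfn_subst')+
    then show ?thesis unfolding j cond_def prod.case by (rule dfn_Iff)
  qed
  have Edom: "asg a E ` (?S \<union> ?V) \<subseteq> Dom U" using rmi_dom[OF E] AB by auto
  obtain w where w: "w ` ?V \<subseteq> Dom U" "\<And>P. P \<in> ?\<Phi> \<Longrightarrow> P (override_on (asg a E) w ?V)"
  proof (rule compactness[of ?\<Phi> ?S ?V "asg a E"])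
    show "dfn L U (?S \<union> ?V) P" if "P \<in> ?\<Phi>" for P
      using that
    proof
      assume "P \<in> ?\<Phi>1"
      then show ?thesis using AB by (auto intro: dfn_mono[of L U "Par ` A \<union> ?V"])
    qed (use dcond in auto)
    show "|?S| <o \<mu>" using small by (rule small_image)
    show "|?V| <o \<mu>" by (rule small_arr)
    show "asg a E ` ?S \<subseteq> Dom U" using Edom by auto
    fix \<Phi>0 assume \<Phi>0: "finite \<Phi>0" "\<Phi>0 \<subseteq> ?\<Phi>"
    define \<Phi>1 where "\<Phi>1 = \<Phi>0 \<inter> ?\<Phi>1"
    have f1: "finite \<Phi>1" and s1: "\<Phi>1 \<subseteq> ?\<Phi>1" using \<Phi>0 by (simp_all add: \<Phi>1_def)
    have "finite (\<Phi>0 - ?\<Phi>1)" "\<Phi>0 - ?\<Phi>1 \<subseteq> cond ` Collect tr" using \<Phi>0 by auto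
    from finite_subset_image[OF this] obtain J where J: "J \<subseteq> Collect tr" "finite J"
      "\<Phi>0 - ?\<Phi>1 = cond ` J" by (elim exE conjE) (rule that)
    have "dfn L U (Par ` A \<union> ?V) (\<lambda>v. \<forall>P \<in> \<Phi>1. P v)"
      using f1 s1 by (intro dfn_Ball[of _ L U _ "\<lambda>P. P"]) auto
    then obtain S1 \<Sigma> where S1: "finite S1" "S1 \<subseteq> Par ` A \<union> ?V" "dfn L U S1 \<Sigma>"
      "\<And>v. v ` (Par ` A \<union> ?V) \<subseteq> Dom U \<Longrightarrow> (\<forall>P \<in> \<Phi>1. P v) = \<Sigma> v" by (rule dfn_finite) blast
    have "\<exists>T Q. finite T \<and> T \<subseteq> ?S \<union> Ar (fst (snd j)) \<and> dfn L U T Q \<and>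
        (\<forall>v. v ` (?S \<union> Ar (fst (snd j))) \<subseteq> Dom U \<longrightarrow> fst j v = Q v)" if "j \<in> J" for j
    proof -
      have "dfn L U (?S \<union> Ar (fst (snd j))) (fst j)"
        using that J(1) by (auto simp: tr_def)
      then obtain T Q where "finite T" "T \<subseteq> ?S \<union> Ar (fst (snd j))" "dfn L U T Q"
        "\<And>v. v ` (?S \<union> Ar (fst (snd j))) \<subseteq> Dom U \<Longrightarrow> fst j v = Q v" by (rule dfn_finite) blast
      then show ?thesis by (intro exI[of _ T] exI[of _ Q]) simp
    qed
    then obtain T Q where TQ: "\<forall>j \<in> J. finite (T j) \<and> T j \<subseteq> ?S \<union> Ar (fst (snd j)) \<and> dfn L U (T j) (Q j) \<and>
        (\<forall>v. v ` (?S \<union> Ar (fst (snd j))) \<subseteq> Dom U \<longrightarrow> fst j v = Q j v)"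
      unfolding bchoice_iff[symmetric] by (metis (no_types, lifting))
    have T: "finite (T j)" "T j \<subseteq> ?S \<union> Ar (fst (snd j))" "dfn L U (T j) (Q j)"
      "\<And>v. v ` (?S \<union> Ar (fst (snd j))) \<subseteq> Dom U \<Longrightarrow> fst j v = Q j v" if "j \<in> J" for j
      using TQ that by simp_all
    have tr: "into UNIV (fst (snd j)) (snd (snd j))" if "j \<in> J" for j
      using J(1) that by (auto simp: tr_def)
    have Tsub: "T j \<subseteq> ?S \<union> ?V" if "j \<in> J" for j
      using T(2)[OF that] arr_mono[of K "fst (snd j)" "\<lambda>_. UNIV" Y] by auto
    have gdom: "asg a (\<lambda>i q. E i (g i q)) ` (?S \<union> ?V) \<subseteq> Dom U" for g
    proof -
      have "asg a (\<lambda>i q. E i (g i q)) ` (?S \<union> ?V) = asg a E ` ren g ` (?S \<union> ?V)"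
        unfolding asg_ren[symmetric] by (simp only: image_comp)
      also have "\<dots> \<subseteq> asg a E ` (?S \<union> ?V)" by (intro image_mono ren_Un_arr) auto
      also note Edom
      finally show ?thesis .
    qed
    define ps :: "('u, 'c, 'k, rat) vr \<Rightarrow> ('k \<times> rat) set" where
      "ps = (\<lambda>x. case x of Arr i q y \<Rightarrow> {(i, q)} | _ \<Rightarrow> {})"
    have ps: "(i, q) \<in> ps x \<longleftrightarrow> (\<exists>y. x = Arr i q y)" for i q x by (auto simp: ps_def split: vr.split)
    have fps: "finite (ps x)" for x by (auto simp: ps_def split: vr.split)
    define Sj where "Sj = (\<lambda>j. \<Union> (ps ` T j))"
    have Sj: "(i, q) \<in> Sj j \<longleftrightarrow> (\<exists>y. Arr i q y \<in> T j)" for i q j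
      unfolding Sj_def UN_iff ps by blast
    define N where "N = \<Union> (ps ` S1) \<union> (\<Union>j \<in> J. Sj j)"
    have finSj: "finite (Sj j)" if "j \<in> J" for j using T(1)[OF that] fps by (auto simp: Sj_def)
    have finN: "finite N" using S1(1) J(2) finSj fps by (auto simp: N_def)
    define K0 where "K0 = fst ` N"
    \<comment> \<open>All positions that occur in the finite fragment, before or after the
      moves.\<close>
    define R where "R = snd ` N \<union> (\<Union>j \<in> J. (\<lambda>(i, q). snd (snd j) i q) ` Sj j)"
    define t where "t = (\<lambda>j g. Q j (asg a (\<lambda>i q. E i (g i q))))"
    obtain g where g: "\<And>i. i \<in> K0 \<Longrightarrow> strict_mono_on R (g i)"
      and gt: "\<And>j f. j \<in> J \<Longrightarrow> (\<And>i. strict_mono_on {q. (i, q) \<in> Sj j} (f i)) \<Longrightarrow>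
        (\<And>i q. (i, q) \<in> Sj j \<Longrightarrow> f i q \<in> R) \<Longrightarrow> t j (\<lambda>i q. g i (f i q)) = t j g"
    proof (rule Ramsey_array[of K0 R J Sj t])
      show "finite K0" "finite R" "finite J" using finN finSj J(2) by (auto simp: K0_def R_def)
      show "Sj j \<subseteq> K0 \<times> R" if "j \<in> J" for j using that by (force simp: K0_def R_def N_def)
      show "t j h = t j h'" if j: "j \<in> J" and h: "\<And>i q. (i, q) \<in> Sj j \<Longrightarrow> h i q = h' i q" for j h h'
        unfolding t_def
      proof (rule dfn_cong[OF T(3)[OF j]])
        show "asg a (\<lambda>i q. E i (h i q)) ` T j \<subseteq> Dom U" using gdom[of h] Tsub[OF j] by blast
        fix x assume "x \<in> T j"
        then show "asg a (\<lambda>i q. E i (h i q)) x = asg a (\<lambda>i q. E i (h' i q)) x"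
          using h by (cases x) (simp_all add: Sj, metis)
      qed
    qed blast
    let ?w = "asg a (\<lambda>i q. E i (g i q))"
    have wV: "?w ` ?V \<subseteq> Dom U" using gdom[of g] by blast
    let ?u = "override_on (asg a E) ?w ?V"
    have u: "?u x = ?w x" if "x \<in> ?S \<union> ?V" for x using that by (auto simp: override_on_def)
    have udom: "?u ` (?S \<union> ?V) \<subseteq> Dom U" using gdom[of g] u by (auto simp: image_subset_iff)
    have "P ?u" if P: "P \<in> \<Phi>0" for P
    proof (cases "P \<in> \<Phi>1")
      case True
      \<comment> \<open>Ramsey makes \<open>g\<close> increasing only in the finitely many rows
        \<open>K0\<close>; no positions are used in the others.\<close>
      let ?F = "\<lambda>i. if i \<in> K0 then R else {}"
      have "into UNIV ?F g" using g by (auto simp: into_def strict_mono_on_def)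
      then have eq: "tpeq L U (Par ` A \<union> Ar ?F) (asg a E) ?w" by (intro rmiD[OF E]) auto
      have "S1 \<subseteq> Par ` A \<union> Ar ?F"
      proof
        fix x assume x: "x \<in> S1"
        then have "x \<in> Par ` A \<union> ?V" using S1(2) by auto
        then show "x \<in> Par ` A \<union> Ar ?F"
        proof
          assume V: "x \<in> ?V"
          then obtain i q y where i: "x = Arr i q y" by (auto simp: arr_def)
          then have "(i, q) \<in> N" using x ps unfolding N_def by blast
          then have "i \<in> K0" "q \<in> R" by (force simp: K0_def R_def)+
          then show ?thesis using V i by auto
        qed auto
      qed
      then have "\<Sigma> (asg a E) = \<Sigma> ?w" by (rule tpeqD[OF eq dfn_mono[OF S1(3)]])
      moreover have "\<forall>P \<in> \<Phi>1. P (asg a E)" using s1 by blast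
      then have "\<Sigma> (asg a E)" using S1(4)[of "asg a E"] rmi_dom[OF E] by simp
      moreover have "\<Sigma> ?u = \<Sigma> ?w"
      proof (rule dfn_cong[OF S1(3)])
        have sub: "S1 \<subseteq> ?S \<union> ?V" using S1(2) AB by auto
        then show "?u ` S1 \<subseteq> Dom U" using udom by blast
        show "?u x = ?w x" if "x \<in> S1" for x using u that sub by blast
      qed
      moreover have "?u ` (Par ` A \<union> ?V) \<subseteq> Dom U" using udom AB by (auto simp: image_subset_iff)
      ultimately have "\<forall>P \<in> \<Phi>1. P ?u" using S1(4)[of ?u] by simp
      then show ?thesis using True by (rule bspec)
    next
      case False
      then have "P \<in> cond ` J" using P J(3) \<Phi>1_def by blast
      then obtain j where j: "j \<in> J" and Pj: "P = cond j" by auto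
      let ?F = "fst (snd j)" and ?f = "snd (snd j)"
      have FV: "?S \<union> Ar ?F \<subseteq> ?S \<union> ?V" using arr_mono[of K ?F "\<lambda>_. UNIV" Y] by auto
      have rF: "ren ?f ` (?S \<union> ?V) \<subseteq> ?S \<union> ?V"
        by (rule ren_Un_arr) auto
      have "fst j ?u = Q j ?u" using udom FV by (intro T(4)[OF j]) blast
      also have "\<dots> = t j g" unfolding t_def
      proof (rule dfn_cong[OF T(3)[OF j]])
        show "?u ` T j \<subseteq> Dom U" using udom Tsub[OF j] by blast
        show "?u x = ?w x" if "x \<in> T j" for x using u that Tsub[OF j] by blast
      qed
      also have "\<dots> = t j (\<lambda>i q. g i (?f i q))"
      proof (rule gt[OF j, symmetric])
        fix i
        have "{q. (i, q) \<in> Sj j} \<subseteq> (if i \<in> K then ?F i else {})"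
        proof
          fix q assume "q \<in> {q. (i, q) \<in> Sj j}"
          then obtain y where "Arr i q y \<in> T j" by (auto simp: Sj)
          then have "Arr i q y \<in> ?S \<union> Ar ?F" using T(2)[OF j] by blast
          then show "q \<in> (if i \<in> K then ?F i else {})" by auto
        qed
        then show "strict_mono_on {q. (i, q) \<in> Sj j} (?f i)"
          using tr[OF j] unfolding into_def strict_mono_on_def
          by (cases "i \<in> K") (simp_all add: subset_iff)
        show "?f i q \<in> R" if "(i, q) \<in> Sj j" for q
          using that j unfolding R_def by force
      qed
      also have "\<dots> = Q j (?u \<circ> ren ?f)" unfolding t_def
      proof (rule dfn_cong[OF T(3)[OF j]])
        show "asg a (\<lambda>i q. E i (g i (?f i q))) ` T j \<subseteq> Dom U"
          using gdom[of "\<lambda>i q. g i (?f i q)"] Tsub[OF j] by blast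
        fix x assume "x \<in> T j"
        then have "ren ?f x \<in> ?S \<union> ?V" using Tsub[OF j] rF by blast
        then have "(?u \<circ> ren ?f) x = ?w (ren ?f x)" using u by simp
        then show "asg a (\<lambda>i q. E i (g i (?f i q))) x = (?u \<circ> ren ?f) x"
          by (cases x) simp_all
      qed
      also have "\<dots> = fst j (?u \<circ> ren ?f)"
      proof (rule T(4)[OF j, symmetric])
        have "(?u \<circ> ren ?f) ` (?S \<union> Ar ?F) = ?u ` ren ?f ` (?S \<union> Ar ?F)" by (simp only: image_comp)
        also have "\<dots> \<subseteq> ?u ` (?S \<union> ?V)" by (rule image_mono[OF subset_trans[OF image_mono[OF FV] rF]])
        also note udom
        finally show "(?u \<circ> ren ?f) ` (?S \<union> Ar ?F) \<subseteq> Dom U" .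
      qed
      finally show ?thesis unfolding Pj cond_def by (cases j) simp
    qed
    then show "\<exists>w. w ` ?V \<subseteq> Dom U \<and> (\<forall>P \<in> \<Phi>0. P (override_on (asg a E) w ?V))"
      using wV by (intro exI[of _ ?w] conjI ballI)
  qed blast
  define D where "D = (\<lambda>i q y. override_on (asg a E) w ?V (Arr i q y))"
  have D: "override_on (asg a E) w ?V = asg a D"
    unfolding D_def by (rule asg_eta) (simp_all add: override_on_def)
  have Ddom: "asg a D ` (?S \<union> ?V) \<subseteq> Dom U"
    unfolding D[symmetric] by (rule override_on_image_subset[OF _ w(1), of _ ?S]) (use Edom in auto)
  show ?thesis
  proof (rule that)
    show "tpeq L U (Par ` A \<union> ?V) (asg a E) (asg a D)"
    proof (rule tpeqI)
      show "asg a E ` (Par ` A \<union> ?V) \<subseteq> Dom U" by (rule rmi_dom[OF E])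
      show "asg a D ` (Par ` A \<union> ?V) \<subseteq> Dom U" using Ddom AB by auto
      show "P (asg a D)" if "dfn L U (Par ` A \<union> ?V) P" "P (asg a E)" for P
        using w(2)[of P] that by (simp add: D)
    qed
    show "rmi UNIV (Par ` B) a D"
      unfolding rmi_def
    proof (intro allI impI, elim conjE)
      fix F f assume f: "into UNIV F f"
      show "tpeq L U (?S \<union> Ar F) (asg a D) (asg a (\<lambda>i q. D i (f i q)))"
      proof (rule tpeqI)
        show "asg a D ` (?S \<union> Ar F) \<subseteq> Dom U"
          using Ddom arr_mono[of K F "\<lambda>_. UNIV" Y] by blast
        have "asg a (\<lambda>i q. D i (f i q)) ` (?S \<union> Ar F) = asg a D ` ren f ` (?S \<union> Ar F)"
          unfolding asg_ren[symmetric] by (simp only: image_comp)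
        also have "\<dots> \<subseteq> asg a D ` (?S \<union> ?V)" by (intro image_mono ren_Un_arr) auto
        also note Ddom
        finally show "asg a (\<lambda>i q. D i (f i q)) ` (?S \<union> Ar F) \<subseteq> Dom U" .
        show "P (asg a (\<lambda>i q. D i (f i q)))" if "dfn L U (?S \<union> Ar F) P" "P (asg a D)" for P
        proof -
          have "(P, F, f) \<in> Collect tr" using that(1) f by (simp add: tr_def)
          then have "cond (P, F, f) \<in> ?\<Phi>" by (intro UnI2 imageI)
          from w(2)[OF this] show ?thesis using that(2) by (simp add: D cond_def asg_ren)
        qed
      qed
    qed
  qed
qed

text \<open>In each of the disjoint intervals \<open>P\<close> takes both truth values, so a
  suitable choice of copies of the block yields any pattern \<open>T\<close>. The chosen copies have
  the same type over \<open>S0\<close> as the standard copies at \<open>p l\<close>, so with other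
  values for \<open>Z\<close> the pattern appears there too, and the standard copies are shattered.
  What \<open>P\<close> refers to beyond \<open>S0\<close> and the block sits in \<open>Z\<close>
  and gets quantified.\<close>

lemma switch_card:
  assumes rmi: "rmi G S0 a E" and S0: "S0 \<subseteq> range Par \<union> range Xv"
    and Z: "finite Z" "Z \<subseteq> range Par \<union> range Xv" "asg a E ` Z \<subseteq> Dom U"
    and P: "dfn L U (Z \<union> S0 \<union> Ar R) P" and N: "nip_bound U (Z \<union> S0 \<union> Ar R) Z P N"
    and \<Lambda>: "finite (\<Lambda> :: nat set)"
    and p: "\<And>l i q. l \<in> \<Lambda> \<Longrightarrow> i \<in> K \<Longrightarrow> q \<in> R i \<Longrightarrow> p l + q \<in> G \<inter> {lo l<..<hi l}"
    and c: "\<And>l i q. l \<in> \<Lambda> \<Longrightarrow> i \<in> K \<Longrightarrow> q \<in> R i \<Longrightarrow> c l i q \<in> G \<inter> {lo l<..<hi l}"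
    and c_mono: "\<And>l i. l \<in> \<Lambda> \<Longrightarrow> i \<in> K \<Longrightarrow> strict_mono_on (R i) (c l i)"
    and sep: "\<And>l l'. l \<in> \<Lambda> \<Longrightarrow> l' \<in> \<Lambda> \<Longrightarrow> l < l' \<Longrightarrow> hi l \<le> lo l'"
    and switch: "\<And>l. l \<in> \<Lambda> \<Longrightarrow>
      P (asg a (\<lambda>i q. E i (p l + q))) \<noteq> P (asg a (\<lambda>i q. E i (c l i q)))"
  shows "card \<Lambda> < N"
proof (rule nip_bound_card[OF N \<Lambda>])
  have dom: "asg a E ` (Z \<union> S0 \<union> At G) \<subseteq> Dom U" using Z(3) rmi_dom[OF rmi] by auto
  have cdom: "asg a (\<lambda>i q. E i (g i q)) ` (Z \<union> S0 \<union> Ar F) \<subseteq> Dom U"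
    if "\<And>i. i \<in> K \<Longrightarrow> g i ` F i \<subseteq> G" for g F
  proof -
    have "asg a (\<lambda>i q. E i (g i q)) ` (Z \<union> S0 \<union> Ar F) = asg a E ` ren g ` (Z \<union> S0 \<union> Ar F)"
      unfolding asg_ren[symmetric] by (simp only: image_comp)
    also have "\<dots> \<subseteq> asg a E ` (Z \<union> S0 \<union> At G)"
      using S0 Z(2) that by (intro image_mono ren_Un_arr) auto
    also note dom
    finally show ?thesis .
  qed
  let ?s = "\<lambda>l (i :: 'k) q. p l + q"
  let ?w = "\<lambda>l. asg a (\<lambda>i q. E i (p l + q))"
  show "?w l ` (Z \<union> S0 \<union> Ar R) \<subseteq> Dom U" if "l \<in> \<Lambda>" for l
    using p[OF that] by (intro cdom) auto
  show "shatters U Z P ?w \<Lambda>"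
    unfolding shatters_def
  proof (intro allI impI)
    fix T assume "T \<subseteq> \<Lambda>"
    \<comment> \<open>The copy at which \<open>P\<close> has the truth value wanted for
      \<open>l\<close>.\<close>
    define ch where "ch = (\<lambda>l. if P (?w l) = (l \<in> T) then ?s l else c l)"
    have ch: "ch l i q \<in> G \<inter> {lo l<..<hi l}" if "l \<in> \<Lambda>" "i \<in> K" "q \<in> R i" for l i q
      using p[OF that] c[OF that] by (auto simp: ch_def)
    have ch_mono: "strict_mono_on (R i) (ch l i)" if "l \<in> \<Lambda>" "i \<in> K" for l i
      using c_mono[OF that] by (auto simp: ch_def strict_mono_on_def)
    have chP: "P (asg a (\<lambda>i q. E i (ch l i q))) = (l \<in> T)" if "l \<in> \<Lambda>" for l
      using switch[OF that] by (auto simp: ch_def)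
    define F where "F = (\<lambda>i. \<Union>l \<in> \<Lambda>. (\<lambda>q. p l + q) ` R i)"
    \<comment> \<open>The interval that contains a position; \<open>f\<close> needs it to know which
      copy the position moves to.\<close>
    define bl where "bl = (\<lambda>x. SOME l. l \<in> \<Lambda> \<and> lo l < x \<and> x < hi l)"
    define f where "f = (\<lambda>i x. ch (bl x) i (x - p (bl x)))"
    have bl: "bl x = l" if "l \<in> \<Lambda>" "x \<in> {lo l<..<hi l}" for x l
    proof -
      have "bl x \<in> \<Lambda> \<and> lo (bl x) < x \<and> x < hi (bl x)"
        unfolding bl_def by (rule someI[of _ l]) (use that in auto)
      then show ?thesis using sep[of "bl x" l] sep[of l "bl x"] that
        by (metis greaterThanLessThan_iff leD less_trans linorder_neqE_nat order_less_le_trans)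
    qed
    have f: "f i (p l + q) = ch l i q" if "l \<in> \<Lambda>" "i \<in> K" "q \<in> R i" for l i q
      using bl[OF that(1), of "p l + q"] p[OF that] by (simp add: f_def)
    have FG: "F i \<subseteq> G" if "i \<in> K" for i using p that by (auto simp: F_def)
    have into: "into G F f" unfolding into_def
    proof (intro ballI conjI)
      fix i assume i: "i \<in> K"
      show "f i ` F i \<subseteq> G" using f ch i by (auto simp: F_def)
      show "strict_mono_on (F i) (f i)"
      proof (rule strict_mono_onI)
        fix x y assume "x \<in> F i" "y \<in> F i" and xy: "x < y"
        then obtain l q l' q' where x: "l \<in> \<Lambda>" "q \<in> R i" "x = p l + q"
          and y: "l' \<in> \<Lambda>" "q' \<in> R i" "y = p l' + q'" by (auto simp: F_def)
        have fx: "f i x = ch l i q" "f i y = ch l' i q'" using f x y i by auto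
        consider "l = l'" | "l < l'" | "l' < l" by linarith
        then show "f i x < f i y"
        proof cases
          case 1
          then have "q < q'" using xy x y by simp
          then show ?thesis using ch_mono[OF x(1) i] fx 1 x(2) y(2) by (auto simp: strict_mono_on_def)
        next
          case 2
          then show ?thesis using ch[OF x(1) i x(2)] ch[OF y(1) i y(2)] sep[OF x(1) y(1)] fx by auto
        next
          case 3
          then show ?thesis using p[OF x(1) i x(2)] p[OF y(1) i y(2)] sep[OF y(1) x(1)] xy x(3) y(3) by auto
        qed
      qed
    qed
    have ov: "override_on v z Z \<circ> ren g = override_on (v \<circ> ren g) z Z" for v z g
    proof
      fix x
      show "(override_on v z Z \<circ> ren g) x = override_on (v \<circ> ren g) z Z x"
        using Z(2) by (cases x) (auto simp: override_on_def)
    qed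
    let ?\<Psi> = "\<lambda>v. \<exists>z. z ` Z \<subseteq> Dom U \<and> (\<forall>l \<in> \<Lambda>. P (override_on v z Z \<circ> ren (?s l)) = (l \<in> T))"
    have "dfn L U (Z \<union> S0 \<union> Ar F) (\<lambda>v. P (v \<circ> ren (?s l)) = (l \<in> T))" if l: "l \<in> \<Lambda>" for l
    proof -
      have "dfn L U (Z \<union> S0 \<union> Ar F) (\<lambda>v. P (v \<circ> ren (?s l)))"
        using P by (rule dfn_subst') (use S0 Z(2) l in \<open>intro ren_Un_arr, auto simp: F_def\<close>)
      then show ?thesis using dfn_Not by (cases "l \<in> T") simp_all
    qed
    then have "dfn L U (Z \<union> S0 \<union> Ar F) (\<lambda>v. \<forall>l \<in> \<Lambda>. P (v \<circ> ren (?s l)) = (l \<in> T))"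
      by (intro dfn_Ball[OF \<Lambda>])
    then have "dfn L U (Z \<union> S0 \<union> Ar F - Z) ?\<Psi>" by (rule dfn_Ex_finite[OF Z(1)])
    then have d\<Psi>: "dfn L U (S0 \<union> Ar F) ?\<Psi>" by (rule dfn_mono) auto
    have "P (override_on (asg a (\<lambda>i q. E i (f i q))) (asg a E) Z \<circ> ren (?s l)) = (l \<in> T)"
      if l: "l \<in> \<Lambda>" for l
    proof -
      have "P (asg a (\<lambda>i q. E i (ch l i q))) =
        P (override_on (asg a (\<lambda>i q. E i (f i q))) (asg a E) Z \<circ> ren (?s l))"
      proof (rule dfn_cong[OF P])
        show "asg a (\<lambda>i q. E i (ch l i q)) ` (Z \<union> S0 \<union> Ar R) \<subseteq> Dom U"
          using ch[OF l] by (intro cdom) auto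
        fix x assume "x \<in> Z \<union> S0 \<union> Ar R"
        then show "asg a (\<lambda>i q. E i (ch l i q)) x =
          (override_on (asg a (\<lambda>i q. E i (f i q))) (asg a E) Z \<circ> ren (?s l)) x"
          using S0 Z(2) f[OF l] by (cases x) (auto simp: override_on_def)
      qed
      then show ?thesis using chP[OF l] by simp
    qed
    then have "?\<Psi> (asg a (\<lambda>i q. E i (f i q)))" using Z(3) by (intro exI[of _ "asg a E"] conjI ballI)
    moreover have "tpeq L U (S0 \<union> Ar F) (asg a E) (asg a (\<lambda>i q. E i (f i q)))"
      by (rule rmiD[OF rmi FG into])
    ultimately have "?\<Psi> (asg a E)" using tpeqD[OF _ d\<Psi>] by simp
    then show "\<exists>z. z ` Z \<subseteq> Dom U \<and> (\<forall>l \<in> \<Lambda>. P (override_on (?w l) z Z) = (l \<in> T))"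
      unfolding ov asg_ren .
  qed
qed

end

section \<open>Moving the centre of an array\<close>

text \<open>Distinct points of the grid are at least \<open>2 * M\<close> apart, so a block of
  radius \<open>M\<close> about one of them contains no other.\<close>

lemma grid_separated:
  fixes M q :: rat
  assumes "2 * M * of_nat m + q = 2 * M * of_nat m'" "\<bar>q\<bar> < M"
  shows "m = m' \<and> q = 0"
proof -
  have M: "M > 0" using assms(2) by linarith
  have e: "q = 2 * M * (of_nat m' - of_nat m)" using assms(1) by (simp add: algebra_simps)
  have "\<bar>of_nat m' - of_nat m :: rat\<bar> < 1"
  proof (rule ccontr)
    assume "\<not> ?thesis"
    then have "2 * M * 1 \<le> 2 * M * \<bar>of_nat m' - of_nat m\<bar>" using M by (intro mult_left_mono) auto
    also have "\<dots> = \<bar>q\<bar>" using M by (simp add: e abs_mult)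
    finally show False using assms(2) M by simp
  qed
  then have "\<bar>int m' - int m\<bar> < 1" by linarith
  then have "m = m'" by simp
  then show ?thesis using e by simp
qed

lemma index_unique:
  fixes l k l' k' b :: nat
  assumes "l * b + k = l' * b + k'" "k < b" "k' < b"
  shows "l = l' \<and> k = k'"
proof -
  have "(l * b + k) div b = l" "(l' * b + k') div b = l'" using assms(2,3) by simp_all
  then have "l = l'" using assms(1) by simp
  then show ?thesis using assms(1) by simp
qed

context array_structure
begin

text \<open>The finite fragment needed by \<open>base_change\<close>: \<open>\<Sigma>\<close> is a
  part of the type of the tuple over \<open>A\<close> and the array, \<open>P\<close> and
  \<open>f\<close> are finitely many tests of indiscernibility over \<open>B\<close>, and
  \<open>bad\<close> says that no values satisfying \<open>\<Sigma>\<close> over \<open>D\<close>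
  pass all tests.\<close>

lemma base_change_step:
  assumes AB: "A \<subseteq> B" "B \<subseteq> Dom U" and small: "|B| <o \<mu>" "|X| <o \<mu>"
    and r1: "rmi UNIV (Par ` A) a0 D0" and r2: "rmi (- {0}) (Par ` A \<union> Xv ` X) a0 D0"
    and tD: "tpeq L U (Par ` A \<union> At UNIV) (asg a0 D0) (asg a0 D)" and rB: "rmi UNIV (Par ` B) a0 D"
    and Zx: "finite Zx" "Zx \<subseteq> Xv ` X" and Zp: "finite Zp" "Zp \<subseteq> Par ` B" and J: "finite J"
    and \<Sigma>: "dfn L U (Par ` A \<union> Zx \<union> At {-M<..<M}) \<Sigma>" "dfn L U (Zp \<union> Zx \<union> At {-M<..<M}) \<Sigma>" "\<Sigma> (asg a0 D0)"
    and P: "\<And>j. j \<in> J \<Longrightarrow> dfn L U (Zp \<union> Zx \<union> Ar (R j)) (P j)"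
    and R: "\<And>j i. j \<in> J \<Longrightarrow> i \<in> K \<Longrightarrow> R j i \<subseteq> {-M<..<M} - {0}"
    and f: "\<And>j. j \<in> J \<Longrightarrow> into ({-M<..<M} - {0}) (R j) (f j)"
    and bad: "\<And>z. z ` Zx \<subseteq> Dom U \<Longrightarrow> \<Sigma> (override_on (asg a0 D) z Zx) \<Longrightarrow>
      \<exists>j \<in> J. P j (override_on (asg a0 D) z Zx) \<noteq> P j (override_on (asg a0 D) z Zx \<circ> ren (f j))"
    and M: "M > 0"
  shows False
proof -
  let ?I = "{-M<..<M}"
  let ?sh = "\<lambda>p (E :: 'k \<Rightarrow> rat \<Rightarrow> 'c \<Rightarrow> 'u) i q. E i (p + q)"
  \<comment> \<open>The tuple is quantified away, so \<open>\<Theta>\<close> speaks of parameters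
    and one block only and can be evaluated at every translate of the block.\<close>
  define \<Theta> where "\<Theta> = (\<lambda>v. \<not> (\<exists>z. z ` Zx \<subseteq> Dom U \<and> \<Sigma> (override_on v z Zx) \<and>
    (\<forall>j \<in> J. P j (override_on v z Zx) = P j (override_on v z Zx \<circ> ren (f j)))))"
  have Xdom: "a0 ` X \<subseteq> Dom U" using rmi_dom[OF r2] by (simp add: image_subset_iff ball_Un)
  have zp: "c \<in> Dom U" if "Par c \<in> Zp" for c using Zp(2) AB(2) that by auto
  have zx: "x \<in> X" if "Xv x \<in> Zx" for x using Zx(2) that by auto
  have znot: "Xv x \<notin> Zp" "Arr i q y \<notin> Zp" "Par c \<notin> Zx" "Arr i q y \<notin> Zx" for x i q y c
    using Zp(2) Zx(2) by auto
  have "dfn L U (Zp \<union> Zx \<union> At ?I) (\<lambda>v. P j v = P j (v \<circ> ren (f j)))" if "j \<in> J" for j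
  proof (rule dfn_Iff)
    show "dfn L U (Zp \<union> Zx \<union> At ?I) (P j)"
      using P[OF that] by (rule dfn_mono) (use R[OF that] in \<open>intro Un_mono order_refl arr_mono, auto\<close>)
    show "dfn L U (Zp \<union> Zx \<union> At ?I) (\<lambda>v. P j (v \<circ> ren (f j)))"
      using P[OF that] by (rule dfn_subst')
        (use Zp(2) Zx(2) f[OF that] in \<open>intro ren_Un_arr, auto simp: into_def\<close>)
  qed
  then have "dfn L U (Zp \<union> Zx \<union> At ?I) (\<lambda>v. \<Sigma> v \<and> (\<forall>j \<in> J. P j v = P j (v \<circ> ren (f j))))"
    using \<Sigma>(2) J by (intro dfn_And dfn_Ball)
  then have "dfn L U (Zp \<union> Zx \<union> At ?I - Zx) \<Theta>"
    unfolding \<Theta>_def by (intro dfn_Not dfn_Ex_finite[OF Zx(1)])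
  then have d\<Theta>: "dfn L U (Zp \<union> At ?I) \<Theta>" by (rule dfn_mono) auto
  have "\<Theta> (asg a0 D)" unfolding \<Theta>_def using bad by (intro notI, elim exE conjE) blast
  have \<Theta>D: "\<Theta> (asg a0 (?sh p D))" for p
  proof -
    have "tpeq L U (Par ` B \<union> At ?I) (asg a0 D) (asg a0 (?sh p D))"
      by (rule rmiD[OF rB]) (auto simp: into_def strict_mono_on_def)
    then have "\<Theta> (asg a0 D) = \<Theta> (asg a0 (?sh p D))"
      by (rule tpeqD) (use d\<Theta> Zp(2) in \<open>auto intro: dfn_mono\<close>)
    then show ?thesis using \<open>\<Theta> (asg a0 D)\<close> by simp
  qed
  have "\<exists>N. nip_bound U (Zx \<union> Par ` B \<union> Ar (R j)) Zx (P j) N" if "j \<in> J" for j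
    by (rule ex_nip_bound, rule dfn_mono[OF P[OF that]]) (use Zp(2) in auto)
  then obtain N where N: "\<And>j. j \<in> J \<Longrightarrow> nip_bound U (Zx \<union> Par ` B \<union> Ar (R j)) Zx (P j) (N j)" by metis
  obtain N\<Theta> where N\<Theta>: "nip_bound U (Zp \<union> {} \<union> At ?I) Zp \<Theta> N\<Theta>"
    using ex_nip_bound[OF d\<Theta>, of Zp] by auto
  \<comment> \<open>Test \<open>j\<close> can fail at fewer than \<open>N j\<close> places, so one
    of \<open>N1\<close> candidate places is good for all tests.\<close>
  define N1 where "N1 = (\<Sum>j \<in> J. N j) + 1"
  \<comment> \<open>Group \<open>l\<close> has \<open>N1 + 2\<close> slots: slot 0 carries the
    centre that is given up, slots \<open>1\<close> to \<open>N1\<close> are the candidates for the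
    new centre, and slot \<open>N1 + 1\<close> is never altered, so that \<open>\<Theta>\<close>
    stays true there.\<close>
  define idx where "idx = (\<lambda>l k. l * (N1 + 2) + k)"
  define pos where "pos = (\<lambda>l k. 2 * M * of_nat (idx l k))"
  have idx: "l = l' \<and> k = k'" if "idx l k = idx l' k'" "k < N1 + 2" "k' < N1 + 2" for l k l' k'
    using index_unique[of l "N1 + 2" k l' k'] that unfolding idx_def by blast
  have pos: "l = l' \<and> k = k' \<and> q = 0" if "pos l k + q = pos l' k'" "\<bar>q\<bar> < M" "k < N1 + 2" "k' < N1 + 2"
    for l k l' k' q
  proof -
    have "idx l k = idx l' k' \<and> q = 0" using that(1,2) unfolding pos_def by (rule grid_separated)
    then show ?thesis using idx[of l k l' k'] that(3,4) by blast
  qed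
  have pos': "l = l' \<and> k = k'" if "pos l k = pos l' k'" "k < N1 + 2" "k' < N1 + 2" for l k l' k'
    using pos[of l k 0 l' k'] that M by simp
  \<comment> \<open>\<open>T n\<close> collects the positions given up in \<open>n\<close> rounds,
    \<open>C n\<close> those where a point may have been exchanged.\<close>
  define T where "T = (\<lambda>n. {pos l 0 | l. l < n})"
  define C where "C = (\<lambda>n. {pos l k | l k. l < n \<and> k \<in> {1..N1}})"
  have CC: "C n \<subseteq> C (Suc n)" for n unfolding C_def using less_SucI by blast
  \<comment> \<open>The \<open>A\<close>-type off \<open>T n\<close> is kept because the next tuple
    is obtained from it. Agreement with \<open>D\<close> off \<open>C n\<close> is kept because the
    tests over \<open>B\<close> are only known to be stable on \<open>D\<close>.\<close>
  have ind: "\<exists>E. tpeq L U (Par ` A \<union> At (- T n)) (asg a0 D0) (asg a0 E) \<and> (\<forall>i q. q \<notin> C n \<longrightarrow> E i q = D i q) \<and>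
      (\<forall>l < n. \<exists>k \<in> {1..N1}. \<not> \<Theta> (asg a0 (?sh (pos l k) E)))" for n
  proof (induction n)
    case 0
    show ?case using tD by (intro exI[of _ D]) (simp add: T_def)
  next
    case (Suc n)
    then obtain E where E: "tpeq L U (Par ` A \<union> At (- T n)) (asg a0 D0) (asg a0 E)"
      "\<And>i q. q \<notin> C n \<Longrightarrow> E i q = D i q" "\<And>l. l < n \<Longrightarrow> \<exists>k \<in> {1..N1}. \<not> \<Theta> (asg a0 (?sh (pos l k) E))"
      by blast
    let ?t = "pos n 0"
    \<comment> \<open>The shift puts the centre of \<open>D0\<close> at \<open>?t\<close>. Over
      \<open>A\<close> this is invisible, since there \<open>D0\<close> is indiscernible at all
      positions.\<close>
    have "tpeq L U (Par ` A \<union> At (- T n)) (asg a0 (?sh (- ?t) D0)) (asg a0 D0)"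
      using rmi_maps[OF r1, of "\<lambda>_. - T n" "\<lambda>_ q. - ?t + q" "\<lambda>_ q. q"]
      by (auto simp: into_def strict_mono_on_def)
    then have "tpeq L U (Par ` A \<union> At (- T n)) (asg a0 (?sh (- ?t) D0)) (asg a0 E)"
      using E(1) by (rule tpeq_trans)
    \<comment> \<open>The new tuple is related to \<open>E\<close> as \<open>a0\<close> is to
      \<open>D0\<close> with its centre shifted to \<open>?t\<close>.\<close>
    then obtain w where w: "tpeq L U (Par ` A \<union> At (- T n) \<union> Xv ` X) (asg a0 (?sh (- ?t) D0)) w"
      "\<And>x. x \<notin> Xv ` X \<Longrightarrow> w x = asg a0 E x"
    proof (rule extension)
      show "asg a0 (?sh (- ?t) D0) ` Xv ` X \<subseteq> Dom U" using Xdom by auto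
      show "|Par ` A \<union> At (- T n)| <o \<mu>"
        using small_subset[OF small(1) AB(1)] small_subset[OF small_arr, of "At (- T n)"]
        by (intro small_Un small_image) (auto intro!: arr_mono)
      show "|Xv ` X :: ('u, 'c, 'k, rat) vr set| <o \<mu>" using small(2) by (rule small_image)
    qed auto
    define a where "a = (\<lambda>x. w (Xv x))"
    have w_eq: "w x = asg a E x" for x using w(2)[of x] by (cases x) (auto simp: a_def)
    have aE: "tpeq L U (Par ` A \<union> Xv ` X \<union> At (- T n)) (asg a0 (?sh (- ?t) D0)) (asg a E)"
      using w(1) w_eq by (auto simp: Un_ac intro: tpeq_cong)
    have adom: "a ` X \<subseteq> Dom U" using tpeq_dom(2)[OF aE] by (simp add: image_subset_iff ball_Un)
    have rBa: "rmi UNIV (Par ` B) a D"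
      by (rule rmi_tpeq[OF rB], force, rule tpeq_refl[OF rmi_dom[OF rB]]) (auto simp: arr_def)
    \<comment> \<open>Failures are counted along \<open>D\<close> and not along \<open>E\<close>,
      because \<open>D\<close> is still indiscernible over \<open>B\<close>.\<close>
    define badk where "badk = (\<lambda>j. {k \<in> {1..N1}. P j (asg a (?sh (pos n k) D)) \<noteq>
      P j (asg a (\<lambda>i q. D i (pos n k + f j i q)))})"
    have "card (badk j) < N j" if j: "j \<in> J" for j
    proof (rule switch_card[OF rBa, of Zx "R j" "P j" "N j" "badk j" "pos n" "\<lambda>k. pos n k - M"
          "\<lambda>k. pos n k + M" "\<lambda>k i q. pos n k + f j i q"])
      show "asg a D ` Zx \<subseteq> Dom U" using Zx(2) adom by fastforce
      show "dfn L U (Zx \<union> Par ` B \<union> Ar (R j)) (P j)" by (rule dfn_mono[OF P[OF j]]) (use Zp(2) in auto)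
      show "finite (badk j)" by (simp add: badk_def)
      fix l i q assume "i \<in> K" "q \<in> R j i"
      then show "pos n l + q \<in> UNIV \<inter> {pos n l - M<..<pos n l + M}" using R[OF j, of i] by auto
    next
      fix l i q assume "i \<in> K" "q \<in> R j i"
      then show "pos n l + f j i q \<in> UNIV \<inter> {pos n l - M<..<pos n l + M}"
        using f[OF j] unfolding into_def by fastforce
    next
      fix l i assume "i \<in> K"
      then show "strict_mono_on (R j i) (\<lambda>q. pos n l + f j i q)"
        using f[OF j] unfolding into_def by (auto simp: strict_mono_on_def)
    next
      fix l l' assume "l < (l' :: nat)"
      then have "of_nat l + (1 :: rat) \<le> of_nat l'" by (simp flip: of_nat_Suc add: Suc_leI)
      then have "2 * M * (of_nat l + 1) \<le> 2 * M * of_nat l'" using M by (intro mult_left_mono) auto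
      then show "pos n l + M \<le> pos n l' - M" by (simp add: pos_def idx_def algebra_simps)
    next
      fix l assume "l \<in> badk j"
      then show "P j (asg a (\<lambda>i q. D i (pos n l + q))) \<noteq> P j (asg a (\<lambda>i q. D i (pos n l + f j i q)))"
        by (simp add: badk_def)
    qed (use Zx N[OF j] in auto)
    then have "card (\<Union>j \<in> J. badk j) \<le> (\<Sum>j \<in> J. N j)"
      using card_UN_le[OF J, of badk] by (meson less_imp_le order_trans sum_mono)
    also have "\<dots> < card {1..N1}" by (simp add: N1_def)
    finally have lt: "card (\<Union>j \<in> J. badk j) < card {1..N1}" .
    have "finite (\<Union>j \<in> J. badk j)" using J by (auto simp: badk_def)
    then have "\<not> {1..N1} \<subseteq> (\<Union>j \<in> J. badk j)" using card_mono lt leD by blast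
    then obtain k where k1: "k \<in> {1..N1}" "k \<notin> (\<Union>j \<in> J. badk j)" by blast
    have k2: "P j (asg a (?sh (pos n k) D)) = P j (asg a (\<lambda>i q. D i (pos n k + f j i q)))"
      if "j \<in> J" for j
      using k1 that unfolding badk_def by blast
    note k = k1(1) k2
    let ?p = "pos n k"
    let ?F = "- T n - {?t, ?p}"
    \<comment> \<open>Off 0 the array \<open>D0\<close> is indiscernible over \<open>A\<close> and
      \<open>a0\<close>; hence off both \<open>?t\<close> and \<open>?p\<close> it makes no
      difference which of the two carries the centre.\<close>
    have "tpeq L U (Par ` A \<union> Xv ` X \<union> At ?F) (asg a0 (?sh (- ?p) D0)) (asg a0 (?sh (- ?t) D0))"
      by (rule rmi_maps[OF r2]) (auto simp: into_def strict_mono_on_def image_iff)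
    moreover have "tpeq L U (Par ` A \<union> Xv ` X \<union> At ?F) (asg a0 (?sh (- ?t) D0)) (asg a E)"
      using aE by (rule tpeq_mono) (auto simp: arr_def)
    ultimately have "tpeq L U (Par ` A \<union> Xv ` X \<union> At ?F) (asg a0 (?sh (- ?p) D0)) (asg a E)"
      by (rule tpeq_trans)
    \<comment> \<open>Only the point at \<open>?p\<close> is chosen anew; \<open>?t\<close> is no
      longer among the positions considered, and the tuple stays as it is.\<close>
    then obtain w' where w': "tpeq L U (Par ` A \<union> Xv ` X \<union> At ?F \<union> At {?p}) (asg a0 (?sh (- ?p) D0)) w'"
      "\<And>x. x \<notin> At {?p} \<Longrightarrow> w' x = asg a E x"
    proof (rule extension)
      show "asg a0 (?sh (- ?p) D0) ` At {?p} \<subseteq> Dom U" using rmi_dom[OF r1] by (fastforce simp: arr_def)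
      show "|Par ` A \<union> Xv ` X \<union> At ?F| <o \<mu>"
        using small_subset[OF small(1) AB(1)] small(2) small_subset[OF small_arr, of "At ?F"]
        by (intro small_Un small_image) (auto intro!: arr_mono)
      show "|At {?p}| <o \<mu>" by (rule small_subset[OF small_arr]) (auto intro!: arr_mono)
      show "(Par ` A \<union> Xv ` X \<union> At ?F) \<inter> At {?p} = {}" by (auto simp: arr_def)
    qed blast
    define E' where "E' = (\<lambda>i q y. w' (Arr i q y))"
    have w'_eq: "w' = asg a E'" unfolding E'_def using w'(2) by (intro asg_eta) auto
    have E'E: "E' i q = E i q" if "q \<noteq> ?p" for i q using w'(2) that by (auto simp: E'_def fun_eq_iff)
    have "?p \<notin> T (Suc n)" using pos'[of n k _ 0] k(1) by (auto simp: T_def)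
    moreover have "?t \<noteq> ?p" using pos'[of n 0 n k] k(1) by auto
    ultimately have TF: "- T (Suc n) = insert ?p ?F" by (auto simp: T_def less_Suc_eq)
    have "At ?F \<union> At {?p} = At (insert ?p ?F)" by (auto simp: arr_def)
    then have aE': "tpeq L U (Par ` A \<union> Xv ` X \<union> At (- T (Suc n))) (asg a0 (?sh (- ?p) D0)) (asg a E')"
      using w'(1) unfolding w'_eq TF by (simp add: Un_assoc)
    show ?case
    proof (intro exI[of _ E'] conjI allI impI)
      have "tpeq L U (Par ` A \<union> At (- T (Suc n))) (asg a0 (?sh (- ?p) D0)) (asg a E')"
        using aE' by (rule tpeq_mono) auto
      then have "tpeq L U (Par ` A \<union> At (- T (Suc n))) (asg a0 (?sh (- ?p) D0)) (asg a0 E')"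
        by (rule tpeq_cong) (auto simp: arr_def)
      moreover have "tpeq L U (Par ` A \<union> At (- T (Suc n))) (asg a0 D0) (asg a0 (?sh (- ?p) D0))"
        by (rule rmiD[OF r1]) (auto simp: into_def strict_mono_on_def)
      ultimately show "tpeq L U (Par ` A \<union> At (- T (Suc n))) (asg a0 D0) (asg a0 E')"
        by (rule tpeq_trans[rotated])
    next
      fix i q assume q: "q \<notin> C (Suc n)"
      have "?p \<in> C (Suc n)" using k(1) unfolding C_def by blast
      then have "q \<noteq> ?p" "q \<notin> C n" using q CC by auto
      then show "E' i q = D i q" using E(2) E'E by simp
    next
      fix l assume "l < Suc n"
      then consider "l < n" | "l = n" by linarith
      then show "\<exists>k \<in> {1..N1}. \<not> \<Theta> (asg a0 (?sh (pos l k) E'))"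
      proof cases
        case 1
        then obtain k' where k': "k' \<in> {1..N1}" "\<not> \<Theta> (asg a0 (?sh (pos l k') E))" using E(3) by blast
        have "\<Theta> (asg a0 (?sh (pos l k') E')) = \<Theta> (asg a0 (?sh (pos l k') E))"
        proof (rule dfn_cong[OF d\<Theta>])
          have ne: "pos l k' + q \<noteq> ?p" if "q \<in> ?I" for q
            using pos[of l k' q n k] that 1 k(1) k'(1) by (auto simp: abs_less_iff)
          have nT: "pos l k' + q \<in> - T (Suc n)" if "q \<in> ?I" for q
            using pos[of l k' q _ 0] that k'(1) by (fastforce simp: T_def)
          show "asg a0 (?sh (pos l k') E') ` (Zp \<union> At ?I) \<subseteq> Dom U"
          proof (rule image_subsetI)
            fix x assume x: "x \<in> Zp \<union> At ?I"
            show "asg a0 (?sh (pos l k') E') x \<in> Dom U"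
            proof (cases x)
              case (Arr i q y)
              then have "Arr i (pos l k' + q) y \<in> At (- T (Suc n))" using x nT Zp(2) by auto
              then have "asg a E' (Arr i (pos l k' + q) y) \<in> Dom U" using tpeq_dom(2)[OF aE'] by blast
              then show ?thesis using Arr by simp
            qed (use x zp znot in auto)
          qed
          fix x assume x: "x \<in> Zp \<union> At ?I"
          then show "asg a0 (?sh (pos l k') E') x = asg a0 (?sh (pos l k') E) x"
            using E'E ne Zp(2) by (cases x) auto
        qed
        then show ?thesis using k' by blast
      next
        case 2
        have nT: "?p + q \<in> - T (Suc n)" if "q \<in> ?I" for q
          using pos[of n k q _ 0] that k(1) by (fastforce simp: T_def)
        have nC: "?p + q \<notin> C (Suc n)" if "q \<in> ?I - {0}" for q
          using pos[of n k q] that k(1) by (fastforce simp: C_def)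
        have E'D: "E' i (?p + q) = D i (?p + q)" if "q \<in> ?I - {0}" for i q
        proof -
          have "?p + q \<notin> C n" using nC[OF that] CC by blast
          then show ?thesis using E(2)[of "?p + q" i] E'E[of "?p + q" i] that by simp
        qed
        let ?v = "asg a (?sh ?p E')"
        have "ren (\<lambda>i q. ?p + q) ` (Par ` A \<union> Xv ` X \<union> At ?I) \<subseteq> Par ` A \<union> Xv ` X \<union> At (- T (Suc n))"
          using nT by (intro ren_Un_arr) auto
        \<comment> \<open>The block around \<open>?p\<close> is for \<open>a\<close> what the block
          around 0 is for \<open>a0\<close>; hence \<open>\<Sigma>\<close>.\<close>
        from tpeq_subst[OF aE' this]
        have v: "tpeq L U (Par ` A \<union> Xv ` X \<union> At ?I) (asg a0 D0) ?v" by (simp add: asg_ren)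
        have "Par ` A \<union> Zx \<union> At ?I \<subseteq> Par ` A \<union> Xv ` X \<union> At ?I" using Zx(2) by auto
        from tpeqD[OF v dfn_mono[OF \<Sigma>(1) this]] \<Sigma>(3) have "\<Sigma> ?v" by simp
        have vdom: "?v ` (Zp \<union> Zx \<union> At ?I) \<subseteq> Dom U"
        proof (rule image_subsetI)
          fix x assume x: "x \<in> Zp \<union> Zx \<union> At ?I"
          show "?v x \<in> Dom U"
          proof (cases x)
            case (Arr i q y)
            then have "x \<in> At ?I" using x znot by auto
            then show ?thesis using tpeq_dom(2)[OF v] by blast
          qed (use x zp zx znot adom in auto)
        qed
        \<comment> \<open>The tests do not look at the centre, and elsewhere in this block
          \<open>E'\<close> agrees with \<open>D\<close>, so the choice of \<open>k\<close>
          applies.\<close>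
        have Pv: "P j ?v = P j (?v \<circ> ren (f j))" if j: "j \<in> J" for j
        proof -
          have e: "P j (asg a (\<lambda>i q. D i (?p + g i q))) = P j (asg a (\<lambda>i q. E' i (?p + g i q)))"
            if g: "\<And>i q. i \<in> K \<Longrightarrow> q \<in> R j i \<Longrightarrow> g i q \<in> ?I - {0}" for g
          proof (rule dfn_cong[OF P[OF j]])
            show "asg a (\<lambda>i q. D i (?p + g i q)) ` (Zp \<union> Zx \<union> Ar (R j)) \<subseteq> Dom U"
            proof (rule image_subsetI)
              fix x assume x: "x \<in> Zp \<union> Zx \<union> Ar (R j)"
              show "asg a (\<lambda>i q. D i (?p + g i q)) x \<in> Dom U"
              proof (cases x)
                case (Arr i q y)
                then have "Arr i (?p + g i q) y \<in> At UNIV" using x Zp(2) Zx(2) by auto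
                then have "asg a0 D (Arr i (?p + g i q) y) \<in> Dom U" using rmi_dom[OF rB] by blast
                then show ?thesis using Arr by simp
              qed (use x zp zx znot adom in auto)
            qed
            show "asg a (\<lambda>i q. D i (?p + g i q)) x = asg a (\<lambda>i q. E' i (?p + g i q)) x"
              if "x \<in> Zp \<union> Zx \<union> Ar (R j)" for x
              using that E'D g Zp(2) Zx(2) by (cases x) auto
          qed
          have "P j (asg a (?sh ?p D)) = P j ?v" using R[OF j] by (intro e) blast
          moreover have "P j (asg a (\<lambda>i q. D i (?p + f j i q))) = P j (asg a (\<lambda>i q. E' i (?p + f j i q)))"
            using f[OF j] unfolding into_def by (intro e) blast
          ultimately show ?thesis using k(2)[OF j] by (simp add: asg_ren)
        qed
        have ov: "override_on (asg a0 (?sh ?p E')) ?v Zx x = ?v x" if "x \<in> Zp \<union> Zx \<union> At G" for x G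
          using that Zp(2) Zx(2) by (cases x) (auto simp: override_on_def)
        let ?u = "override_on (asg a0 (?sh ?p E')) ?v Zx"
        have "\<Sigma> ?v = \<Sigma> ?u" using ov by (intro dfn_cong[OF \<Sigma>(2) vdom]) simp
        moreover have "P j ?v = P j ?u" if j: "j \<in> J" for j
        proof (rule dfn_cong[OF P[OF j]])
          show "?v ` (Zp \<union> Zx \<union> Ar (R j)) \<subseteq> Dom U" using vdom R[OF j] by (fastforce simp: arr_def)
          show "?v x = ?u x" if "x \<in> Zp \<union> Zx \<union> Ar (R j)" for x
            using ov[of x UNIV] that by (auto simp: arr_def)
        qed
        moreover have "P j (?v \<circ> ren (f j)) = P j (?u \<circ> ren (f j))" if j: "j \<in> J" for j
        proof (rule dfn_cong[OF P[OF j]])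
          have "ren (f j) ` (Zp \<union> Zx \<union> Ar (R j)) \<subseteq> Zp \<union> Zx \<union> At ?I"
            using f[OF j] Zp(2) Zx(2) by (intro ren_Un_arr) (auto simp: into_def)
          then show "(?v \<circ> ren (f j)) ` (Zp \<union> Zx \<union> Ar (R j)) \<subseteq> Dom U"
            using vdom by (fastforce simp: image_subset_iff)
          fix x assume "x \<in> Zp \<union> Zx \<union> Ar (R j)"
          then have "ren (f j) x \<in> Zp \<union> Zx \<union> At ?I"
            using \<open>ren (f j) ` (Zp \<union> Zx \<union> Ar (R j)) \<subseteq> Zp \<union> Zx \<union> At ?I\<close> by blast
          then show "(?v \<circ> ren (f j)) x = (?u \<circ> ren (f j)) x" using ov by simp
        qed
        moreover have "?v ` Zx \<subseteq> Dom U" using vdom by blast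
        ultimately have "\<not> \<Theta> (asg a0 (?sh ?p E'))"
          unfolding \<Theta>_def not_not using \<open>\<Sigma> ?v\<close> Pv by (intro exI[of _ ?v] conjI ballI) simp_all
        then show ?thesis using 2 k(1) by blast
      qed
    qed
  qed
  obtain E where E: "tpeq L U (Par ` A \<union> At (- T N\<Theta>)) (asg a0 D0) (asg a0 E)"
      "\<And>i q. q \<notin> C N\<Theta> \<Longrightarrow> E i q = D i q" "\<And>l. l < N\<Theta> \<Longrightarrow> \<exists>k \<in> {1..N1}. \<not> \<Theta> (asg a0 (?sh (pos l k) E))"
    using ind[of N\<Theta>] by blast
  then obtain k where k: "\<And>l. l < N\<Theta> \<Longrightarrow> k l \<in> {1..N1}" "\<And>l. l < N\<Theta> \<Longrightarrow> \<not> \<Theta> (asg a0 (?sh (pos l (k l)) E))"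
    by metis
  \<comment> \<open>The empty base is enough here: the parameters of \<open>\<Theta>\<close> are
    quantified in the count that follows.\<close>
  have rE: "rmi (- T N\<Theta>) {} a0 E"
  proof (rule rmi_tpeq)
    show "rmi (- T N\<Theta>) {} a0 D0" unfolding rmi_def
    proof (intro allI impI, elim conjE)
      fix F h assume "into (- T N\<Theta>) F h"
      then have "into UNIV F h" by (simp add: into_def)
      then have "tpeq L U (Par ` A \<union> Ar F) (asg a0 D0) (asg a0 (\<lambda>i q. D0 i (h i q)))"
        by (intro rmiD[OF r1]) auto
      then show "tpeq L U ({} \<union> Ar F) (asg a0 D0) (asg a0 (\<lambda>i q. D0 i (h i q)))"
        by (rule tpeq_mono) auto
    qed
    show "tpeq L U ({} \<union> At (- T N\<Theta>)) (asg a0 D0) (asg a0 E)" using E(1) by (rule tpeq_mono) auto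
  qed auto
  have nT: "pos l k' + q \<in> - T N\<Theta>" if "q \<in> ?I" "k' \<in> {1..N1 + 1}" for l k' q
    using pos[of l k' q _ 0] that by (fastforce simp: T_def)
  have range: "pos l k' + q \<in> {pos l 0 - M<..<pos l (N1 + 1) + M}" if "q \<in> ?I" "k' \<in> {1..N1 + 1}" for l k' q
  proof -
    have "(of_nat k' :: rat) \<le> of_nat (N1 + 1)" using that(2) by (simp only: of_nat_le_iff) simp
    then have "2 * M * of_nat k' \<le> 2 * M * of_nat (N1 + 1)" using M by (intro mult_left_mono) auto
    moreover have "0 \<le> 2 * M * of_nat k'" using M by simp
    moreover have "pos l k' = pos l 0 + 2 * M * of_nat k'"
      "pos l (N1 + 1) = pos l 0 + 2 * M * of_nat (N1 + 1)"
      unfolding pos_def idx_def of_nat_add by (simp_all add: algebra_simps)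
    ultimately show ?thesis using that(1) unfolding greaterThanLessThan_iff by linarith
  qed
  \<comment> \<open>Each group contributes one switch: \<open>\<Theta>\<close> is true at slot
    \<open>N1 + 1\<close> and false at slot \<open>k l\<close>.\<close>
  have "card {..<N\<Theta>} < N\<Theta>"
  proof (rule switch_card[OF rE, of Zp "\<lambda>_. ?I" \<Theta> N\<Theta> "{..<N\<Theta>}" "\<lambda>l. pos l (N1 + 1)" "\<lambda>l. pos l 0 - M"
        "\<lambda>l. pos l (N1 + 1) + M" "\<lambda>l i q. pos l (k l) + q"])
    show "asg a0 E ` Zp \<subseteq> Dom U" using Zp(2) AB by fastforce
    show "dfn L U (Zp \<union> {} \<union> At ?I) \<Theta>" using d\<Theta> by simp
    fix l i q assume "l \<in> {..<N\<Theta>}" "q \<in> ?I"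
    then show "pos l (N1 + 1) + q \<in> - T N\<Theta> \<inter> {pos l 0 - M<..<pos l (N1 + 1) + M}"
      using nT[of q "N1 + 1" l] range[of q "N1 + 1" l] by simp
  next
    fix l i q assume "l \<in> {..<N\<Theta>}" "q \<in> ?I"
    then show "pos l (k l) + q \<in> - T N\<Theta> \<inter> {pos l 0 - M<..<pos l (N1 + 1) + M}"
      using nT[of q "k l" l] range[of q "k l" l] k(1)[of l] by simp
  next
    fix l l' :: nat assume "l < l'"
    then have "idx l (N1 + 1) + 1 \<le> idx l' 0"
      using mult_le_mono1[of "Suc l" l' "N1 + 2"] by (simp add: idx_def)
    then have "of_nat (idx l (N1 + 1)) + (1 :: rat) \<le> of_nat (idx l' 0)"
      by (metis of_nat_1 of_nat_add of_nat_le_iff)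
    then have "2 * M * (of_nat (idx l (N1 + 1)) + 1) \<le> 2 * M * of_nat (idx l' 0)"
      using M by (intro mult_left_mono) auto
    then show "pos l (N1 + 1) + M \<le> pos l' 0 - M" by (simp add: pos_def algebra_simps)
  next
    fix l assume l: "l \<in> {..<N\<Theta>}"
    have nC: "pos l (N1 + 1) + q \<notin> C N\<Theta>" if "q \<in> ?I" for q
      using pos[of l "N1 + 1" q] that by (fastforce simp: C_def)
    have "\<Theta> (asg a0 (?sh (pos l (N1 + 1)) D)) = \<Theta> (asg a0 (?sh (pos l (N1 + 1)) E))"
    proof (rule dfn_cong[OF d\<Theta>])
      show "asg a0 (?sh (pos l (N1 + 1)) D) ` (Zp \<union> At ?I) \<subseteq> Dom U"
      proof (rule image_subsetI)
        fix x assume x: "x \<in> Zp \<union> At ?I"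
        show "asg a0 (?sh (pos l (N1 + 1)) D) x \<in> Dom U"
        proof (cases x)
          case (Arr i q y)
          then have "Arr i (pos l (N1 + 1) + q) y \<in> At UNIV" using x Zp(2) by auto
          then have "asg a0 D (Arr i (pos l (N1 + 1) + q) y) \<in> Dom U" using rmi_dom[OF rB] by blast
          then show ?thesis using Arr by simp
        qed (use x zp znot in auto)
      qed
      show "asg a0 (?sh (pos l (N1 + 1)) D) x = asg a0 (?sh (pos l (N1 + 1)) E) x"
        if "x \<in> Zp \<union> At ?I" for x
        using that E(2) nC Zp(2) by (cases x) auto
    qed
    then show "\<Theta> (asg a0 (\<lambda>i q. E i (pos l (N1 + 1) + q))) \<noteq> \<Theta> (asg a0 (\<lambda>i q. E i (pos l (k l) + q)))"
      using \<Theta>D k(2)[of l] l by simp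
  qed (use Zp N\<Theta> in \<open>auto simp: strict_mono_on_def\<close>)
  then show False by simp
qed

end

context array_structure
begin

text \<open>The array \<open>D\<close> is fixed beforehand by \<open>rmi_extract\<close>; only the
  coordinates of the tuple are unknowns of the compactness argument. An unsolvable finite fragment
  would contradict \<open>base_change_step\<close>.\<close>

lemma base_change:
  assumes AB: "A \<subseteq> B" "B \<subseteq> Dom U" and small: "|B| <o \<mu>" "|X| <o \<mu>"
    and r1: "rmi UNIV (Par ` A) a0 D0" and r2: "rmi (- {0}) (Par ` A \<union> Xv ` X) a0 D0"
  obtains a D where "tpeq L U (Par ` A \<union> Xv ` X \<union> At UNIV) (asg a0 D0) (asg a D)"
    "rmi UNIV (Par ` B) a D" "rmi (- {0}) (Par ` B \<union> Xv ` X) a D"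
proof -
  obtain D where tD: "tpeq L U (Par ` A \<union> At UNIV) (asg a0 D0) (asg a0 D)"
    and rB: "rmi UNIV (Par ` B) a0 D"
    using rmi_extract[OF AB small(1) r1] by blast
  let ?S = "Par ` B \<union> At UNIV" and ?V = "Xv ` X :: ('u, 'c, 'k, rat) vr set"
  have Xdom: "x \<in> X \<Longrightarrow> a0 x \<in> Dom U" for x
    using rmi_dom[OF r2] by (simp add: image_subset_iff ball_Un)
  define tr where "tr = (\<lambda>(P :: (('u, 'c, 'k, rat) vr \<Rightarrow> 'u) \<Rightarrow> bool, F :: 'k \<Rightarrow> rat set, f).
    dfn L U (Par ` B \<union> ?V \<union> Ar F) P \<and> (\<forall>i \<in> K. F i \<subseteq> - {0}) \<and> into (- {0}) F f)"
  define cond where "cond = (\<lambda>(P :: (('u, 'c, 'k, rat) vr \<Rightarrow> 'u) \<Rightarrow> bool, F :: 'k \<Rightarrow> rat set, f) v.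
    P v = P (v \<circ> ren f))"
  let ?\<Phi>1 = "{P. dfn L U (Par ` A \<union> ?V \<union> At UNIV) P \<and> P (asg a0 D0)}"
  let ?\<Phi> = "?\<Phi>1 \<union> cond ` Collect tr"
  have FV: "Par ` B \<union> ?V \<union> Ar F \<subseteq> ?S \<union> ?V" for F using arr_mono[of K F "\<lambda>_. UNIV" Y] by auto
  have rF: "ren f ` (Par ` B \<union> ?V \<union> Ar F) \<subseteq> ?S \<union> ?V" for f F
  proof -
    have "ren f ` (Par ` B \<union> ?V \<union> Ar F) \<subseteq> Par ` B \<union> ?V \<union> At UNIV" by (rule ren_Un_arr) auto
    then show ?thesis by auto
  qed
  have dcond: "dfn L U (?S \<union> ?V) (cond j)" if "tr j" for j
  proof -
    obtain P F f where j: "j = (P, F, f)" by (cases j) auto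
    have "dfn L U (Par ` B \<union> ?V \<union> Ar F) P" using that j by (simp add: tr_def)
    from dfn_Iff[OF dfn_mono[OF this FV] dfn_subst'[OF this rF[of f F]]]
    show ?thesis unfolding j cond_def prod.case .
  qed
  have Ddom: "asg a0 D ` ?S \<subseteq> Dom U" using rmi_dom[OF rB] by auto
  obtain w where w: "w ` ?V \<subseteq> Dom U" "\<And>P. P \<in> ?\<Phi> \<Longrightarrow> P (override_on (asg a0 D) w ?V)"
  proof (rule compactness[of ?\<Phi> ?S ?V "asg a0 D"])
    show "dfn L U (?S \<union> ?V) P" if "P \<in> ?\<Phi>" for P
      using that
    proof
      assume "P \<in> ?\<Phi>1"
      then show ?thesis using AB by (auto intro: dfn_mono[of L U "Par ` A \<union> ?V \<union> At UNIV"])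
    qed (use dcond in auto)
    show "|?S| <o \<mu>" using small(1) by (intro small_Un small_image small_arr)
    show "|?V| <o \<mu>" using small(2) by (rule small_image)
    show "asg a0 D ` ?S \<subseteq> Dom U" by (rule Ddom)
    fix \<Phi>0 assume \<Phi>0: "finite \<Phi>0" "\<Phi>0 \<subseteq> ?\<Phi>"
    define \<Phi>1 where "\<Phi>1 = \<Phi>0 \<inter> ?\<Phi>1"
    have f1: "finite \<Phi>1" and s1: "\<Phi>1 \<subseteq> ?\<Phi>1" using \<Phi>0 by (simp_all add: \<Phi>1_def)
    have "finite (\<Phi>0 - ?\<Phi>1)" "\<Phi>0 - ?\<Phi>1 \<subseteq> cond ` Collect tr" using \<Phi>0 by auto
    from finite_subset_image[OF this] obtain J where J: "J \<subseteq> Collect tr" "finite J"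
      "\<Phi>0 - ?\<Phi>1 = cond ` J" by (elim exE conjE) (rule that)
    have "dfn L U (Par ` A \<union> ?V \<union> At UNIV) (\<lambda>v. \<forall>P \<in> \<Phi>1. P v)"
      using f1 s1 by (intro dfn_Ball[of _ L U _ "\<lambda>P. P"]) auto
    then obtain S1 \<Sigma> where S1: "finite S1" "S1 \<subseteq> Par ` A \<union> ?V \<union> At UNIV" "dfn L U S1 \<Sigma>"
      "\<And>v. v ` (Par ` A \<union> ?V \<union> At UNIV) \<subseteq> Dom U \<Longrightarrow> (\<forall>P \<in> \<Phi>1. P v) = \<Sigma> v" by (rule dfn_finite) blast
    have "\<exists>T Q. finite T \<and> T \<subseteq> Par ` B \<union> ?V \<union> Ar (fst (snd j)) \<and> dfn L U T Q \<and>
        (\<forall>v. v ` (Par ` B \<union> ?V \<union> Ar (fst (snd j))) \<subseteq> Dom U \<longrightarrow> fst j v = Q v)" if "j \<in> J" for j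
    proof -
      have "dfn L U (Par ` B \<union> ?V \<union> Ar (fst (snd j))) (fst j)"
        using that J(1) by (auto simp: tr_def)
      then obtain T Q where "finite T" "T \<subseteq> Par ` B \<union> ?V \<union> Ar (fst (snd j))" "dfn L U T Q"
        "\<And>v. v ` (Par ` B \<union> ?V \<union> Ar (fst (snd j))) \<subseteq> Dom U \<Longrightarrow> fst j v = Q v" by (rule dfn_finite) blast
      then show ?thesis by (intro exI[of _ T] exI[of _ Q]) simp
    qed
    then obtain T Q where TQ: "\<forall>j \<in> J. finite (T j) \<and> T j \<subseteq> Par ` B \<union> ?V \<union> Ar (fst (snd j)) \<and>
        dfn L U (T j) (Q j) \<and>
        (\<forall>v. v ` (Par ` B \<union> ?V \<union> Ar (fst (snd j))) \<subseteq> Dom U \<longrightarrow> fst j v = Q j v)"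
      unfolding bchoice_iff[symmetric] by (metis (no_types, lifting))
    have T: "finite (T j)" "T j \<subseteq> Par ` B \<union> ?V \<union> Ar (fst (snd j))" "dfn L U (T j) (Q j)"
      "\<And>v. v ` (Par ` B \<union> ?V \<union> Ar (fst (snd j))) \<subseteq> Dom U \<Longrightarrow> fst j v = Q j v" if "j \<in> J" for j
      using TQ that by simp_all
    have tr: "\<forall>i \<in> K. fst (snd j) i \<subseteq> - {0}" "into (- {0}) (fst (snd j)) (snd (snd j))" if "j \<in> J" for j
      using J(1) that by (auto simp: tr_def)
    let ?St = "S1 \<union> (\<Union>j \<in> J. T j)"
    have finSt: "finite ?St" using S1(1) J(2) T(1) by auto
    have StS: "?St \<subseteq> Par ` B \<union> ?V \<union> At UNIV"
    proof -
      have "S1 \<subseteq> Par ` B \<union> ?V \<union> At UNIV" using S1(2) image_mono[OF AB(1), of Par] by blast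
      moreover have "T j \<subseteq> Par ` B \<union> ?V \<union> At UNIV" if "j \<in> J" for j
        using T(2)[OF that] arr_mono[of K "fst (snd j)" "\<lambda>_. UNIV" Y] by auto
      ultimately show ?thesis by blast
    qed
    define po :: "('u, 'c, 'k, rat) vr \<Rightarrow> rat" where "po = (\<lambda>x. case x of Arr i q y \<Rightarrow> q | _ \<Rightarrow> 0)"
    define QS where "QS = po ` ?St \<union> (\<Union>j \<in> J. (\<lambda>x. po (ren (snd (snd j)) x)) ` T j)"
    have finQS: "finite QS" unfolding QS_def using finSt J(2) T(1) by auto
    \<comment> \<open>All positions of the fragment, before and after the moves, are at distance
      less than \<open>M\<close> from the centre.\<close>
    define M where "M = Max (insert 0 (abs ` QS)) + 1"
    have M: "\<bar>q\<bar> < M" if "q \<in> QS" for q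
    proof -
      have "\<bar>q\<bar> \<le> Max (insert 0 (abs ` QS))" using finQS that by (intro Max_ge) auto
      then show ?thesis unfolding M_def by linarith
    qed
    have "0 \<le> Max (insert 0 (abs ` QS))" using finQS by (intro Max_ge) auto
    then have M0: "M > 0" unfolding M_def by linarith
    define R where "R = (\<lambda>j i. {q. \<exists>y. Arr i q y \<in> T j})"
    let ?Zx = "?St \<inter> ?V" and ?Zp = "?St \<inter> Par ` B"
    have S1q: "q \<in> {-M<..<M}" if "Arr i q y \<in> S1" for i q y
    proof -
      have "po (Arr i q y) \<in> QS" unfolding QS_def using that by blast
      then show ?thesis using M[of q] by (auto simp: po_def abs_less_iff)
    qed
    have Tq: "q \<in> {-M<..<M} - {0}" "i \<in> K" "y \<in> Y i" "q \<in> fst (snd j) i"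
      "snd (snd j) i q \<in> {-M<..<M} - {0}" if j: "j \<in> J" and "Arr i q y \<in> T j" for i q y j
    proof -
      have "Arr i q y \<in> Par ` B \<union> ?V \<union> Ar (fst (snd j))" using T(2)[OF j] that(2) by blast
      then show i: "i \<in> K" "y \<in> Y i" "q \<in> fst (snd j) i" by auto
      have "po (Arr i q y) \<in> QS" "po (ren (snd (snd j)) (Arr i q y)) \<in> QS" unfolding QS_def using that by blast+
      then show "q \<in> {-M<..<M} - {0}" "snd (snd j) i q \<in> {-M<..<M} - {0}"
        using M[of q] M[of "snd (snd j) i q"] tr[OF j] i unfolding into_def
        by (auto simp: po_def abs_less_iff)
    qed
    show "\<exists>w. w ` ?V \<subseteq> Dom U \<and> (\<forall>P \<in> \<Phi>0. P (override_on (asg a0 D) w ?V))"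
    proof (rule ccontr)
      assume no: "\<not> (\<exists>w. w ` ?V \<subseteq> Dom U \<and> (\<forall>P \<in> \<Phi>0. P (override_on (asg a0 D) w ?V)))"
      show False
      proof (rule base_change_step[where Zx = ?Zx and Zp = ?Zp and J = J and M = M and \<Sigma> = \<Sigma> and P = Q
            and R = R and f = "\<lambda>j. snd (snd j)", OF AB small r1 r2 tD rB])
        show "finite ?Zx" "?Zx \<subseteq> ?V" "finite ?Zp" "?Zp \<subseteq> Par ` B" "finite J" "M > 0"
          using finSt J(2) M0 by auto
        show "dfn L U (Par ` A \<union> ?Zx \<union> At {-M<..<M}) \<Sigma>"
        proof (rule dfn_mono[OF S1(3)], rule subsetI)
          fix x assume x: "x \<in> S1"
          then have "x \<in> Par ` A \<union> ?V \<union> At UNIV" using S1(2) by blast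
          then show "x \<in> Par ` A \<union> ?Zx \<union> At {-M<..<M}" using x S1q by (cases x) auto
        qed
        show "dfn L U (?Zp \<union> ?Zx \<union> At {-M<..<M}) \<Sigma>"
        proof (rule dfn_mono[OF S1(3)], rule subsetI)
          fix x assume x: "x \<in> S1"
          then have "x \<in> Par ` A \<union> ?V \<union> At UNIV" using S1(2) by blast
          then show "x \<in> ?Zp \<union> ?Zx \<union> At {-M<..<M}" using x S1q AB by (cases x) auto
        qed
        have "\<forall>P \<in> \<Phi>1. P (asg a0 D0)" using s1 by blast
        moreover have "asg a0 D0 ` (Par ` A \<union> ?V \<union> At UNIV) \<subseteq> Dom U"
          using rmi_dom[OF r1] Xdom by (auto simp: image_Un)
        ultimately show "\<Sigma> (asg a0 D0)" using S1(4)[of "asg a0 D0"] by simp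
        fix j assume j: "j \<in> J"
        show "dfn L U (?Zp \<union> ?Zx \<union> Ar (R j)) (Q j)"
        proof (rule dfn_mono[OF T(3)[OF j]], rule subsetI)
          fix x assume x: "x \<in> T j"
          then have "x \<in> Par ` B \<union> ?V \<union> Ar (fst (snd j))" using T(2)[OF j] by blast
          then show "x \<in> ?Zp \<union> ?Zx \<union> Ar (R j)" using x j by (cases x) (auto simp: R_def)
        qed
        show "R j i \<subseteq> {-M<..<M} - {0}" for i using Tq(1)[OF j] unfolding R_def by blast
        show "into ({-M<..<M} - {0}) (R j) (snd (snd j))"
          unfolding into_def
        proof (intro ballI conjI)
          fix i assume i: "i \<in> K"
          have "R j i \<subseteq> fst (snd j) i" using Tq(4)[OF j] unfolding R_def by blast
          then show "strict_mono_on (R j i) (snd (snd j) i)"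
            using tr(2)[OF j] i unfolding into_def strict_mono_on_def by blast
          show "snd (snd j) i ` R j i \<subseteq> {-M<..<M} - {0}"
          proof (rule image_subsetI)
            fix q assume "q \<in> R j i"
            then obtain y where "Arr i q y \<in> T j" unfolding R_def by blast
            then show "snd (snd j) i q \<in> {-M<..<M} - {0}" by (rule Tq(5)[OF j])
          qed
        qed
      next
        fix z assume z: "z ` ?Zx \<subseteq> Dom U" and \<Sigma>: "\<Sigma> (override_on (asg a0 D) z ?Zx)"
        show "\<exists>j \<in> J. Q j (override_on (asg a0 D) z ?Zx) \<noteq>
          Q j (override_on (asg a0 D) z ?Zx \<circ> ren (snd (snd j)))"
        proof (rule ccontr)
          assume "\<not> ?thesis"
          then have eq: "Q j (override_on (asg a0 D) z ?Zx) =
            Q j (override_on (asg a0 D) z ?Zx \<circ> ren (snd (snd j)))" if "j \<in> J" for j using that by blast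
          define w where "w = override_on (asg a0 D) z ?Zx"
          have wV: "w ` ?V \<subseteq> Dom U"
          proof (rule image_subsetI)
            fix x assume "x \<in> ?V"
            then show "w x \<in> Dom U" using z Xdom by (cases "x \<in> ?Zx") (auto simp: w_def)
          qed
          have u: "override_on (asg a0 D) w ?V = w"
            by (auto simp: w_def override_on_def fun_eq_iff)
          have udom: "w ` (?S \<union> ?V) \<subseteq> Dom U"
            using override_on_image_subset[OF Ddom wV, of "?S \<union> ?V"] unfolding u by blast
          have "P w" if P: "P \<in> \<Phi>0" for P
          proof (cases "P \<in> \<Phi>1")
            case True
            have "w ` (Par ` A \<union> ?V \<union> At UNIV) \<subseteq> w ` (?S \<union> ?V)" using AB by (intro image_mono) auto
            then have "w ` (Par ` A \<union> ?V \<union> At UNIV) \<subseteq> Dom U" using udom by (rule subset_trans)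
            then have "\<forall>P \<in> \<Phi>1. P w" using S1(4)[of w] \<Sigma> unfolding w_def[symmetric] by simp
            then show ?thesis using True by (rule bspec)
          next
            case False
            then have "P \<in> cond ` J" using P J(3) \<Phi>1_def by blast
            then obtain j where j: "j \<in> J" and Pj: "P = cond j" by auto
            have "w ` (Par ` B \<union> ?V \<union> Ar (fst (snd j))) \<subseteq> Dom U"
              by (rule subset_trans[OF image_mono[OF FV] udom])
            then have "fst j w = Q j w" by (rule T(4)[OF j])
            also have "\<dots> = Q j (w \<circ> ren (snd (snd j)))" using eq[OF j] unfolding w_def .
            also have "(w \<circ> ren (snd (snd j))) ` (Par ` B \<union> ?V \<union> Ar (fst (snd j))) \<subseteq> Dom U"
              unfolding image_comp[symmetric] by (rule subset_trans[OF image_mono[OF rF] udom])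
            then have "Q j (w \<circ> ren (snd (snd j))) = fst j (w \<circ> ren (snd (snd j)))"
              by (rule T(4)[OF j, symmetric])
            finally show ?thesis unfolding Pj cond_def by (cases j) simp
          qed
          then have "\<forall>P \<in> \<Phi>0. P w" by (rule ballI)
          then have "\<exists>w. w ` ?V \<subseteq> Dom U \<and> (\<forall>P \<in> \<Phi>0. P (override_on (asg a0 D) w ?V))"
            using wV u by (intro exI[of _ w]) simp
          with no show False by (rule notE)
        qed
      qed
    qed
  qed blast
  define v where "v = override_on (asg a0 D) w ?V"
  define a where "a = (\<lambda>x. v (Xv x))"
  have v: "v = asg a D"
  proof
    show "v x = asg a D x" for x by (cases x) (auto simp: v_def a_def override_on_def)
  qed
  have vdom: "asg a D ` (?S \<union> ?V) \<subseteq> Dom U"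
    unfolding v[symmetric] v_def by (rule override_on_image_subset[OF Ddom w(1)]) auto
  show ?thesis
  proof (rule that)
    show "tpeq L U (Par ` A \<union> ?V \<union> At UNIV) (asg a0 D0) (asg a D)"
    proof (rule tpeqI)
      show "asg a0 D0 ` (Par ` A \<union> ?V \<union> At UNIV) \<subseteq> Dom U"
        using rmi_dom[OF r1] Xdom by (auto simp: image_Un)
      have "Par ` A \<union> ?V \<union> At UNIV \<subseteq> ?S \<union> ?V" using AB by auto
      from subset_trans[OF image_mono[OF this] vdom]
      show "asg a D ` (Par ` A \<union> ?V \<union> At UNIV) \<subseteq> Dom U" .
      show "P (asg a D)" if "dfn L U (Par ` A \<union> ?V \<union> At UNIV) P" "P (asg a0 D0)" for P
        using w(2)[of P] that unfolding v[symmetric] v_def by simp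
    qed
    show "rmi UNIV (Par ` B) a D"
      by (rule rmi_tpeq[OF rB], force, rule tpeq_refl[OF rmi_dom[OF rB]]) (auto simp: arr_def)
    show "rmi (- {0}) (Par ` B \<union> ?V) a D"
      unfolding rmi_def
    proof (intro allI impI, elim conjE)
      fix F f assume F: "\<forall>i \<in> K. F i \<subseteq> - {0}" and f: "into (- {0}) F f"
      show "tpeq L U (Par ` B \<union> ?V \<union> Ar F) (asg a D) (asg a (\<lambda>i q. D i (f i q)))"
      proof (rule tpeqI)
        show "asg a D ` (Par ` B \<union> ?V \<union> Ar F) \<subseteq> Dom U"
          by (rule subset_trans[OF image_mono[OF FV] vdom])
        have "asg a (\<lambda>i q. D i (f i q)) ` (Par ` B \<union> ?V \<union> Ar F) = asg a D ` ren f ` (Par ` B \<union> ?V \<union> Ar F)"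
          unfolding asg_ren[symmetric] by (simp only: image_comp)
        also have "\<dots> \<subseteq> Dom U" by (rule subset_trans[OF image_mono[OF rF] vdom])
        finally show "asg a (\<lambda>i q. D i (f i q)) ` (Par ` B \<union> ?V \<union> Ar F) \<subseteq> Dom U" .
        show "P (asg a (\<lambda>i q. D i (f i q)))" if "dfn L U (Par ` B \<union> ?V \<union> Ar F) P" "P (asg a D)" for P
        proof -
          have "(P, F, f) \<in> Collect tr" using that(1) F f by (simp add: tr_def)
          then have "cond (P, F, f) \<in> ?\<Phi>" by (intro UnI2 imageI)
          from w(2)[OF this] show ?thesis
            using that(2) unfolding v_def[symmetric] v by (simp add: cond_def asg_ren)
        qed
      qed
    qed
  qed
qed

end

section \<open>Indiscernibility in terms of definable predicates\<close>

abbreviation tup :: "('i, 'y, 'u) tseq \<Rightarrow> (nat \<Rightarrow> 'i) \<Rightarrow> (nat \<times> 'y) + 'u \<Rightarrow> 'u" where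
  "tup I s \<equiv> case_sum (\<lambda>(k, y). snd I (s k) y) id"

abbreviation tvars :: "nat \<Rightarrow> 'y set \<Rightarrow> 'u set \<Rightarrow> ((nat \<times> 'y) + 'u) set" where
  "tvars n Y C \<equiv> Inl ` ({..<n} \<times> Y) \<union> Inr ` C"

lemma tup_dom:
  assumes "is_seq M Y I" "C \<subseteq> Dom M" "increasing (fst I) n s"
  shows "tup I s ` tvars n Y C \<subseteq> Dom M"
  using assms by (auto simp: is_seq_def increasing_def tuples_def image_subset_iff)

lemma indiscernibleD:
  assumes I: "indiscernible L M Y C I" "is_seq M Y I" "C \<subseteq> Dom M" and P: "dfn L M (tvars n Y C) P"
    and st: "increasing (fst I) n s" "increasing (fst I) n t"
  shows "P (tup I s) = P (tup I t)"
proof -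
  obtain \<psi> where \<psi>: "wf_fm L \<psi>" "fv \<psi> \<subseteq> id ` tvars n Y C"
    "\<And>v. v ` id ` tvars n Y C \<subseteq> Dom M \<Longrightarrow> sat M v \<psi> = P (v \<circ> id)"
    by (rule dfn_to_formula[OF P, where h = id]) (simp_all add: finite_Plus_UNIV_iff finite_prod)
  have e: "sat M (tup I s) \<psi> = P (tup I s)" if "increasing (fst I) n s" for s
    using \<psi>(3)[of "tup I s"] tup_dom[OF I(2,3) that] by simp
  have "\<psi> \<in> pfms L ({..<n} \<times> Y) C" using \<psi>(1,2) by (simp add: pfms_def)
  then have "psat M (\<lambda>(k, y). snd I (s k) y) \<psi> = psat M (\<lambda>(k, y). snd I (t k) y) \<psi>"
    using I(1) st unfolding indiscernible_def by blast
  then show ?thesis using e[OF st(1)] e[OF st(2)] by (simp add: psat_def)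
qed

lemma indiscernibleI:
  assumes "\<And>n P s t. dfn L M (tvars n Y C) P \<Longrightarrow> increasing (fst I) n s \<Longrightarrow> increasing (fst I) n t \<Longrightarrow>
    P (tup I s) = P (tup I t)"
  shows "indiscernible L M Y C I"
  unfolding indiscernible_def
proof (intro allI ballI impI, elim conjE)
  fix n \<phi> s t assume "\<phi> \<in> pfms L ({..<n} \<times> Y) C" and st: "increasing (fst I) n s" "increasing (fst I) n t"
  then have "dfn L M (tvars n Y C) (\<lambda>v. sat M (v \<circ> id) \<phi>)" by (intro dfn_formula) (auto simp: pfms_def)
  from assms[OF this st] show "psat M (\<lambda>(k, y). snd I (s k) y) \<phi> = psat M (\<lambda>(k, y). snd I (t k) y) \<phi>"
    by (simp add: psat_def)
qed

lemma indiscernible_mono: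
  "indiscernible L M Y C I \<Longrightarrow> C' \<subseteq> C \<Longrightarrow> indiscernible L M Y C' I"
  unfolding indiscernible_def pfms_def by (simp add: subset_iff) blast

lemma seq_elems_dom: "is_seq M Y I \<Longrightarrow> seq_elems Y I \<subseteq> Dom M"
  by (auto simp: is_seq_def seq_elems_def tuples_def)

section \<open>Parameters as constant coordinates\<close>

definition mapseq :: "(('y \<Rightarrow> 'u) \<Rightarrow> 'z \<Rightarrow> 'u) \<Rightarrow> ('i, 'y, 'u) tseq \<Rightarrow> ('i, 'z, 'u) tseq" where
  "mapseq g I = (fst I, \<lambda>t. g (snd I t))"

lemma mapseq_append: "mapseq g I \<oplus> mapseq g J = mapseq g (I \<oplus> J)"
  by (auto simp: mapseq_def seq_append_def fun_eq_iff split: sum.split)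

lemma mapseq_single: "seq_single (g b) = mapseq g (seq_single b)"
  by (simp add: mapseq_def seq_single_def)

lemma fst_mapseq [simp]: "fst (mapseq g I) = fst I"
  by (simp add: mapseq_def)

text \<open>The tuple \<open>d\<close> with the elements of \<open>B\<close> as further coordinates.
  \<open>\<iota>\<close> fits the enlarged set of coordinates into the prescribed type.\<close>

definition cmb :: "('y + 'u \<Rightarrow> 'z) \<Rightarrow> 'y set \<Rightarrow> 'u set \<Rightarrow> ('y \<Rightarrow> 'u) \<Rightarrow> 'z \<Rightarrow> 'u" where
  "cmb \<iota> Y B d z = (case inv_into (Y <+> B) \<iota> z of Inl y \<Rightarrow> d y | Inr c \<Rightarrow> c)"

lemma cmb_simps:
  assumes "inj_on \<iota> (Y <+> B)"
  shows "y \<in> Y \<Longrightarrow> cmb \<iota> Y B d (\<iota> (Inl y)) = d y" "c \<in> B \<Longrightarrow> cmb \<iota> Y B d (\<iota> (Inr c)) = c"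
  using assms by (simp_all add: cmb_def InlI InrI)

lemma cmb_tuples:
  assumes "inj_on \<iota> (Y <+> B)" "B \<subseteq> Dom M" "d \<in> tuples M Y"
  shows "cmb \<iota> Y B d \<in> tuples M (\<iota> ` (Y <+> B))"
  using assms(2,3) by (auto simp: tuples_def cmb_simps[OF assms(1)])

text \<open>A parameter from \<open>B\<close> can be read off from any tuple of the enlarged
  sequence, and a constant coordinate can be replaced by the parameter.\<close>

lemma indiscernible_cmb:
  assumes \<iota>: "inj_on \<iota> (Y <+> B)" and BC: "B \<subseteq> Dom M" "C \<subseteq> Dom M" and I: "is_seq M Y I"
  shows "indiscernible L M (\<iota> ` (Y <+> B)) C (mapseq (cmb \<iota> Y B) I) \<longleftrightarrow> indiscernible L M Y (C \<union> B) I"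
proof
  let ?I = "mapseq (cmb \<iota> Y B) I" and ?Y = "\<iota> ` (Y <+> B)"
  have I': "is_seq M ?Y ?I"
    using I cmb_tuples[OF \<iota> BC(1)] by (auto simp: is_seq_def mapseq_def)
  {
    assume ind: "indiscernible L M Y (C \<union> B) I"
    show "indiscernible L M ?Y C ?I"
    proof (rule indiscernibleI)
      fix n P s t assume P: "dfn L M (tvars n ?Y C) P" and "increasing (fst ?I) n s" "increasing (fst ?I) n t"
      then have st: "increasing (fst I) n s" "increasing (fst I) n t" by simp_all
      define m where "m = (\<lambda>x. case x of Inl (k, z) \<Rightarrow>
          (case inv_into (Y <+> B) \<iota> z of Inl y \<Rightarrow> Inl (k :: nat, y) | Inr c \<Rightarrow> Inr c) | Inr c \<Rightarrow> Inr c)"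
      have inv: "inv_into (Y <+> B) \<iota> (\<iota> u) = u" if "u \<in> Y <+> B" for u using \<iota> that by simp
      have "m ` tvars n ?Y C \<subseteq> tvars n Y (C \<union> B)"
        by (auto simp: m_def inv InlI InrI)
      then have "dfn L M (tvars n Y (C \<union> B)) (\<lambda>v. P (v \<circ> m))" by (rule dfn_subst'[OF P])
      from indiscernibleD[OF ind I _ this st] have "P (tup I s \<circ> m) = P (tup I t \<circ> m)" using BC by simp
      moreover have "P (tup ?I s) = P (tup I s \<circ> m)" if "increasing (fst I) n s" for s
        using tup_dom[OF I' BC(2)] that
        by (intro dfn_cong[OF P]) (auto simp: m_def inv InlI InrI mapseq_def cmb_def)
      ultimately show "P (tup ?I s) = P (tup ?I t)" using st by simp
    qed
  next
    assume ind: "indiscernible L M ?Y C ?I"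
    show "indiscernible L M Y (C \<union> B) I"
    proof (rule indiscernibleI)
      fix n P s t assume P: "dfn L M (tvars n Y (C \<union> B)) P" and st: "increasing (fst I) n s" "increasing (fst I) n t"
      have CB: "C \<union> B \<subseteq> Dom M" using BC by simp
      show "P (tup I s) = P (tup I t)"
      proof (cases n)
        \<comment> \<open>There is no tuple from which to read the parameters, but then the
          predicate only concerns parameters and both sides agree.\<close>
        case 0
        then show ?thesis using tup_dom[OF I CB st(1)] by (intro dfn_cong[OF P]) auto
      next
        case (Suc n')
        define m where "m = (\<lambda>x. case x of Inl (k, y) \<Rightarrow> Inl (k, \<iota> (Inl y)) |
          Inr c \<Rightarrow> if c \<in> B then Inl (0 :: nat, \<iota> (Inr c)) else Inr c)"
        have "m ` tvars n Y (C \<union> B) \<subseteq> tvars n ?Y C"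
          using Suc by (auto simp: m_def InlI InrI)
        then have "dfn L M (tvars n ?Y C) (\<lambda>v. P (v \<circ> m))" by (rule dfn_subst'[OF P])
        moreover have "increasing (fst ?I) n s" "increasing (fst ?I) n t" using st by simp_all
        ultimately have "P (tup ?I s \<circ> m) = P (tup ?I t \<circ> m)"
          by (rule indiscernibleD[OF ind I' BC(2), where P = "\<lambda>v. P (v \<circ> m)"])
        moreover have "P (tup I s) = P (tup ?I s \<circ> m)" if "increasing (fst I) n s" for s
          using tup_dom[OF I CB that]
          by (intro dfn_cong[OF P]) (auto simp: m_def mapseq_def cmb_simps[OF \<iota>])
        ultimately show ?thesis using st by simp
      qed
    qed
  }
qed

lemma seq_elems_cmb:
  assumes "inj_on \<iota> (Y <+> B)"
  shows "seq_elems (\<iota> ` (Y <+> B)) (mapseq (cmb \<iota> Y B) I) \<subseteq> seq_elems Y I \<union> B"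
  by (auto simp: seq_elems_def mapseq_def cmb_simps[OF assms])

lemma mutually_indiscernible_cmb:
  assumes \<iota>: "\<And>i. i \<in> K \<Longrightarrow> inj_on (\<iota> i) (Y i <+> B)" and BC: "B \<subseteq> Dom M" "C \<subseteq> Dom M"
    and I: "\<And>i. i \<in> K \<Longrightarrow> is_seq M (Y i) (I i)" and mi: "mutually_indiscernible L M K Y (C \<union> B) I"
  shows "mutually_indiscernible L M K (\<lambda>i. \<iota> i ` (Y i <+> B)) C (\<lambda>i. mapseq (cmb (\<iota> i) (Y i) B) (I i))"
  unfolding mutually_indiscernible_def
proof
  fix i assume i: "i \<in> K"
  let ?D = "\<Union>j \<in> K - {i}. seq_elems (\<iota> j ` (Y j <+> B)) (mapseq (cmb (\<iota> j) (Y j) B) (I j))"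
  have D: "?D \<subseteq> (\<Union>j \<in> K - {i}. seq_elems (Y j) (I j)) \<union> B"
    using seq_elems_cmb[OF \<iota>] by blast
  have "?D \<subseteq> Dom M" using D seq_elems_dom[OF I] BC(1) by blast
  then have "C \<union> ?D \<subseteq> Dom M" using BC(2) by simp
  moreover have "indiscernible L M (Y i) (C \<union> B \<union> (\<Union>j \<in> K - {i}. seq_elems (Y j) (I j))) (I i)"
    using mi i unfolding mutually_indiscernible_def by blast
  then have "indiscernible L M (Y i) (C \<union> ?D \<union> B) (I i)"
    by (rule indiscernible_mono) (use D in blast)
  ultimately show "indiscernible L M (\<iota> i ` (Y i <+> B)) (C \<union> ?D) (mapseq (cmb (\<iota> i) (Y i) B) (I i))"
    using indiscernible_cmb[OF \<iota>[OF i] BC(1) _ I[OF i]] by blast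
qed

section \<open>Witnesses against a bound on the stable dimension\<close>

definition str_witness :: "('f, 'r) lang \<Rightarrow> ('f, 'r, 'u) struct \<Rightarrow> 'c rel \<Rightarrow> 'c set \<Rightarrow>
    ('f, 'r, 'c + 'u) fm set \<Rightarrow> 'u set \<Rightarrow> 'k rel \<Rightarrow> ('c \<Rightarrow> 'u) \<Rightarrow> ('k \<Rightarrow> 'c set) \<Rightarrow>
    ('k \<Rightarrow> ('c, 'c, 'u) tseq) \<Rightarrow> ('k \<Rightarrow> ('c, 'c, 'u) tseq) \<Rightarrow> ('k \<Rightarrow> 'c \<Rightarrow> 'u) \<Rightarrow> bool" where
  "str_witness L M \<mu> X \<pi> C \<kappa> a Y I J b \<longleftrightarrow>
     realizes M X a \<pi> \<and>
     (\<forall>i \<in> Field \<kappa>. |Y i| <o \<mu> \<and>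
        is_seq M (Y i) (I i) \<and> |Field (fst (I i))| <o \<mu> \<and> without_endpoints (I i) \<and>
        is_seq M (Y i) (J i) \<and> |Field (fst (J i))| <o \<mu> \<and> without_endpoints (J i) \<and>
        b i \<in> tuples M (Y i)) \<and>
     mutually_indiscernible L M (Field \<kappa>) Y (C \<union> a ` X) (\<lambda>i. I i \<oplus> J i) \<and>
     mutually_indiscernible L M (Field \<kappa>) Y C (\<lambda>i. I i \<oplus> seq_single (b i) \<oplus> J i) \<and>
     (\<forall>i \<in> Field \<kappa>.
        \<not> indiscernible L M (Y i) (C \<union> a ` X) (I i \<oplus> seq_single (b i) \<oplus> J i))"

lemma str_less_witness:
  "str_less L M \<mu> X \<pi> C \<kappa> \<longleftrightarrow> \<not> (\<exists>a Y I J b. str_witness L M \<mu> X \<pi> C \<kappa> a Y I J b)"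
  unfolding str_less_def str_witness_def ..

lemma Field_ord_sum: "Field (ord_sum r s) = Inl ` Field r \<union> Inr ` Field s"
  by (fastforce simp: ord_sum_def Field_def)

lemma ord_sum_iff [simp]:
  "(Inl x, Inl y) \<in> ord_sum r s \<longleftrightarrow> (x, y) \<in> r" "(Inr u, Inr v) \<in> ord_sum r s \<longleftrightarrow> (u, v) \<in> s"
  "(Inl x, Inr v) \<in> ord_sum r s \<longleftrightarrow> x \<in> Field r \<and> v \<in> Field s" "(Inr u, Inl y) \<notin> ord_sum r s"
  by (auto simp: ord_sum_def)

lemma Linear_order_ord_sum:
  assumes "Linear_order r" "Linear_order s"
  shows "Linear_order (ord_sum r s)"
proof -
  have F: "x \<in> Field r" "y \<in> Field r" if "(x, y) \<in> r" for x y using that by (auto simp: Field_def)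
  have F': "x \<in> Field s" "y \<in> Field s" if "(x, y) \<in> s" for x y using that by (auto simp: Field_def)
  have "refl_on (Field (ord_sum r s)) (ord_sum r s)"
    using assms by (auto simp: order_on_defs refl_on_def Field_ord_sum)
  moreover have "trans (ord_sum r s)"
  proof (rule transI)
    fix x y z assume "(x, y) \<in> ord_sum r s" "(y, z) \<in> ord_sum r s"
    then show "(x, z) \<in> ord_sum r s"
      using assms by (cases x; cases y; cases z) (auto simp: order_on_defs F F' dest: transD)
  qed
  moreover have "antisym (ord_sum r s)"
  proof (rule antisymI)
    fix x y assume "(x, y) \<in> ord_sum r s" "(y, x) \<in> ord_sum r s"
    then show "x = y" using assms by (cases x; cases y) (auto simp: order_on_defs dest: antisymD)
  qed
  moreover have "total_on (Field (ord_sum r s)) (ord_sum r s)"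
    using assms by (auto simp: order_on_defs total_on_def Field_ord_sum) blast+
  moreover have "ord_sum r s \<subseteq> Field (ord_sum r s) \<times> Field (ord_sum r s)" by (auto simp: Field_def)
  ultimately show ?thesis by (simp add: order_on_defs)
qed

lemma is_seq_append: "is_seq M Y I \<Longrightarrow> is_seq M Y J \<Longrightarrow> is_seq M Y (I \<oplus> J)"
  using Linear_order_ord_sum[of "fst I" "fst J"]
  by (auto simp: is_seq_def seq_append_def simp del: Un_iff image_iff) (auto simp: Field_ord_sum)

lemma is_seq_single: "b \<in> tuples M Y \<Longrightarrow> is_seq M Y (seq_single b)"
  by (auto simp: is_seq_def seq_single_def order_on_defs refl_on_def trans_def antisym_def total_on_def)

context saturated_structure
begin

text \<open>Serves twice: for passing from \<open>B\<close> to \<open>A\<close>, and for taking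
  sequence points that were moved to the base out of it again.\<close>

lemma str_witness_restrict:
  fixes \<kappa> :: "'k rel"
  assumes AB: "A \<subseteq> B" "B \<subseteq> Dom U" and small: "|B| <o \<mu>"
    and w: "str_witness L U \<mu> X \<pi> B \<kappa> a Y I J b"
  shows "\<exists>Y I J b. str_witness L U \<mu> X \<pi> A \<kappa> a Y I J b"
proof -
  have "\<exists>\<iota> :: 'c + 'u \<Rightarrow> 'c. inj_on \<iota> (Y i <+> B)" if "i \<in> Field \<kappa>" for i
  proof -
    have "|Y i <+> B| <o \<mu>" using w that small by (intro small_Plus) (auto simp: str_witness_def)
    then have "|Y i <+> B| \<le>o |Field \<mu>|"
      using card_of_Field_ordIso[OF card_order] ordIso_symmetric ordLess_imp_ordLeq ordLeq_ordIso_trans by metis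
    then show ?thesis unfolding card_of_ordLeq[symmetric] by blast
  qed
  then obtain \<iota> :: "'k \<Rightarrow> 'c + 'u \<Rightarrow> 'c" where \<iota>: "\<And>i. i \<in> Field \<kappa> \<Longrightarrow> inj_on (\<iota> i) (Y i <+> B)" by metis
  define g where "g = (\<lambda>i. cmb (\<iota> i) (Y i) B)"
  define Y' where "Y' = (\<lambda>i. \<iota> i ` (Y i <+> B))"
  have W: "mapseq (g i) (I i) \<oplus> mapseq (g i) (J i) = mapseq (g i) (I i \<oplus> J i)"
    "mapseq (g i) (I i) \<oplus> seq_single (g i (b i)) \<oplus> mapseq (g i) (J i) =
      mapseq (g i) (I i \<oplus> seq_single (b i) \<oplus> J i)" for i
    by (simp_all add: mapseq_append mapseq_single)
  have s: "is_seq U (Y i) (I i \<oplus> J i)" "is_seq U (Y i) (I i \<oplus> seq_single (b i) \<oplus> J i)"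
    if "i \<in> Field \<kappa>" for i
    using w that unfolding str_witness_def by (simp_all add: is_seq_append is_seq_single)
  have a: "a ` X \<subseteq> Dom U" using w by (simp add: str_witness_def realizes_def tuples_def)
  have AaB: "A \<union> a ` X \<union> B = B \<union> a ` X" "A \<union> B = B" using AB by auto
  have Aa: "A \<union> a ` X \<subseteq> Dom U" "A \<subseteq> Dom U" using AB a by auto
  have "str_witness L U \<mu> X \<pi> A \<kappa> a Y' (\<lambda>i. mapseq (g i) (I i)) (\<lambda>i. mapseq (g i) (J i)) (\<lambda>i. g i (b i))"
    unfolding str_witness_def W
  proof (intro conjI ballI)
    show "realizes U X a \<pi>" using w by (simp add: str_witness_def)
    show "mutually_indiscernible L U (Field \<kappa>) Y' (A \<union> a ` X) (\<lambda>i. mapseq (g i) (I i \<oplus> J i))"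
      unfolding Y'_def g_def using w s(1)
      by (intro mutually_indiscernible_cmb[OF \<iota> AB(2) Aa(1)]) (simp_all add: AaB str_witness_def)
    show "mutually_indiscernible L U (Field \<kappa>) Y' A (\<lambda>i. mapseq (g i) (I i \<oplus> seq_single (b i) \<oplus> J i))"
      unfolding Y'_def g_def using w s(2)
      by (intro mutually_indiscernible_cmb[OF \<iota> AB(2) Aa(2)]) (simp_all add: AaB str_witness_def)
    fix i assume i: "i \<in> Field \<kappa>"
    have "|Y i <+> B| <o \<mu>" using w i small by (intro small_Plus) (auto simp: str_witness_def)
    then show "|Y' i| <o \<mu>" unfolding Y'_def by (rule small_image)
    show "\<not> indiscernible L U (Y' i) (A \<union> a ` X) (mapseq (g i) (I i \<oplus> seq_single (b i) \<oplus> J i))"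
      unfolding Y'_def g_def indiscernible_cmb[OF \<iota>[OF i] AB(2) Aa(1) s(2)[OF i]] AaB
      using w i by (simp add: str_witness_def)
    have t: "g i d \<in> tuples U (Y' i)" if "d \<in> tuples U (Y i)" for d
      unfolding Y'_def g_def by (rule cmb_tuples[OF \<iota>[OF i] AB(2) that])
    show "g i (b i) \<in> tuples U (Y' i)" using w i t by (simp add: str_witness_def)
    show "is_seq U (Y' i) (mapseq (g i) (I i))" "is_seq U (Y' i) (mapseq (g i) (J i))"
      using w i t by (auto simp: str_witness_def is_seq_def mapseq_def)
    show "|Field (fst (mapseq (g i) (I i)))| <o \<mu>" "|Field (fst (mapseq (g i) (J i)))| <o \<mu>"
      "without_endpoints (mapseq (g i) (I i))" "without_endpoints (mapseq (g i) (J i))"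
      using w i by (simp_all add: str_witness_def without_endpoints_def)
  qed
  then show ?thesis by blast
qed

end

section \<open>Mutually indiscernible sequences as arrays\<close>

text \<open>The counterpart of \<open>increasing\<close> for a set of positions in place of an
  initial segment of the natural numbers.\<close>

definition smap :: "'q set \<Rightarrow> 'i rel \<Rightarrow> ('q :: linorder \<Rightarrow> 'i) \<Rightarrow> bool" where
  "smap F r h \<longleftrightarrow> (\<forall>q \<in> F. h q \<in> Field r) \<and> (\<forall>q \<in> F. \<forall>q' \<in> F. q < q' \<longrightarrow> (h q, h q') \<in> r \<and> h q \<noteq> h q')"

text \<open>A predicate involves finitely many rows. They are moved one at a time; meanwhile the
  points of the other rows are parameters, over which the moving row is indiscernible.\<close>

lemma mutual_tpeq:
  fixes Q :: "'k \<Rightarrow> ('i, 'y, 'u) tseq" and F :: "'k \<Rightarrow> 'q :: linorder set"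
  assumes mi: "mutually_indiscernible L M K Y C Q" and Q: "\<And>i. i \<in> K \<Longrightarrow> is_seq M (Y i) (Q i)"
    and C: "C \<subseteq> Dom M" "a ` X \<subseteq> C"
    and h: "\<And>i. i \<in> K \<Longrightarrow> smap (F i) (fst (Q i)) (h i)" "\<And>i. i \<in> K \<Longrightarrow> smap (F i) (fst (Q i)) (h' i)"
  shows "tpeq L M (Par ` C \<union> Xv ` X \<union> arr K Y F) (asg a (\<lambda>i q. snd (Q i) (h i q)))
    (asg a (\<lambda>i q. snd (Q i) (h' i q)))"
proof -
  \<comment> \<open>The rows in \<open>K1\<close> have already been moved.\<close>
  define E where "E = (\<lambda>K1. asg a (\<lambda>i q. snd (Q i) (if i \<in> K1 then h' i q else h i q)) ::
    ('u, 'y, 'k, 'q) vr \<Rightarrow> 'u)"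
  let ?S = "Par ` C \<union> Xv ` X \<union> arr K Y F :: ('u, 'y, 'k, 'q) vr set"
  have Fld: "(if i \<in> K1 then h' i q else h i q) \<in> Field (fst (Q i))" if "i \<in> K" "q \<in> F i" for i q K1
    using h[OF that(1)] that(2) by (auto simp: smap_def)
  have dom: "E K1 ` ?S \<subseteq> Dom M" for K1
  proof (rule image_subsetI)
    fix x assume x: "x \<in> ?S"
    show "E K1 x \<in> Dom M"
    proof (cases x)
      case (Arr i q y)
      then have "i \<in> K" "q \<in> F i" "y \<in> Y i" using x by auto
      then show ?thesis using Arr Q[of i] Fld[of i q K1] by (auto simp: E_def is_seq_def tuples_def image_subset_iff)
    qed (use x C in \<open>auto simp: E_def\<close>)
  qed
  have E0: "E {} = asg a (\<lambda>i q. snd (Q i) (h i q))" and EU: "E UNIV = asg a (\<lambda>i q. snd (Q i) (h' i q))"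
    by (simp_all add: E_def)
  show ?thesis unfolding E0[symmetric] EU[symmetric]
  proof (rule tpeqI[OF dom dom])
    fix P assume P: "dfn L M ?S P" "P (E {})"
    obtain T P' where T: "finite T" "T \<subseteq> ?S" "dfn L M T P'" "\<And>v. v ` ?S \<subseteq> Dom M \<Longrightarrow> P v = P' v"
      using P(1) by (rule dfn_finite) blast
    have Tdom: "E K1 ` T \<subseteq> Dom M" for K1 by (rule subset_trans[OF image_mono[OF T(2)] dom])
    have step: "P' (E (insert i K1)) = P' (E K1)" if i: "i \<in> K" "i \<notin> K1" for i K1
    proof -
      define G where "G = {q. \<exists>y. Arr i q y \<in> T}"
      have "G \<subseteq> (\<lambda>x. case x of Arr i q y \<Rightarrow> q | _ \<Rightarrow> undefined) ` T" unfolding G_def by force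
      then have fG: "finite G" using T(1) finite_surj by blast
      have GF: "G \<subseteq> F i" using T(2) unfolding G_def by auto
      define l where "l = sorted_list_of_set G"
      define n where "n = card G"
      have l: "set l = G" "length l = n" "sorted l" "distinct l" using fG by (simp_all add: l_def n_def)
      have lmono: "l ! k < l ! k'" if "k < k'" "k' < n" for k k'
        using l that by (metis antisym_conv2 distinct_conv_nth less_trans order.strict_implies_order
            sorted_iff_nth_mono_less)
      define rk where "rk = (\<lambda>q. SOME k. k < n \<and> l ! k = q)"
      have rk: "rk q < n" "l ! rk q = q" if "q \<in> G" for q
      proof -
        have "\<exists>k. k < n \<and> l ! k = q" using l(1,2) that by (metis in_set_conv_nth)
        then show "rk q < n" "l ! rk q = q" unfolding rk_def by (metis (mono_tags, lifting) someI_ex)+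
      qed
      have rkT: "l ! rk q = q" if "Arr i q y \<in> T" for q y using rk(2) that unfolding G_def by blast
      let ?C = "C \<union> (\<Union>j \<in> K - {i}. seq_elems (Y j) (Q j))"
      \<comment> \<open>The points of row \<open>i\<close> become a list of tuples, ordered by rank;
        everything else is replaced by its value, as a parameter.\<close>
      define m where "m = (\<lambda>x. case x of Par c \<Rightarrow> Inr c | Xv x \<Rightarrow> Inr (a x) |
        Arr j q y \<Rightarrow> if j = i then Inl (rk q, y) else Inr (E K1 (Arr j q y)))"
      have mT: "m ` T \<subseteq> tvars n (Y i) ?C"
      proof (rule image_subsetI)
        fix x assume x: "x \<in> T"
        then have xS: "x \<in> ?S" using T(2) by blast
        show "m x \<in> tvars n (Y i) ?C"
        proof (cases x)
          case (Arr j q y)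
          show ?thesis
          proof (cases "j = i")
            case True
            then have "q \<in> G" using x Arr by (auto simp: G_def)
            then show ?thesis using Arr True xS rk(1) by (auto simp: m_def)
          next
            case False
            have "j \<in> K" "q \<in> F j" "y \<in> Y j" using xS Arr by auto
            then have "E K1 (Arr j q y) \<in> seq_elems (Y j) (Q j)"
              using Fld[of j q K1] unfolding seq_elems_def E_def by auto
            then have "E K1 (Arr j q y) \<in> ?C" using False \<open>j \<in> K\<close> by blast
            then show ?thesis using Arr False by (simp add: m_def)
          qed
        qed (use xS C in \<open>auto simp: m_def\<close>)
      qed
      have "dfn L M (tvars n (Y i) ?C) (\<lambda>v. P' (v \<circ> m))" by (rule dfn_subst'[OF T(3) mT])
      moreover have "indiscernible L M (Y i) ?C (Q i)" using mi i(1) unfolding mutually_indiscernible_def by blast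
      moreover have "?C \<subseteq> Dom M" using C(1) seq_elems_dom[OF Q] by blast
      moreover have inc: "increasing (fst (Q i)) n (\<lambda>k. g (l ! k))" if "smap (F i) (fst (Q i)) g" for g
        unfolding increasing_def
      proof (intro conjI allI impI)
        fix k assume "k < n"
        then have "l ! k \<in> F i" using l(1,2) GF by (metis nth_mem subsetD)
        then show "g (l ! k) \<in> Field (fst (Q i))" using that by (simp add: smap_def)
      next
        fix k k' assume k: "k < k' \<and> k' < n"
        then have "l ! k \<in> F i" "l ! k' \<in> F i" using l(1,2) GF by (metis nth_mem subsetD less_trans)+
        then show "(g (l ! k), g (l ! k')) \<in> fst (Q i)" "g (l ! k) \<noteq> g (l ! k')"
          using that lmono[of k k'] k unfolding smap_def by blast+
      qed
      ultimately have "P' (tup (Q i) (\<lambda>k. h' i (l ! k)) \<circ> m) = P' (tup (Q i) (\<lambda>k. h i (l ! k)) \<circ> m)"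
        using Q[OF i(1)] h[OF i(1)] by (intro indiscernibleD[where P = "\<lambda>v. P' (v \<circ> m)"])
      moreover have "P' (E (insert i K1)) = P' (tup (Q i) (\<lambda>k. h' i (l ! k)) \<circ> m)"
      proof (rule dfn_cong[OF T(3) Tdom])
        fix x assume "x \<in> T"
        then show "E (insert i K1) x = (tup (Q i) (\<lambda>k. h' i (l ! k)) \<circ> m) x"
          using rkT by (cases x) (auto simp: m_def E_def)
      qed
      moreover have "P' (E K1) = P' (tup (Q i) (\<lambda>k. h i (l ! k)) \<circ> m)"
      proof (rule dfn_cong[OF T(3) Tdom])
        fix x assume "x \<in> T"
        then show "E K1 x = (tup (Q i) (\<lambda>k. h i (l ! k)) \<circ> m) x"
          using rkT i(2) by (cases x) (auto simp: m_def E_def)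
      qed
      ultimately show ?thesis by simp
    qed
    define K0 where "K0 = {i. \<exists>q y. Arr i q y \<in> T}"
    have "K0 \<subseteq> (\<lambda>x. case x of Arr i q y \<Rightarrow> i | _ \<Rightarrow> undefined) ` T" unfolding K0_def by force
    then have "finite K0" using T(1) finite_surj by blast
    moreover have "K0 \<subseteq> K" using T(2) unfolding K0_def by auto
    ultimately have "P' (E K0) = P' (E {})"
      by (induction K0 rule: finite_induct) (simp_all add: step)
    moreover have "P' (E K0) = P' (E UNIV)"
    proof (rule dfn_cong[OF T(3) Tdom])
      fix x assume "x \<in> T"
      then show "E K0 x = E UNIV x" by (cases x) (auto simp: E_def K0_def)
    qed
    ultimately show "P (E UNIV)" using T(4)[OF dom] P(2) by simp
  qed
qed

context array_structure
begin

text \<open>Indiscernibility of one row over the others is the case of a move that fixes all other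
  rows. \<open>dec\<close> gives the position of an index, so that one array serves for the
  sequences with and without their middle points.\<close>

lemma rmi_mutually_indiscernible:
  fixes Q :: "'k \<Rightarrow> ('i, 'c, 'u) tseq" and dec :: "'i \<Rightarrow> rat"
  assumes rmi: "rmi G (Par ` B \<union> Xv ` X) a D"
    and dec: "\<And>i u. i \<in> K \<Longrightarrow> u \<in> Field (fst (Q i)) \<Longrightarrow> dec u \<in> G"
      "\<And>i u v. i \<in> K \<Longrightarrow> (u, v) \<in> fst (Q i) \<Longrightarrow> u \<noteq> v \<Longrightarrow> dec u < dec v"
      "\<And>i u. i \<in> K \<Longrightarrow> u \<in> Field (fst (Q i)) \<Longrightarrow> snd (Q i) u = D i (dec u)"
  shows "mutually_indiscernible L U K Y (B \<union> a ` X) Q"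
  unfolding mutually_indiscernible_def
proof
  fix i assume i: "i \<in> K"
  let ?S = "\<Union>j \<in> K - {i}. seq_elems (Y j) (Q j)"
  show "indiscernible L U (Y i) (B \<union> a ` X \<union> ?S) (Q i)"
  proof (rule indiscernibleI)
    fix n P s t assume P: "dfn L U (tvars n (Y i) (B \<union> a ` X \<union> ?S)) P"
      and s: "increasing (fst (Q i)) n s" and t: "increasing (fst (Q i)) n t"
    have ds: "dec (r k) < dec (r k')" if "increasing (fst (Q i)) n r" "k < k'" "k' < n" for r k k'
      using that dec(2)[OF i] unfolding increasing_def by blast
    have inj: "k = k'" if "dec (s k) = dec (s k')" "k < n" "k' < n" for k k'
      using ds[OF s, of k k'] ds[OF s, of k' k] that by (metis less_irrefl linorder_neqE_nat)
    have fld: "r k \<in> Field (fst (Q i))" if "increasing (fst (Q i)) n r" "k < n" for r k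
      using that unfolding increasing_def by blast
    define ix where "ix = (\<lambda>q. SOME k. k < n \<and> dec (s k) = q)"
    have ix: "ix (dec (s k)) = k" if "k < n" for k
    proof -
      have "ix (dec (s k)) < n \<and> dec (s (ix (dec (s k)))) = dec (s k)"
        unfolding ix_def by (rule someI[of _ k]) (use that in simp)
      then show ?thesis using inj that by blast
    qed
    define F where "F = (\<lambda>j. if j = i then (\<lambda>k. dec (s k)) ` {..<n} else G)"
    define f where "f = (\<lambda>j q. if j = i then dec (t (ix q)) else q)"
    have FG: "F j \<subseteq> G" if "j \<in> K" for j using dec(1)[OF i] fld[OF s] by (auto simp: F_def)
    have io: "into G F f" unfolding into_def
    proof (intro ballI conjI)
      fix j
      show "strict_mono_on (F j) (f j)"
      proof (rule strict_mono_onI)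
        fix q q' assume q: "q \<in> F j" "q' \<in> F j" "q < q'"
        show "f j q < f j q'"
        proof (cases "j = i")
          case True
          then obtain k k' where k: "k < n" "k' < n" "q = dec (s k)" "q' = dec (s k')" using q by (auto simp: F_def)
          have "k < k'" using ds[OF s, of k' k] k q(3) by (metis less_asym linorder_neqE_nat less_irrefl)
          then show ?thesis using True k ix ds[OF t] by (simp add: f_def)
        qed (use q in \<open>simp add: f_def\<close>)
      qed
      show "f j ` F j \<subseteq> G" using dec(1)[OF i] fld[OF t] ix by (auto simp: f_def F_def)
    qed
    have eq: "tpeq L U (Par ` B \<union> Xv ` X \<union> Ar F) (asg a D) (asg a (\<lambda>i q. D i (f i q)))"
      by (rule rmiD[OF rmi FG io])
    have cd: "\<exists>x \<in> Par ` B \<union> Xv ` X \<union> Ar F. asg a D x = c \<and> asg a (\<lambda>i q. D i (f i q)) x = c"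
      if c: "c \<in> B \<union> a ` X \<union> ?S" for c
    proof -
      consider "c \<in> B" | "c \<in> a ` X" | "c \<in> ?S" using c by blast
      then show ?thesis
      proof cases
        case 1
        then show ?thesis by (intro bexI[of _ "Par c"]) auto
      next
        case 2
        then obtain x where "x \<in> X" "c = a x" by blast
        then show ?thesis by (intro bexI[of _ "Xv x"]) auto
      next
        case 3
        then obtain j u y where j: "j \<in> K" "j \<noteq> i" "u \<in> Field (fst (Q j))" "y \<in> Y j" "c = snd (Q j) u y"
          unfolding seq_elems_def by blast
        then show ?thesis using dec(1,3)[OF j(1,3)]
          by (intro bexI[of _ "Arr j (dec u) y"]) (auto simp: F_def f_def)
      qed
    qed
    \<comment> \<open>A variable that names the parameter \<open>c\<close> and keeps this value
      under the move.\<close>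
    define cv where "cv = (\<lambda>c. SOME x. x \<in> Par ` B \<union> Xv ` X \<union> Ar F \<and> asg a D x = c \<and>
      asg a (\<lambda>i q. D i (f i q)) x = c)"
    have cv: "cv c \<in> Par ` B \<union> Xv ` X \<union> Ar F" "asg a D (cv c) = c" "asg a (\<lambda>i q. D i (f i q)) (cv c) = c"
      if "c \<in> B \<union> a ` X \<union> ?S" for c
    proof -
      have "\<exists>x. x \<in> Par ` B \<union> Xv ` X \<union> Ar F \<and> asg a D x = c \<and> asg a (\<lambda>i q. D i (f i q)) x = c"
        using cd[OF that] by blast
      from someI_ex[OF this] show "cv c \<in> Par ` B \<union> Xv ` X \<union> Ar F" "asg a D (cv c) = c"
        "asg a (\<lambda>i q. D i (f i q)) (cv c) = c" unfolding cv_def by blast+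
    qed
    define m where "m = (\<lambda>x. case x of Inl (k, y) \<Rightarrow> Arr i (dec (s k)) y | Inr c \<Rightarrow> cv c)"
    have mS: "m ` tvars n (Y i) (B \<union> a ` X \<union> ?S) \<subseteq> Par ` B \<union> Xv ` X \<union> Ar F"
    proof (rule image_subsetI)
      fix x assume x: "x \<in> tvars n (Y i) (B \<union> a ` X \<union> ?S)"
      show "m x \<in> Par ` B \<union> Xv ` X \<union> Ar F"
      proof (cases x)
        case (Inl ky)
        then show ?thesis using x i by (auto simp: m_def F_def)
      next
        case (Inr c)
        then have "c \<in> B \<union> a ` X \<union> ?S" using x by blast
        then show ?thesis using Inr cv(1) by (simp add: m_def del: Un_iff)
      qed
    qed
    have me: "(asg a D \<circ> m) x = tup (Q i) s x \<and> (asg a (\<lambda>i q. D i (f i q)) \<circ> m) x = tup (Q i) t x"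
      if x: "x \<in> tvars n (Y i) (B \<union> a ` X \<union> ?S)" for x
    proof (cases x)
      case (Inl ky)
      then obtain k y where "ky = (k, y)" "k < n" using x by auto
      then show ?thesis using Inl dec(3)[OF i fld[OF s, of k]] dec(3)[OF i fld[OF t, of k]] ix
        by (simp add: m_def f_def)
    next
      case (Inr c)
      then have "c \<in> B \<union> a ` X \<union> ?S" using x by blast
      then show ?thesis using Inr cv(2,3) by (simp add: m_def)
    qed
    have "tpeq L U (tvars n (Y i) (B \<union> a ` X \<union> ?S)) (asg a D \<circ> m) (asg a (\<lambda>i q. D i (f i q)) \<circ> m)"
      by (rule tpeq_subst[OF eq mS])
    then have "tpeq L U (tvars n (Y i) (B \<union> a ` X \<union> ?S)) (tup (Q i) s) (tup (Q i) t)"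
      by (rule tpeq_cong) (use me in simp_all)
    then show "P (tup (Q i) s) = P (tup (Q i) t)" using P by (rule tpeqD)
  qed
qed

text \<open>Index sets of witnesses have to be subsets of \<open>'c\<close>.\<close>

lemma rat_embedding: obtains \<iota> :: "rat \<Rightarrow> 'c" where "inj \<iota>"
proof -
  have "|UNIV :: rat set| <o \<mu>" by (rule small_countable[of to_nat]) auto
  then have "|UNIV :: rat set| \<le>o |Field \<mu>|"
    using card_of_Field_ordIso[OF card_order] ordIso_symmetric ordLess_imp_ordLeq ordLeq_ordIso_trans by metis
  then show ?thesis using that unfolding card_of_ordLeq[symmetric] by blast
qed

text \<open>Negative positions form \<open>I\<close>, position 0 is \<open>b\<close> and positive
  positions form \<open>J\<close>. A predicate that distinguishes the point at 0 from the point at 1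
  breaks indiscernibility already for tuples of length 1.\<close>

lemma array_str_witness:
  fixes \<kappa> :: "'k rel"
  assumes K: "K = Field \<kappa>" and Y: "\<And>i. i \<in> K \<Longrightarrow> finite (Y i)" and BX: "B \<subseteq> Dom U"
    and r1: "rmi UNIV (Par ` B) a D" and r2: "rmi (- {0}) (Par ` B \<union> Xv ` X) a D"
    and \<pi>: "realizes U X a \<pi>"
    and Q: "\<And>i. i \<in> K \<Longrightarrow> dfn L U (Par ` B \<union> Xv ` X \<union> {Arr i 0 y | y. y \<in> Y i}) (Q i)"
      "\<And>i. i \<in> K \<Longrightarrow> Q i (asg a D)" "\<And>i. i \<in> K \<Longrightarrow> \<not> Q i (asg a (\<lambda>j q. D j 1))"
  shows "\<exists>I J b. str_witness L U \<mu> X \<pi> B \<kappa> a Y I J b"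
proof -
  obtain \<iota> :: "rat \<Rightarrow> 'c" where \<iota>: "inj \<iota>" by (rule rat_embedding)
  define rl where "rl = (\<lambda>G. {(\<iota> p, \<iota> q) | p q. p \<in> G \<and> q \<in> G \<and> p \<le> q})"
  have rl: "(\<iota> p, \<iota> q) \<in> rl G \<longleftrightarrow> p \<in> G \<and> q \<in> G \<and> p \<le> q" for p q G
    using \<iota> by (auto simp: rl_def inj_def)
  have rlE: "\<exists>p q. u = \<iota> p \<and> v = \<iota> q \<and> p \<in> G \<and> q \<in> G \<and> p \<le> q" if "(u, v) \<in> rl G" for u v G
    using that by (auto simp: rl_def)
  have Frl: "Field (rl G) = \<iota> ` G" for G by (fastforce simp: rl_def Field_def)
  have Lrl: "Linear_order (rl G)" for G
  proof -
    have "refl_on (\<iota> ` G) (rl G)" by (auto simp: refl_on_def rl) 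
    moreover have "trans (rl G)" by (rule transI) (auto dest!: rlE simp: rl inj_eq[OF \<iota>])
    moreover have "antisym (rl G)" by (rule antisymI) (auto dest!: rlE simp: rl inj_eq[OF \<iota>])
    moreover have "total_on (\<iota> ` G) (rl G)" by (auto simp: total_on_def rl)
    moreover have "rl G \<subseteq> \<iota> ` G \<times> \<iota> ` G" by (auto simp: rl_def)
    ultimately show ?thesis by (simp add: order_on_defs Frl)
  qed
  have D: "D i q \<in> tuples U (Y i)" if "i \<in> K" for i q
  proof -
    have "asg a D ` At UNIV \<subseteq> Dom U" using rmi_dom[OF r1] by blast
    then have "asg a D (Arr i q y) \<in> Dom U" if "y \<in> Y i" for y
      using that \<open>i \<in> K\<close> arr_iff(1)[of i q y K Y "\<lambda>_. UNIV"] by blast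
    then show ?thesis by (auto simp: tuples_def)
  qed
  define sq where "sq = (\<lambda>G i. (rl G, \<lambda>c. D i (inv \<iota> c)))"
  have sq: "is_seq U (Y i) (sq G i)" if "i \<in> K" for i G
    using Lrl D[OF that] by (simp add: is_seq_def sq_def)
  have sqF: "fst (sq G i) = rl G" "snd (sq G i) (\<iota> q) = D i q" for G i q
    using \<iota> by (simp_all add: sq_def)
  have small: "|Field (fst (sq G i))| <o \<mu>" for G i
    unfolding sqF Frl using small_countable[of to_nat G] by (intro small_image) auto
  let ?I = "\<lambda>i. sq {..<0} i" and ?J = "\<lambda>i. sq {0<..} i" and ?b = "\<lambda>i. D i 0"
  have ends: "without_endpoints (?I i)" "without_endpoints (?J i)" for i
  proof -
    have "\<exists>s. s \<noteq> \<iota> q \<and> (s, \<iota> q) \<in> rl {..<0}" "\<exists>s. s \<noteq> \<iota> q \<and> (\<iota> q, s) \<in> rl {..<0}" if "q < 0" for q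
      using that by (intro exI[of _ "\<iota> (q - 1)"] exI[of _ "\<iota> (q / 2)"], simp add: rl inj_eq[OF \<iota>])+
    moreover have "\<iota> (-1) \<in> Field (rl {..<0})" by (simp add: Frl)
    ultimately show "without_endpoints (?I i)" unfolding without_endpoints_def sqF(1) by (auto simp: Frl)
    have "\<exists>s. s \<noteq> \<iota> q \<and> (s, \<iota> q) \<in> rl {0<..}" "\<exists>s. s \<noteq> \<iota> q \<and> (\<iota> q, s) \<in> rl {0<..}" if "q > 0" for q
      using that by (intro exI[of _ "\<iota> (q / 2)"] exI[of _ "\<iota> (q + 1)"], simp add: rl inj_eq[OF \<iota>])+
    moreover have "\<iota> 1 \<in> Field (rl {0<..})" by (simp add: Frl)
    ultimately show "without_endpoints (?J i)" unfolding without_endpoints_def sqF(1) by (auto simp: Frl)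
  qed
  let ?W = "\<lambda>i. ?I i \<oplus> seq_single (?b i) \<oplus> ?J i"
  define dec where "dec = case_sum (inv \<iota>) (case_sum (\<lambda>_ :: unit. 0) (inv \<iota>))"
  define dec' where "dec' = case_sum (inv \<iota>) (inv \<iota>)"
  have [simp]: "inv \<iota> (\<iota> q) = q" for q using \<iota> by simp
  have fW: "fst (?W i) = ord_sum (rl {..<0}) (ord_sum {((), ())} (rl {0<..}))" for i
    by (simp add: seq_append_def sqF seq_single_def)
  have fV: "fst (?I i \<oplus> ?J i) = ord_sum (rl {..<0}) (rl {0<..})" for i
    by (simp add: seq_append_def sqF)
  have FW: "Field (fst (?W i)) = Inl ` \<iota> ` {..<0} \<union> Inr ` (Inl ` {()} \<union> Inr ` \<iota> ` {0<..})" for i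
    unfolding fW Field_ord_sum Frl by (auto simp: Field_def)
  have FV: "Field (fst (?I i \<oplus> ?J i)) = Inl ` \<iota> ` {..<0} \<union> Inr ` \<iota> ` {0<..}" for i
    unfolding fV Field_ord_sum Frl ..
  have W: "mutually_indiscernible L U K Y (B \<union> a ` {}) ?W"
  proof (rule rmi_mutually_indiscernible[where dec = dec and D = D and G = UNIV])
    show "rmi UNIV (Par ` B \<union> Xv ` {}) a D" using r1 by simp
    show "dec u < dec v" if "(u, v) \<in> fst (?W i)" "u \<noteq> v" for i u v
    proof -
      have uv: "u \<in> Field (fst (?W i))" "v \<in> Field (fst (?W i))" using that(1) by (auto intro: FieldI1 FieldI2)
      show ?thesis using uv[unfolded FW] that[unfolded fW] by (auto simp: dec_def rl)
    qed
    show "snd (?W i) u = D i (dec u)" if "u \<in> Field (fst (?W i))" for i u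
      using that unfolding FW by (auto simp: dec_def seq_append_def sqF seq_single_def)
  qed simp
  have V: "mutually_indiscernible L U K Y (B \<union> a ` X) (\<lambda>i. ?I i \<oplus> ?J i)"
  proof (rule rmi_mutually_indiscernible[where dec = dec' and D = D and G = "- {0}"])
    show "rmi (- {0}) (Par ` B \<union> Xv ` X) a D" by (rule r2)
    show "dec' u \<in> - {0}" if "u \<in> Field (fst (?I i \<oplus> ?J i))" for i u
      using that unfolding FV by (auto simp: dec'_def)
    show "dec' u < dec' v" if "(u, v) \<in> fst (?I i \<oplus> ?J i)" "u \<noteq> v" for i u v
    proof -
      have uv: "u \<in> Field (fst (?I i \<oplus> ?J i))" "v \<in> Field (fst (?I i \<oplus> ?J i))"
        using that(1) by (auto intro: FieldI1 FieldI2)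
      show ?thesis using uv[unfolded FV] that[unfolded fV] by (auto simp: dec'_def rl)
    qed
    show "snd (?I i \<oplus> ?J i) u = D i (dec' u)" if "u \<in> Field (fst (?I i \<oplus> ?J i))" for i u
      using that unfolding FV by (auto simp: dec'_def seq_append_def sqF)
  qed
  have aX: "a ` X \<subseteq> Dom U" using \<pi> by (simp add: realizes_def tuples_def)
  have N: "\<not> indiscernible L U (Y i) (B \<union> a ` X) (?W i)" if i: "i \<in> K" for i
  proof
    assume ind: "indiscernible L U (Y i) (B \<union> a ` X) (?W i)"
    let ?S = "Par ` B \<union> Xv ` X \<union> {Arr i 0 y | y. y \<in> Y i} :: ('u, 'c, 'k, rat) vr set"
    define m :: "('u, 'c, 'k, rat) vr \<Rightarrow> (nat \<times> 'c) + 'u" where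
      "m = (\<lambda>x. case x of Par c \<Rightarrow> Inr c | Xv x \<Rightarrow> Inr (a x) | Arr j q y \<Rightarrow> Inl (0, y))"
    have "m ` ?S \<subseteq> tvars 1 (Y i) (B \<union> a ` X)" by (auto simp: m_def)
    then have P: "dfn L U (tvars 1 (Y i) (B \<union> a ` X)) (\<lambda>v. Q i (v \<circ> m))" by (rule dfn_subst'[OF Q(1)[OF i]])
    have seqW: "is_seq U (Y i) (?W i)" using sq[OF i] D[OF i] by (intro is_seq_append is_seq_single)
    have C: "B \<union> a ` X \<subseteq> Dom U" using BX aX by simp
    let ?s = "\<lambda>k :: nat. Inr (Inl ()) :: 'c + unit + 'c" and ?t = "\<lambda>k :: nat. Inr (Inr (\<iota> 1)) :: 'c + unit + 'c"
    have inc: "increasing (fst (?W i)) 1 ?s" "increasing (fst (?W i)) 1 ?t"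
      by (auto simp: increasing_def FW)
    have "Q i (tup (?W i) ?s \<circ> m) = Q i (tup (?W i) ?t \<circ> m)"
      by (rule indiscernibleD[OF ind seqW C P inc])
    moreover have "Q i (asg a D) = Q i (tup (?W i) ?s \<circ> m)"
    proof (rule dfn_cong[OF Q(1)[OF i]])
      show "asg a D ` ?S \<subseteq> Dom U" using BX aX D[OF i, of 0] by (auto simp: tuples_def)
      show "asg a D x = (tup (?W i) ?s \<circ> m) x" if "x \<in> ?S" for x
        using that by (auto simp: m_def seq_append_def seq_single_def)
    qed
    moreover have "Q i (asg a (\<lambda>j q. D j 1)) = Q i (tup (?W i) ?t \<circ> m)"
    proof (rule dfn_cong[OF Q(1)[OF i]])
      show "asg a (\<lambda>j q. D j 1) ` ?S \<subseteq> Dom U" using BX aX D[OF i, of 1] by (auto simp: tuples_def)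
      show "asg a (\<lambda>j q. D j 1) x = (tup (?W i) ?t \<circ> m) x" if "x \<in> ?S" for x
        using that by (auto simp: m_def seq_append_def sqF)
    qed
    ultimately show False using Q(2,3)[OF i] by simp
  qed
  have "|Y i| <o \<mu>" if "i \<in> K" for i using Y[OF that] by (rule small_finite)
  then have "str_witness L U \<mu> X \<pi> B \<kappa> a Y ?I ?J ?b"
    unfolding str_witness_def K[symmetric] using \<pi> sq small ends D W V N by simp
  then show ?thesis by blast
qed

end

section \<open>The centre of a sequence and its surroundings\<close>

lemma ascending_chain:
  assumes r: "Linear_order r" and succ: "\<And>t. t \<in> Field r \<Longrightarrow> \<exists>s. s \<noteq> t \<and> (t, s) \<in> r" and x0: "x0 \<in> Field r"
  obtains x :: "nat \<Rightarrow> 'i" where "\<And>k. (x0, x k) \<in> r" "\<And>k. x0 \<noteq> x k"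
    "\<And>k k'. k < k' \<Longrightarrow> (x k, x k') \<in> r \<and> x k \<noteq> x k'"
proof -
  obtain f where f: "\<And>t. t \<in> Field r \<Longrightarrow> f t \<noteq> t \<and> (t, f t) \<in> r" using succ by metis
  have tr: "(x, z) \<in> r \<and> x \<noteq> z" if "(x, y) \<in> r \<and> x \<noteq> y" "(y, z) \<in> r \<and> y \<noteq> z" for x y z
    using that r unfolding order_on_defs by (metis antisymD transD)
  define x where "x = (\<lambda>k. (f ^^ k) x0)"
  have xF: "x k \<in> Field r" for k
  proof (induction k)
    case (Suc k)
    have "(x k, f (x k)) \<in> r" using f[OF Suc] by blast
    then show ?case using FieldI2[of "x k" "f (x k)" r] by (simp add: x_def)
  qed (simp add: x_def x0)
  have step: "(x k, x (Suc k)) \<in> r \<and> x k \<noteq> x (Suc k)" for k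
    using f[OF xF[of k]] by (auto simp: x_def)
  have mono: "(x k, x k') \<in> r \<and> x k \<noteq> x k'" if "k < k'" for k k'
    using that
  proof (induction k')
    case (Suc k')
    show ?case
    proof (cases "k = k'")
      case False
      then have "(x k, x k') \<in> r \<and> x k \<noteq> x k'" using Suc by simp
      then show ?thesis using step by (rule tr)
    qed (use step in simp)
  qed simp
  have 0: "x 0 = x0" by (simp add: x_def)
  show ?thesis
    using mono[of 0, unfolded 0] mono by (intro that[of "\<lambda>k. x (Suc k)"]) simp_all
qed

text \<open>Positions for a tuple of length \<open>n\<close> whose entry \<open>p\<close> is at 0.
  All entries are at integers, which leaves the interval from -1 to 1 free for new points on either
  side of 0.\<close>

definition pts :: "nat \<Rightarrow> nat \<Rightarrow> rat set" where
  "pts n p = (\<lambda>k. of_int (int k - int p)) ` {..<n}"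

text \<open>Points of \<open>F\<close> left of 0 go to the ascending chain \<open>x\<close> below
  \<open>s p\<close>, those right of 0 to the descending chain \<open>y\<close> above it.\<close>

lemma insert_positions:
  fixes lt :: "'i \<Rightarrow> 'i \<Rightarrow> bool" and s x y :: "nat \<Rightarrow> 'i" and F :: "rat set"
  assumes tr: "\<And>u v w. lt u v \<Longrightarrow> lt v w \<Longrightarrow> lt u w" and s: "\<And>k k'. k < k' \<Longrightarrow> k' < n \<Longrightarrow> lt (s k) (s k')"
    and p: "p < n" and x: "\<And>k k'. k < k' \<Longrightarrow> lt (x k) (x k')" and y: "\<And>k k'. k < k' \<Longrightarrow> lt (y k') (y k)"
    and sx: "\<And>k j. k < p \<Longrightarrow> lt (s k) (x j)" and xs: "\<And>j. lt (x j) (s p)" and sy: "\<And>j. lt (s p) (y j)"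
    and ys: "\<And>k j. p < k \<Longrightarrow> k < n \<Longrightarrow> lt (y j) (s k)" and F: "finite F" "F \<subseteq> {-1<..<1}"
  obtains h :: "rat \<Rightarrow> 'i" where "\<And>k. k < n \<Longrightarrow> h (of_int (int k - int p)) = s k"
    "\<And>q. q \<in> F \<Longrightarrow> q \<noteq> 0 \<Longrightarrow> h q \<in> range x \<union> range y"
    "\<And>q q'. q \<in> F \<union> pts n p \<Longrightarrow> q' \<in> F \<union> pts n p \<Longrightarrow> q < q' \<Longrightarrow> lt (h q) (h q')"
proof -
  \<comment> \<open>Ranks are counted from the left for the ascending chain and from the right for
    the descending one.\<close>
  define rl where "rl = (\<lambda>q. card {q' \<in> F. q' < q})"
  define rr where "rr = (\<lambda>q. card {q' \<in> F. q < q'})"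
  define h where "h = (\<lambda>q. if -1 < q \<and> q < 0 then x (rl q) else if 0 < q \<and> q < 1 then y (rr q)
    else s (nat (\<lfloor>q\<rfloor> + int p)))"
  have rl: "rl q < rl q'" if "q \<in> F" "q < q'" for q q'
    unfolding rl_def using F(1) that by (intro psubset_card_mono) auto
  have rr: "rr q' < rr q" if "q' \<in> F" "q < q'" for q q'
    unfolding rr_def using F(1) that by (intro psubset_card_mono) auto
  have hs: "h (of_int (int k - int p)) = s k" for k
  proof -
    define m where "m = int k - int p"
    have "m \<le> -1 \<or> m = 0 \<or> 1 \<le> m" by linarith
    then have "(of_int m :: rat) \<le> -1 \<or> of_int m = (0 :: rat) \<or> 1 \<le> (of_int m :: rat)"
      using of_int_le_iff[of m "-1", where 'a = rat] of_int_le_iff[of 1 m, where 'a = rat] by simp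
    then have "\<not> (-1 < (of_int m :: rat) \<and> (of_int m :: rat) < 0)"
      and "\<not> (0 < (of_int m :: rat) \<and> (of_int m :: rat) < 1)" by auto
    then have "\<not> (-1 < (of_int (int k - int p) :: rat) \<and> (of_int (int k - int p) :: rat) < 0)"
      and "\<not> (0 < (of_int (int k - int p) :: rat) \<and> (of_int (int k - int p) :: rat) < 1)"
      unfolding m_def by blast+
    then show ?thesis unfolding h_def by (simp only: if_False floor_of_int) simp
  qed
  have cls: "(-1 < q \<and> q < 0 \<and> q \<in> F \<and> h q = x (rl q)) \<or> (0 < q \<and> q < 1 \<and> q \<in> F \<and> h q = y (rr q)) \<or>
      (\<exists>k < n. q = of_int (int k - int p) \<and> h q = s k)" if q: "q \<in> F \<union> pts n p" for q
  proof (cases "q \<in> pts n p")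
    case True
    then obtain k where "k < n" "q = of_int (int k - int p)" by (auto simp: pts_def)
    then show ?thesis using hs by blast
  next
    case False
    moreover have "0 \<in> pts n p" unfolding pts_def using p by (intro image_eqI[of _ _ p]) auto
    ultimately have "q \<in> F" "q \<noteq> 0" using q by auto
    moreover have "-1 < q" "q < 1" using F(2) \<open>q \<in> F\<close> by auto
    ultimately show ?thesis by (auto simp: h_def)
  qed
  show ?thesis
  proof (rule that[of h])
    show "h q \<in> range x \<union> range y" if "q \<in> F" "q \<noteq> 0" for q
      using that F(2) by (auto simp: h_def)
    fix q q' assume q: "q \<in> F \<union> pts n p" "q' \<in> F \<union> pts n p" and lt: "q < q'"
    have sp: "lt (s k) (y j)" if "k \<le> p" for k j
      using sy[of j] tr[OF s[of k p] sy[of j]] that p by (cases "k = p") auto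
    have ps: "lt (x j) (s k)" if "p \<le> k" "k < n" for k j
      using xs[of j] tr[OF xs[of j] s[of p k]] that by (cases "k = p") auto
    from cls[OF q(1)] show "lt (h q) (h q')"
    proof (elim disjE exE conjE)
      assume a: "-1 < q" "q < 0" "q \<in> F" "h q = x (rl q)"
      from cls[OF q(2)] show ?thesis
      proof (elim disjE exE conjE)
        assume "h q' = x (rl q')"
        then show ?thesis using a x[OF rl[OF a(3) lt]] by simp
      next
        assume "h q' = y (rr q')"
        then show ?thesis using a tr[OF xs sy] by simp
      next
        fix k assume k: "k < n" "q' = of_int (int k - int p)" "h q' = s k"
        then have "p \<le> k" using lt a by linarith
        then show ?thesis using a k ps by simp
      qed
    next
      assume a: "0 < q" "q < 1" "q \<in> F" "h q = y (rr q)"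
      from cls[OF q(2)] show ?thesis
      proof (elim disjE exE conjE)
        assume "q' < 0"
        then show ?thesis using a lt by simp
      next
        assume "q' \<in> F" "h q' = y (rr q')"
        then show ?thesis using a y[OF rr[OF _ lt]] by simp
      next
        fix k assume k: "k < n" "q' = of_int (int k - int p)" "h q' = s k"
        then have "p < k" using lt a by linarith
        then show ?thesis using a k ys by simp
      qed
    next
      fix k assume k: "k < n" "q = of_int (int k - int p)" "h q = s k"
      from cls[OF q(2)] show ?thesis
      proof (elim disjE exE conjE)
        assume a: "q' < 0" "h q' = x (rl q')"
        then have "k < p" using lt k by linarith
        then show ?thesis using a k sx by simp
      next
        assume a: "q' < 1" "h q' = y (rr q')"
        then have "k \<le> p" using lt k by linarith
        then show ?thesis using a k sp by simp
      next
        fix k' assume k': "k' < n" "q' = of_int (int k' - int p)" "h q' = s k'"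
        then have "k < k'" using lt k by linarith
        then show ?thesis using k k' s by simp
      qed
    qed
  qed (use hs in simp)
qed

abbreviation ctr :: "'c + unit + 'c" where "ctr \<equiv> Inr (Inl ())"

text \<open>Translates indices of \<open>W\<close> into indices of \<open>V\<close>; the value at
  \<open>ctr\<close> is a dummy.\<close>

definition une :: "'c + unit + 'c \<Rightarrow> 'c + 'c" where
  "une u = (case u of Inl x \<Rightarrow> Inl x | Inr v \<Rightarrow> (case v of Inl _ \<Rightarrow> undefined | Inr y \<Rightarrow> Inr y))"

locale witness_structure = nip_structure L U \<mu>
  for L :: "('f, 'r) lang" and U :: "('f, 'r, 'u) struct" and \<mu> :: "'c rel" +
  fixes X :: "'c set" and \<pi> :: "('f, 'r, 'c + 'u) fm set" and A :: "'u set" and \<kappa> :: "'k rel"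
    and a :: "'c \<Rightarrow> 'u" and Y :: "'k \<Rightarrow> 'c set" and I J :: "'k \<Rightarrow> ('c, 'c, 'u) tseq" and b :: "'k \<Rightarrow> 'c \<Rightarrow> 'u"
  assumes wit: "str_witness L U \<mu> X \<pi> A \<kappa> a Y I J b" and A_dom: "A \<subseteq> Dom U"
begin

abbreviation W :: "'k \<Rightarrow> ('c + unit + 'c, 'c, 'u) tseq" where "W i \<equiv> I i \<oplus> seq_single (b i) \<oplus> J i"

abbreviation V :: "'k \<Rightarrow> ('c + 'c, 'c, 'u) tseq" where "V i \<equiv> I i \<oplus> J i"

abbreviation K :: "'k set" where "K \<equiv> Field \<kappa>"

definition lt :: "'k \<Rightarrow> 'c + unit + 'c \<Rightarrow> 'c + unit + 'c \<Rightarrow> bool" where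
  "lt i u v \<longleftrightarrow> (u, v) \<in> fst (W i) \<and> u \<noteq> v"

lemma seqs: "i \<in> K \<Longrightarrow> is_seq U (Y i) (I i)" "i \<in> K \<Longrightarrow> is_seq U (Y i) (J i)"
  "i \<in> K \<Longrightarrow> is_seq U (Y i) (W i)" "i \<in> K \<Longrightarrow> is_seq U (Y i) (V i)"
  using wit unfolding str_witness_def by (simp_all add: is_seq_append is_seq_single)

lemma aX_dom: "a ` X \<subseteq> Dom U"
  using wit by (simp add: str_witness_def realizes_def tuples_def)

lemma Aa_dom: "A \<union> a ` X \<subseteq> Dom U"
  using A_dom aX_dom by simp

lemma fst_W: "fst (W i) = ord_sum (fst (I i)) (ord_sum {((), ())} (fst (J i)))"
  by (simp add: seq_append_def seq_single_def)

lemma fst_V: "fst (V i) = ord_sum (fst (I i)) (fst (J i))"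
  by (simp add: seq_append_def)

lemma Field_W: "Field (fst (W i)) = Inl ` Field (fst (I i)) \<union> insert ctr (Inr ` Inr ` Field (fst (J i)))"
  unfolding fst_W Field_ord_sum by (auto simp: Field_def)

lemma snd_W: "u \<noteq> ctr \<Longrightarrow> snd (V i) (une u) = snd (W i) u"
  by (auto simp: seq_append_def une_def split: sum.split)

lemma une_W:
  "u \<noteq> ctr \<Longrightarrow> u \<in> Field (fst (W i)) \<Longrightarrow> une u \<in> Field (fst (V i))"
  "u \<noteq> ctr \<Longrightarrow> v \<noteq> ctr \<Longrightarrow> (u, v) \<in> fst (W i) \<Longrightarrow> (une u, une v) \<in> fst (V i)"
  "u \<noteq> ctr \<Longrightarrow> v \<noteq> ctr \<Longrightarrow> u \<noteq> v \<Longrightarrow> une u \<noteq> une v"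
  unfolding Field_W fst_V fst_W by (auto simp: une_def Field_ord_sum split: sum.splits)

lemma smap_une:
  assumes "smap F (fst (W i)) h" "\<And>q. q \<in> F \<Longrightarrow> h q \<noteq> ctr"
  shows "smap F (fst (V i)) (\<lambda>q. une (h q))"
  using assms une_W(1)[of _ i] une_W(2)[of _ _ i] une_W(3) unfolding smap_def by simp

lemma increasing_une:
  assumes "increasing (fst (W i)) n t" "\<And>k. k < n \<Longrightarrow> t k \<noteq> ctr"
  shows "increasing (fst (V i)) n (\<lambda>k. une (t k))"
  unfolding increasing_def
proof (intro conjI allI impI)
  fix k assume "k < n"
  then show "une (t k) \<in> Field (fst (V i))" using assms une_W(1)[of "t k" i] unfolding increasing_def by simp
next
  fix k l assume kl: "k < l \<and> l < n"
  then have "t k \<noteq> ctr" "t l \<noteq> ctr" "(t k, t l) \<in> fst (W i)" "t k \<noteq> t l"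
    using assms(1) assms(2)[of k] assms(2)[of l] unfolding increasing_def by auto
  then show "(une (t k), une (t l)) \<in> fst (V i)" "une (t k) \<noteq> une (t l)" using une_W(2,3) by blast+
qed

lemma V_indiscernible: "i \<in> K \<Longrightarrow> indiscernible L U (Y i) (A \<union> a ` X) (V i)"
  using wit unfolding str_witness_def mutually_indiscernible_def by (blast intro: indiscernible_mono)

text \<open>Without its centre the sequence is indiscernible over \<open>A\<close> and
  \<open>a\<close>, so the predicate witnessing the failure has a constant truth value on tuples
  that avoid the centre. Up to negation this value is false, and a tuple on which the predicate is
  true has to pass through the centre.\<close>

lemma witness_formula:
  assumes i: "i \<in> K"
  shows "\<exists>n P s. dfn L U (tvars n (Y i) (A \<union> a ` X)) P \<and> increasing (fst (W i)) n s \<and> P (tup (W i) s) \<and>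
    (\<forall>t. increasing (fst (W i)) n t \<and> (\<forall>k < n. t k \<noteq> ctr) \<longrightarrow> \<not> P (tup (W i) t)) \<and>
    (\<exists>t. increasing (fst (W i)) n t \<and> (\<forall>k < n. t k \<noteq> ctr))"
proof -
  have "\<not> indiscernible L U (Y i) (A \<union> a ` X) (W i)" using wit i unfolding str_witness_def by blast
  then obtain n P s0 t0 where P: "dfn L U (tvars n (Y i) (A \<union> a ` X)) P"
    and st: "increasing (fst (W i)) n s0" "increasing (fst (W i)) n t0" "P (tup (W i) s0) \<noteq> P (tup (W i) t0)"
    using indiscernibleI[of L U "Y i" "A \<union> a ` X" "W i"] by blast
  have lin: "Linear_order (fst (I i))" using seqs(1)[OF i] by (simp add: is_seq_def)
  have we: "without_endpoints (I i)" using wit i unfolding str_witness_def by blast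
  then obtain x0 where "x0 \<in> Field (fst (I i))" unfolding without_endpoints_def by blast
  then obtain x :: "nat \<Rightarrow> 'c" where x: "\<And>k. (x0, x k) \<in> fst (I i)"
    "\<And>k k'. k < k' \<Longrightarrow> (x k, x k') \<in> fst (I i) \<and> x k \<noteq> x k'"
    using ascending_chain[OF lin _, of x0] we unfolding without_endpoints_def by metis
  have u: "increasing (fst (W i)) n (\<lambda>k. Inl (x k))"
    unfolding increasing_def Field_W using x FieldI2[OF x(1)] by (auto simp: fst_W)
  have eq: "P (tup (W i) t) = P (tup (W i) (\<lambda>k. Inl (x k)))"
    if t: "increasing (fst (W i)) n t" "\<forall>k < n. t k \<noteq> ctr" for t
  proof -
    have e: "P (tup (W i) t) = P (tup (V i) (\<lambda>k. une (t k)))"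
      if t: "increasing (fst (W i)) n t" "\<forall>k < n. t k \<noteq> ctr" for t
      using tup_dom[OF seqs(3)[OF i] Aa_dom t(1)] t(2) snd_W[of _ i] by (intro dfn_cong[OF P]) auto
    have "P (tup (V i) (\<lambda>k. une (t k))) = P (tup (V i) (\<lambda>k. une (Inl (x k))))"
      using t u by (intro indiscernibleD[OF V_indiscernible[OF i] seqs(4)[OF i] Aa_dom P] increasing_une) auto
    then show ?thesis using e[OF t] e[OF u] by simp
  qed
  define \<beta> where "\<beta> = P (tup (W i) (\<lambda>k. Inl (x k)))"
  have d: "dfn L U (tvars n (Y i) (A \<union> a ` X)) (\<lambda>v. P v \<noteq> \<beta>)" using P dfn_Not by (cases \<beta>) simp_all
  obtain s where s: "increasing (fst (W i)) n s" "P (tup (W i) s) \<noteq> \<beta>" using st by blast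
  have t: "\<forall>t. increasing (fst (W i)) n t \<and> (\<forall>k < n. t k \<noteq> ctr) \<longrightarrow> \<not> (P (tup (W i) t) \<noteq> \<beta>)"
    using eq unfolding \<beta>_def by blast
  have ex: "\<exists>t. increasing (fst (W i)) n t \<and> (\<forall>k < n. t k \<noteq> ctr)"
    using u by (intro exI[of _ "\<lambda>k. Inl (x k)"]) simp
  show ?thesis
    by (rule exI[of _ n], rule exI[of _ "\<lambda>v. P v \<noteq> \<beta>"], rule exI[of _ s]) (intro conjI d s t ex)
qed

text \<open>Besides the predicate and a tuple \<open>s\<close> through the centre, this records that
  any finite set of positions between -1 and 1 can be filled with points of the sequence lying
  between the neighbours of the centre in \<open>s\<close>.\<close>

definition nbhd :: "'k \<Rightarrow> nat \<Rightarrow> ((nat \<times> 'c + 'u \<Rightarrow> 'u) \<Rightarrow> bool) \<Rightarrow> (nat \<Rightarrow> 'c + unit + 'c) \<Rightarrow> nat \<Rightarrow> bool" where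
  "nbhd i n P s p \<longleftrightarrow> dfn L U (tvars n (Y i) (A \<union> a ` X)) P \<and> increasing (fst (W i)) n s \<and> P (tup (W i) s) \<and>
    (\<forall>t. increasing (fst (W i)) n t \<and> (\<forall>k < n. t k \<noteq> ctr) \<longrightarrow> \<not> P (tup (W i) t)) \<and>
    p < n \<and> s p = ctr \<and>
    (\<forall>F. finite F \<and> F \<subseteq> {-1<..<1} \<longrightarrow> (\<exists>h. smap (F \<union> pts n p) (fst (W i)) h \<and>
       (\<forall>k < n. h (of_int (int k - int p)) = s k) \<and> (\<forall>q \<in> F. q \<noteq> 0 \<longrightarrow> h q \<noteq> ctr)))"

lemma lt_trans:
  assumes "i \<in> K" "lt i u v" "lt i v w"
  shows "lt i u w"
proof -
  have "trans (fst (W i))" "antisym (fst (W i))"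
    using seqs(3)[OF assms(1)] by (auto simp: is_seq_def order_on_defs)
  then show ?thesis using assms(2,3) unfolding lt_def by (blast dest: transD antisymD)
qed

text \<open>\<open>I\<close> has no last point and \<open>J\<close> no first point, so infinite
  chains fit between the centre and its neighbours in \<open>s\<close>.\<close>

lemma ex_nbhd:
  assumes i: "i \<in> K"
  shows "\<exists>n P s p. nbhd i n P s p"
proof -
  obtain n P s where P: "dfn L U (tvars n (Y i) (A \<union> a ` X)) P" "increasing (fst (W i)) n s" "P (tup (W i) s)"
    "\<forall>t. increasing (fst (W i)) n t \<and> (\<forall>k < n. t k \<noteq> ctr) \<longrightarrow> \<not> P (tup (W i) t)"
    using witness_formula[OF i] by (elim exE conjE) (rule that)
  then obtain p where p: "p < n" "s p = ctr" by blast
  have s: "lt i (s k) (s k')" if "k < k'" "k' < n" for k k'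
    using P(2) that unfolding increasing_def lt_def by blast
  have sF: "s k \<in> Field (fst (W i))" if "k < n" for k using P(2) that unfolding increasing_def by blast
  have sl: "\<exists>z \<in> Field (fst (I i)). s k = Inl z" if "k < p" for k
    using s[OF that p(1), unfolded lt_def fst_W] sF[of k, unfolded Field_W] that p by auto
  have sr: "\<exists>z \<in> Field (fst (J i)). s k = Inr (Inr z)" if "p < k" "k < n" for k
    using s[OF that, unfolded lt_def fst_W] sF[of k, unfolded Field_W] that p by auto
  have linI: "Linear_order (fst (I i))" and linJ: "Linear_order (fst (J i))"
    using seqs(1,2)[OF i] by (simp_all add: is_seq_def)
  have we: "without_endpoints (I i)" "without_endpoints (J i)" using wit i unfolding str_witness_def by blast+
  \<comment> \<open>If \<open>s\<close> has no entry before the centre, any point of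
    \<open>I\<close> bounds the chain from below.\<close>
  have "\<exists>x0 \<in> Field (fst (I i)). 0 < p \<longrightarrow> s (p - 1) = Inl x0"
  proof (cases "0 < p")
    case True
    then show ?thesis using sl[of "p - 1"] by auto
  next
    case False
    then show ?thesis using we(1) unfolding without_endpoints_def by auto
  qed
  then obtain x0 where x0: "x0 \<in> Field (fst (I i))" "0 < p \<Longrightarrow> s (p - 1) = Inl x0" by blast
  have "\<exists>y0 \<in> Field (fst (J i)). p + 1 < n \<longrightarrow> s (p + 1) = Inr (Inr y0)"
  proof (cases "p + 1 < n")
    case True
    then show ?thesis using sr[of "p + 1"] by auto
  next
    case False
    then show ?thesis using we(2) unfolding without_endpoints_def by auto
  qed
  then obtain y0 where y0: "y0 \<in> Field (fst (J i))" "p + 1 < n \<Longrightarrow> s (p + 1) = Inr (Inr y0)" by blast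
  obtain x :: "nat \<Rightarrow> 'c" where x: "\<And>k. (x0, x k) \<in> fst (I i)" "\<And>k. x0 \<noteq> x k"
    "\<And>k k'. k < k' \<Longrightarrow> (x k, x k') \<in> fst (I i) \<and> x k \<noteq> x k'"
    using ascending_chain[OF linI _ x0(1)] we(1) unfolding without_endpoints_def by metis
  have "Linear_order ((fst (J i))\<inverse>)" using linJ by simp
  then obtain y :: "nat \<Rightarrow> 'c" where y: "\<And>k. (y k, y0) \<in> fst (J i)" "\<And>k. y0 \<noteq> y k"
    "\<And>k k'. k < k' \<Longrightarrow> (y k', y k) \<in> fst (J i) \<and> y k \<noteq> y k'"
    using ascending_chain[of "(fst (J i))\<inverse>" y0] we(2) y0(1) unfolding without_endpoints_def
    by (metis Field_converse converse_iff)
  have U: "Field {((), ())} = {()}" by (auto simp: Field_def)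
  have xF: "x k \<in> Field (fst (I i))" for k using FieldI2[OF x(1)] .
  have yF: "y k \<in> Field (fst (J i))" for k using FieldI1[OF y(1)] .
  have "\<exists>h. smap (F \<union> pts n p) (fst (W i)) h \<and>
      (\<forall>k < n. h (of_int (int k - int p)) = s k) \<and> (\<forall>q \<in> F. q \<noteq> 0 \<longrightarrow> h q \<noteq> ctr)"
    if F: "finite F" "F \<subseteq> {-1<..<1}" for F :: "rat set"
  proof -
    obtain h where h: "\<And>k. k < n \<Longrightarrow> h (of_int (int k - int p)) = s k"
      "\<And>q. q \<in> F \<Longrightarrow> q \<noteq> 0 \<Longrightarrow> h q \<in> range (\<lambda>k. Inl (x k)) \<union> range (\<lambda>k. Inr (Inr (y k)))"
      "\<And>q q'. q \<in> F \<union> pts n p \<Longrightarrow> q' \<in> F \<union> pts n p \<Longrightarrow> q < q' \<Longrightarrow> lt i (h q) (h q')"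
    proof (rule insert_positions[of "lt i" n s p "\<lambda>k. Inl (x k)" "\<lambda>k. Inr (Inr (y k))" F])
      show "lt i (Inl (x k)) (Inl (x k'))" if "k < k'" for k k' using x(3)[OF that] by (simp add: lt_def fst_W)
      show "lt i (Inr (Inr (y k'))) (Inr (Inr (y k)))" if "k < k'" for k k'
        using y(3)[OF that] by (auto simp: lt_def fst_W)
      show "lt i (Inl (x j)) (s p)" for j using xF p(2) unfolding lt_def fst_W by (simp add: Field_ord_sum U)
      show "lt i (s p) (Inr (Inr (y j)))" for j using yF p(2) by (simp add: lt_def fst_W Field_def)
      show "lt i (s k) (Inl (x j))" if "k < p" for k j
      proof -
        have a: "lt i (s (p - 1)) (Inl (x j))" using x0(2) that x(1,2) by (simp add: lt_def fst_W)
        show ?thesis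
        proof (cases "k = p - 1")
          case False
          then have "lt i (s k) (s (p - 1))" using that p(1) by (intro s) auto
          then show ?thesis using a by (rule lt_trans[OF i])
        qed (use a in simp)
      qed
      show "lt i (Inr (Inr (y j))) (s k)" if "p < k" "k < n" for k j
      proof -
        have "p + 1 < n" using that by simp
        then have a: "lt i (Inr (Inr (y j))) (s (p + 1))" using y0(2) y(1,2) by (auto simp: lt_def fst_W)
        show ?thesis
        proof (cases "k = p + 1")
          case False
          then have "lt i (s (p + 1)) (s k)" using that by (intro s) auto
          then show ?thesis by (rule lt_trans[OF i a])
        qed (use a in simp)
      qed
    qed (use s p F lt_trans[OF i] in blast)+
    have "h q \<in> Field (fst (W i))" if "q \<in> F \<union> pts n p" for q
    proof (cases "q \<in> pts n p")
      case True
      then show ?thesis using h(1) sF by (auto simp: pts_def)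
    next
      case False
      moreover have "0 \<in> pts n p" unfolding pts_def using p by (intro image_eqI[of _ _ p]) auto
      ultimately have "h q \<in> range (\<lambda>k. Inl (x k)) \<union> range (\<lambda>k. Inr (Inr (y k)))" using h(2)[of q] that by auto
      then show ?thesis using xF yF unfolding Field_W by auto
    qed
    then have "smap (F \<union> pts n p) (fst (W i)) h" using h(3) unfolding smap_def lt_def by blast
    moreover have "\<forall>q \<in> F. q \<noteq> 0 \<longrightarrow> h q \<noteq> ctr" using h(2) by fastforce
    ultimately show ?thesis using h(1) by (intro exI[of _ h]) simp
  qed
  then have "nbhd i n P s p" unfolding nbhd_def using P p by simp
  then show ?thesis by (intro exI)
qed

end

section \<open>From a witness to an array over the rationals\<close>

context array_structure
begin

text \<open>A finite part of an instance of indiscernibility looks at finitely many positions, so it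
  is enough to fill each finite set of positions indiscernibly.\<close>

lemma array_compactness:
  assumes A: "A \<subseteq> Dom U" "|A| <o \<mu>" and X: "|X| <o \<mu>" "a ` X \<subseteq> Dom U"
    and \<Phi>2: "\<And>P. P \<in> \<Phi>2 \<Longrightarrow> dfn L U (Par ` A \<union> Xv ` X \<union> At UNIV) P"
    and sample: "\<And>R0. finite R0 \<Longrightarrow> \<exists>E. rmi R0 (Par ` A) a E \<and> rmi (R0 - {0}) (Par ` A \<union> Xv ` X) a E \<and>
      asg a E ` At UNIV \<subseteq> Dom U \<and> (\<forall>P \<in> \<Phi>2. P (asg a E))"
  obtains D where "rmi UNIV (Par ` A) a D" "rmi (- {0}) (Par ` A \<union> Xv ` X) a D" "\<And>P. P \<in> \<Phi>2 \<Longrightarrow> P (asg a D)"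
proof -
  let ?S = "Par ` A \<union> Xv ` X :: ('u, 'c, 'k, rat) vr set" and ?V = "At UNIV"
  \<comment> \<open>The flag selects one of the two requirements: over \<open>A\<close> at all
    positions, or over \<open>A\<close> and the tuple off the centre.\<close>
  define S0 where "S0 = (\<lambda>b. if b then Par ` A else ?S)"
  define G where "G = (\<lambda>b. if b then UNIV else - {0 :: rat})"
  have S0: "S0 b \<subseteq> range Par \<union> range Xv" "S0 b \<subseteq> ?S" for b by (auto simp: S0_def)
  define tr where "tr = (\<lambda>(b, P :: (('u, 'c, 'k, rat) vr \<Rightarrow> 'u) \<Rightarrow> bool, F :: 'k \<Rightarrow> rat set, f).
    dfn L U (S0 b \<union> Ar F) P \<and> (\<forall>i \<in> K. F i \<subseteq> G b) \<and> into (G b) F f)"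
  define cond where "cond = (\<lambda>(b :: bool, P :: (('u, 'c, 'k, rat) vr \<Rightarrow> 'u) \<Rightarrow> bool, F :: 'k \<Rightarrow> rat set, f) v.
    P v = P (v \<circ> ren f))"
  let ?\<Phi> = "\<Phi>2 \<union> cond ` Collect tr"
  have FV: "S0 b \<union> Ar F \<subseteq> ?S \<union> ?V" for b F using S0(2)[of b] arr_mono[of K F "\<lambda>_. UNIV" Y] by auto
  have rF: "ren f ` (S0 b \<union> Ar F) \<subseteq> ?S \<union> ?V" for f F b
  proof -
    have "ren f ` (S0 b \<union> Ar F) \<subseteq> S0 b \<union> At UNIV" using S0(1) by (rule ren_Un_arr) auto
    then show ?thesis using S0(2)[of b] by blast
  qed
  have dcond: "dfn L U (?S \<union> ?V) (cond j)" if "tr j" for j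
  proof -
    obtain b P F f where j: "j = (b, P, F, f)" by (cases j) auto
    have "dfn L U (S0 b \<union> Ar F) P" using that j by (simp add: tr_def)
    from dfn_Iff[OF dfn_mono[OF this FV] dfn_subst'[OF this rF[of f b F]]]
    show ?thesis unfolding j cond_def prod.case .
  qed
  \<comment> \<open>The array part is a dummy; it is overwritten on all of
    \<open>?V\<close>.\<close>
  define v0 where "v0 = asg a (\<lambda>(i :: 'k) (q :: rat) (y :: 'c). undefined :: 'u)"
  have Sdom: "v0 ` ?S \<subseteq> Dom U" using A(1) X(2) by (auto simp: v0_def)
  obtain w where w: "w ` ?V \<subseteq> Dom U" "\<And>P. P \<in> ?\<Phi> \<Longrightarrow> P (override_on v0 w ?V)"
  proof (rule compactness[of ?\<Phi> ?S ?V v0])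
    show "dfn L U (?S \<union> ?V) P" if "P \<in> ?\<Phi>" for P using that \<Phi>2 dcond by auto
    show "|?S| <o \<mu>" using A(2) X(1) by (intro small_Un small_image)
    show "|?V| <o \<mu>" by (rule small_arr)
    show "v0 ` ?S \<subseteq> Dom U" by (rule Sdom)
    fix \<Phi>0 assume \<Phi>0: "finite \<Phi>0" "\<Phi>0 \<subseteq> ?\<Phi>"
    have "finite (\<Phi>0 - \<Phi>2)" "\<Phi>0 - \<Phi>2 \<subseteq> cond ` Collect tr" using \<Phi>0 by auto
    from finite_subset_image[OF this] obtain J where J: "J \<subseteq> Collect tr" "finite J"
      "\<Phi>0 - \<Phi>2 = cond ` J" by (elim exE conjE) (rule that)
    define bb where "bb = (\<lambda>j :: bool \<times> ((('u, 'c, 'k, rat) vr \<Rightarrow> 'u) \<Rightarrow> bool) \<times> ('k \<Rightarrow> rat set) \<times> ('k \<Rightarrow> rat \<Rightarrow> rat). fst j)"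
    define PP where "PP = (\<lambda>j :: bool \<times> ((('u, 'c, 'k, rat) vr \<Rightarrow> 'u) \<Rightarrow> bool) \<times> ('k \<Rightarrow> rat set) \<times> ('k \<Rightarrow> rat \<Rightarrow> rat). fst (snd j))"
    define FF where "FF = (\<lambda>j :: bool \<times> ((('u, 'c, 'k, rat) vr \<Rightarrow> 'u) \<Rightarrow> bool) \<times> ('k \<Rightarrow> rat set) \<times> ('k \<Rightarrow> rat \<Rightarrow> rat). fst (snd (snd j)))"
    define ff where "ff = (\<lambda>j :: bool \<times> ((('u, 'c, 'k, rat) vr \<Rightarrow> 'u) \<Rightarrow> bool) \<times> ('k \<Rightarrow> rat set) \<times> ('k \<Rightarrow> rat \<Rightarrow> rat). snd (snd (snd j)))"
    have trj: "dfn L U (S0 (bb j) \<union> Ar (FF j)) (PP j)" "\<forall>i \<in> K. FF j i \<subseteq> G (bb j)" "into (G (bb j)) (FF j) (ff j)"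
      if "j \<in> J" for j
    proof -
      have "tr j" using that J(1) by blast
      then show "dfn L U (S0 (bb j) \<union> Ar (FF j)) (PP j)" "\<forall>i \<in> K. FF j i \<subseteq> G (bb j)" "into (G (bb j)) (FF j) (ff j)"
        by (cases j; simp add: tr_def bb_def PP_def FF_def ff_def)+
    qed
    have cj: "cond j = (\<lambda>v. PP j v = PP j (v \<circ> ren (ff j)))" for j
      by (cases j) (simp add: cond_def PP_def ff_def)
    define fin where "fin = (\<lambda>j T Q. finite T \<and> T \<subseteq> S0 (bb j) \<union> Ar (FF j) \<and> dfn L U T Q \<and>
        (\<forall>v. v ` (S0 (bb j) \<union> Ar (FF j)) \<subseteq> Dom U \<longrightarrow> PP j v = Q v))"
    have "\<exists>T Q. fin j T Q" if jJ: "j \<in> J" for j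
    proof -
      obtain T Q where "finite T" "T \<subseteq> S0 (bb j) \<union> Ar (FF j)" "dfn L U T Q"
        "\<And>v. v ` (S0 (bb j) \<union> Ar (FF j)) \<subseteq> Dom U \<Longrightarrow> PP j v = Q v" using trj(1)[OF jJ] by (rule dfn_finite) blast
      then show ?thesis unfolding fin_def by (intro exI[of _ T] exI[of _ Q]) simp
    qed
    then obtain T Q where TQ: "\<And>j. j \<in> J \<Longrightarrow> fin j (T j) (Q j)" by metis
    have T: "finite (T j)" "T j \<subseteq> S0 (bb j) \<union> Ar (FF j)" "dfn L U (T j) (Q j)"
      "\<And>v. v ` (S0 (bb j) \<union> Ar (FF j)) \<subseteq> Dom U \<Longrightarrow> PP j v = Q j v" if "j \<in> J" for j
      using TQ[OF that] unfolding fin_def by simp_all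
    define po :: "('u, 'c, 'k, rat) vr \<Rightarrow> rat" where "po = (\<lambda>x. case x of Arr i q y \<Rightarrow> q | _ \<Rightarrow> 0)"
    define R0 where "R0 = (\<Union>j \<in> J. po ` T j \<union> (\<lambda>x. po (ren (ff j) x)) ` T j)"
    have "finite R0" unfolding R0_def using J(2) T(1) by auto
    then obtain E where E: "rmi R0 (Par ` A) a E" "rmi (R0 - {0}) ?S a E" "asg a E ` ?V \<subseteq> Dom U"
      "\<forall>P \<in> \<Phi>2. P (asg a E)" using sample by blast
    have u: "override_on v0 (asg a E) ?V x = asg a E x" if "x \<in> ?S \<union> ?V" for x
      using that by (auto simp: override_on_def v0_def)
    let ?u = "override_on v0 (asg a E) ?V"
    have Edom: "asg a E ` (?S \<union> ?V) \<subseteq> Dom U" using E(3) A(1) X(2) by auto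
    have udom: "?u ` (?S \<union> ?V) \<subseteq> Dom U" by (rule override_on_image_subset[OF Sdom E(3)]) simp
    have "P ?u" if P: "P \<in> \<Phi>0" for P
    proof (cases "P \<in> \<Phi>2")
      case True
      then have "P (asg a E)" using E(4) by blast
      moreover have "P ?u = P (asg a E)" by (rule dfn_cong[OF \<Phi>2[OF True] udom u])
      ultimately show ?thesis by simp
    next
      case False
      then have "P \<in> cond ` J" using P J(3) by blast
      then obtain j where j: "j \<in> J" and Pj: "P = cond j" by auto
      define F where "F = (\<lambda>i. {q. \<exists>y. Arr i q y \<in> T j})"
      let ?G = "R0 \<inter> G (bb j)"
      have Tq: "i \<in> K \<and> q \<in> FF j i \<and> y \<in> Y i \<and> q \<in> R0 \<and> ff j i q \<in> R0" if x: "Arr i q y \<in> T j" for i q y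
      proof -
        have "Arr i q y \<in> S0 (bb j) \<union> Ar (FF j)" using T(2)[OF j] x by blast
        then have "i \<in> K" "q \<in> FF j i" "y \<in> Y i" using S0(1)[of "bb j"] by auto
        moreover have "po (Arr i q y) \<in> R0" "po (ren (ff j) (Arr i q y)) \<in> R0"
          unfolding R0_def using j x by blast+
        ultimately show ?thesis by (simp add: po_def)
      qed
      have FG: "F i \<subseteq> ?G" if "i \<in> K" for i
        using trj(2)[OF j] Tq that unfolding F_def by blast
      have io: "into ?G F (ff j)" unfolding into_def
      proof (intro ballI conjI)
        fix i assume i: "i \<in> K"
        have "F i \<subseteq> FF j i" using Tq unfolding F_def by blast
        then show "strict_mono_on (F i) (ff j i)"
          using trj(3)[OF j] i unfolding into_def strict_mono_on_def by blast
        have "ff j i q \<in> G (bb j)" if "q \<in> F i" for q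
          using trj(3)[OF j] i that \<open>F i \<subseteq> FF j i\<close> unfolding into_def by blast
        moreover have "ff j i q \<in> R0" if "q \<in> F i" for q using that Tq unfolding F_def by blast
        ultimately show "ff j i ` F i \<subseteq> ?G" by blast
      qed
      have "rmi ?G (S0 (bb j)) a E"
        using E(1,2) by (cases "bb j") (simp_all add: G_def S0_def Diff_eq)
      then have eq: "tpeq L U (S0 (bb j) \<union> Ar F) (asg a E) (asg a (\<lambda>i q. E i (ff j i q)))"
        by (rule rmiD[OF _ FG io])
      have TF: "T j \<subseteq> S0 (bb j) \<union> Ar F"
      proof
        fix x assume x: "x \<in> T j"
        then have "x \<in> S0 (bb j) \<union> Ar (FF j)" using T(2)[OF j] by blast
        then show "x \<in> S0 (bb j) \<union> Ar F" using x Tq by (cases x) (auto simp: F_def)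
      qed
      have TS: "T j \<subseteq> ?S \<union> ?V" by (rule subset_trans[OF TF FV])
      have rTS: "ren (ff j) ` T j \<subseteq> ?S \<union> ?V" by (rule subset_trans[OF image_mono[OF TF] rF])
      have "PP j ?u = Q j ?u" by (rule T(4)[OF j subset_trans[OF image_mono[OF FV] udom]])
      also have "\<dots> = Q j (asg a E)"
      proof (rule dfn_cong[OF T(3)[OF j] subset_trans[OF image_mono[OF TS] udom]])
        fix x assume "x \<in> T j"
        then have "x \<in> ?S \<union> ?V" using TS by blast
        then show "?u x = asg a E x" by (rule u)
      qed
      also have "\<dots> = Q j (asg a E \<circ> ren (ff j))"
        unfolding asg_ren by (rule tpeqD[OF eq dfn_mono[OF T(3)[OF j] TF]])
      also have "\<dots> = Q j (?u \<circ> ren (ff j))"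
      proof (rule dfn_cong[OF T(3)[OF j]])
        have "(asg a E \<circ> ren (ff j)) ` T j = asg a E ` ren (ff j) ` T j" by (simp only: image_comp)
        also have "\<dots> \<subseteq> Dom U" by (rule subset_trans[OF image_mono[OF rTS] Edom])
        finally show "(asg a E \<circ> ren (ff j)) ` T j \<subseteq> Dom U" .
        fix x assume "x \<in> T j"
        then have "ren (ff j) x \<in> ?S \<union> ?V" using rTS by blast
        then show "(asg a E \<circ> ren (ff j)) x = (?u \<circ> ren (ff j)) x" using u by simp
      qed
      also have "\<dots> = PP j (?u \<circ> ren (ff j))"
      proof (rule T(4)[OF j, symmetric])
        have "(?u \<circ> ren (ff j)) ` (S0 (bb j) \<union> Ar (FF j)) = ?u ` ren (ff j) ` (S0 (bb j) \<union> Ar (FF j))"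
          by (simp only: image_comp)
        also have "\<dots> \<subseteq> Dom U" by (rule subset_trans[OF image_mono[OF rF] udom])
        finally show "(?u \<circ> ren (ff j)) ` (S0 (bb j) \<union> Ar (FF j)) \<subseteq> Dom U" .
      qed
      finally show ?thesis unfolding Pj cj .
    qed
    then have "\<forall>P \<in> \<Phi>0. P ?u" by (rule ballI)
    then show "\<exists>w. w ` ?V \<subseteq> Dom U \<and> (\<forall>P \<in> \<Phi>0. P (override_on v0 w ?V))"
      using E(3) by (intro exI[of _ "asg a E"] conjI)
  qed blast
  define D where "D = (\<lambda>i q y. override_on v0 w ?V (Arr i q y))"
  have D: "override_on v0 w ?V = asg a D"
    unfolding D_def by (rule asg_eta) (simp_all add: override_on_def v0_def)
  have Ddom: "asg a D ` (?S \<union> ?V) \<subseteq> Dom U"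
    unfolding D[symmetric] by (rule override_on_image_subset[OF Sdom w(1)]) simp
  have rmi: "rmi (G b) (S0 b) a D" for b
    unfolding rmi_def
  proof (intro allI impI, elim conjE)
    fix F f assume F: "\<forall>i \<in> K. F i \<subseteq> G b" and f: "into (G b) F f"
    show "tpeq L U (S0 b \<union> Ar F) (asg a D) (asg a (\<lambda>i q. D i (f i q)))"
    proof (rule tpeqI)
      show "asg a D ` (S0 b \<union> Ar F) \<subseteq> Dom U" by (rule subset_trans[OF image_mono[OF FV] Ddom])
      have "asg a (\<lambda>i q. D i (f i q)) ` (S0 b \<union> Ar F) = asg a D ` ren f ` (S0 b \<union> Ar F)"
        unfolding asg_ren[symmetric] by (simp only: image_comp)
      also have "\<dots> \<subseteq> Dom U" by (rule subset_trans[OF image_mono[OF rF] Ddom])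
      finally show "asg a (\<lambda>i q. D i (f i q)) ` (S0 b \<union> Ar F) \<subseteq> Dom U" .
      show "P (asg a (\<lambda>i q. D i (f i q)))" if "dfn L U (S0 b \<union> Ar F) P" "P (asg a D)" for P
      proof -
        have "(b, P, F, f) \<in> Collect tr" using that(1) F f by (simp add: tr_def)
        then have "cond (b, P, F, f) \<in> ?\<Phi>" by (intro UnI2 imageI)
        from w(2)[OF this] show ?thesis using that(2) by (simp add: D cond_def asg_ren)
      qed
    qed
  qed
  show ?thesis
  proof (rule that)
    show "rmi UNIV (Par ` A) a D" using rmi[of True] by (simp add: G_def S0_def)
    show "rmi (- {0}) ?S a D" using rmi[of False] by (simp add: G_def S0_def)
    show "P (asg a D)" if "P \<in> \<Phi>2" for P using w(2)[of P] that unfolding D by blast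
  qed
qed

end

text \<open>An increasing map of all rationals into the interval that \<open>pts\<close> leaves
  free, with the centre fixed.\<close>

definition squash :: "rat \<Rightarrow> rat" where
  "squash q = q / (1 + \<bar>q\<bar>)"

lemma squash_less: "q < q' \<Longrightarrow> squash q < squash q'"
proof -
  assume q: "q < q'"
  have "q * (1 + \<bar>q'\<bar>) < q' * (1 + \<bar>q\<bar>)"
  proof (cases "0 \<le> q")
    case True
    then show ?thesis using q by (simp add: algebra_simps)
  next
    case False
    show ?thesis
    proof (cases "0 \<le> q'")
      case True
      have "q * (1 + \<bar>q'\<bar>) < 0" using False by (simp add: mult_neg_pos)
      also have "0 \<le> q' * (1 + \<bar>q\<bar>)" using True by simp
      finally show ?thesis .
    next
      case neg: False
      then show ?thesis using q False by (simp add: algebra_simps)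
    qed
  qed
  then have "q < q' * (1 + \<bar>q\<bar>) / (1 + \<bar>q'\<bar>)" by (intro mult_imp_less_div_pos) auto
  then have "q < q' / (1 + \<bar>q'\<bar>) * (1 + \<bar>q\<bar>)" by simp
  then show ?thesis unfolding squash_def by (intro mult_imp_div_pos_less) auto
qed

lemma squash_range: "squash q \<in> {-1<..<1}"
proof -
  have "- (1 + \<bar>q\<bar>) < q" "q < 1 + \<bar>q\<bar>" by linarith+
  then show ?thesis unfolding squash_def by (simp add: divide_simps)
qed

lemma squash_0 [simp]: "squash 0 = 0"
  by (simp add: squash_def)

lemma inj_squash: "inj squash"
  by (rule injI) (metis less_irrefl linorder_neqE squash_less)

lemma squash_less_iff: "squash q < squash q' \<longleftrightarrow> q < q'"
  using squash_less by (metis less_asym less_irrefl linorder_neqE)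

lemma pts_outside: "q \<in> pts n p \<Longrightarrow> q \<noteq> 0 \<Longrightarrow> q \<le> -1 \<or> 1 \<le> q"
proof -
  assume "q \<in> pts n p" "q \<noteq> 0"
  then obtain k where k: "q = of_int (int k - int p)" unfolding pts_def by blast
  define m where "m = int k - int p"
  have m: "q = of_int m" "m \<noteq> 0" using k \<open>q \<noteq> 0\<close> by (auto simp: m_def simp del: of_int_diff)
  then have "m \<le> -1 \<or> 1 \<le> m" by linarith
  then show ?thesis
    using m(1) of_int_le_iff[of m "-1", where 'a = rat] of_int_le_iff[of 1 m, where 'a = rat] by simp
qed

lemma finite_ordLeq_nat:
  assumes "finite S"
  shows "|S| \<le>o |UNIV :: nat set|"
proof -
  obtain g :: "_ \<Rightarrow> nat" where "inj_on g S"
    using finite_imp_inj_to_nat_seg[OF assms] by (elim exE conjE) (rule that)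
  then show ?thesis by (rule card_of_ordLeqI) simp
qed

lemma smap_subset: "smap F r h \<Longrightarrow> G \<subseteq> F \<Longrightarrow> smap G r h"
  by (auto simp: smap_def)

lemma smap_comp:
  "smap F r h \<Longrightarrow> (\<And>q. q \<in> G \<Longrightarrow> f q \<in> F) \<Longrightarrow>
    (\<And>q q'. q \<in> G \<Longrightarrow> q' \<in> G \<Longrightarrow> q < q' \<Longrightarrow> f q < f q') \<Longrightarrow> smap G r (\<lambda>q. h (f q))"
  by (simp add: smap_def)

text \<open>The other entries are at distance at least 1 from entry \<open>p\<close>, so a point at
  \<open>q\<close> can take its place.\<close>

lemma increasing_replace:
  fixes r :: "'i rel" and s :: "nat \<Rightarrow> 'i"
  assumes h: "smap (F \<union> pts n p) r h" and s: "\<And>k. k < n \<Longrightarrow> h (of_int (int k - int p)) = s k"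
    and q: "q \<in> F" "-1 < q" "q < 1" and p: "p < n"
  shows "increasing r n (s(p := h q))"
proof -
  define g :: "nat \<Rightarrow> rat" where "g = (\<lambda>k. if k = p then q else of_int (int k - int p))"
  have g: "g k \<in> F \<union> pts n p" if "k < n" for k using that q by (auto simp: g_def pts_def)
  have gs: "(s(p := h q)) k = h (g k)" if "k < n" for k using s[OF that] by (simp add: g_def)
  have gm: "g k < g l" if "k < l" for k l
  proof -
    have "int k - int p + 1 \<le> int l - int p" using that by simp
    then have "(of_int (int k - int p) :: rat) + 1 \<le> of_int (int l - int p)"
      by (metis of_int_1 of_int_add of_int_le_iff)
    moreover have "of_int (int p - int p) = (0 :: rat)" by simp
    ultimately show ?thesis using q unfolding g_def
      by (cases "k = p"; cases "l = p") (auto simp del: of_int_diff)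
  qed
  have hF: "h (g k) \<in> Field r" if "k < n" for k using h g[OF that] unfolding smap_def by blast
  have hr: "(h (g k), h (g l)) \<in> r \<and> h (g k) \<noteq> h (g l)" if "k < l" "l < n" for k l
    using h g[of k] g[of l] gm[OF that(1)] that unfolding smap_def by simp
  show ?thesis unfolding increasing_def
  proof (intro conjI allI impI)
    show "(s(p := h q)) k \<in> Field r" if "k < n" for k using hF[OF that] gs[OF that] by simp
    fix k l assume kl: "k < l \<and> l < n"
    then show "((s(p := h q)) k, (s(p := h q)) l) \<in> r" "(s(p := h q)) k \<noteq> (s(p := h q)) l"
      using hr[of k l] gs[of k] gs[of l] by (simp_all del: fun_upd_apply)
  qed
qed

section \<open>Base change for a small index set\<close>

context witness_structure
begin

text \<open>For each \<open>i\<close> one predicate is kept, in which only finitely many coordinates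
  \<open>Y'\<close> matter. After the enlargement of the base to \<open>A'\<close> it speaks of the
  centre alone, as \<open>Q i\<close>. A new witness then only has to reproduce \<open>Q i\<close>
  at 0 and its failure at 1, and smallness of the index set makes both \<open>A'\<close> and the
  array small.\<close>

lemma base_change_small:
  assumes ksmall: "|K| <o \<mu>" and AB: "A \<subseteq> B" "B \<subseteq> Dom U" and small: "|B| <o \<mu>" "|X| <o \<mu>"
    and \<pi>: "\<pi> \<subseteq> pfms L X A"
  shows "\<exists>a Y I J b. str_witness L U \<mu> X \<pi> B \<kappa> a Y I J b"
proof -
  obtain n P s p where nb: "\<And>i. i \<in> K \<Longrightarrow> nbhd i (n i) (P i) (s i) (p i)" using ex_nbhd by metis
  have P: "dfn L U (tvars (n i) (Y i) (A \<union> a ` X)) (P i)" and sinc: "increasing (fst (W i)) (n i) (s i)"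
    and Ps: "P i (tup (W i) (s i))" and Pt: "\<And>t. increasing (fst (W i)) (n i) t \<Longrightarrow>
      (\<And>k. k < n i \<Longrightarrow> t k \<noteq> ctr) \<Longrightarrow> \<not> P i (tup (W i) t)" and p: "p i < n i" and sp: "s i (p i) = ctr"
    if "i \<in> K" for i
    using nb[OF that] unfolding nbhd_def by simp_all
  have exh: "\<exists>h. smap (F \<union> pts (n i) (p i)) (fst (W i)) h \<and>
      (\<forall>k < n i. h (of_int (int k - int (p i))) = s i k) \<and> (\<forall>q \<in> F. q \<noteq> 0 \<longrightarrow> h q \<noteq> ctr)"
    if "i \<in> K" "finite F" "F \<subseteq> {-1<..<1}" for i F
    using nb[OF that(1)] that(2,3) unfolding nbhd_def by blast
  define fin where "fin = (\<lambda>i T Q. finite T \<and> T \<subseteq> tvars (n i) (Y i) (A \<union> a ` X) \<and> dfn L U T Q \<and>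
      (\<forall>v. v ` tvars (n i) (Y i) (A \<union> a ` X) \<subseteq> Dom U \<longrightarrow> P i v = Q v))"
  have "\<exists>T Q. fin i T Q" if iK: "i \<in> K" for i
  proof -
    obtain T Q where "finite T" "T \<subseteq> tvars (n i) (Y i) (A \<union> a ` X)" "dfn L U T Q"
      "\<And>v. v ` tvars (n i) (Y i) (A \<union> a ` X) \<subseteq> Dom U \<Longrightarrow> P i v = Q v" using P[OF iK] by (rule dfn_finite) blast
    then show ?thesis unfolding fin_def by (intro exI[of _ T] exI[of _ Q]) simp
  qed
  then obtain T R where TR: "\<And>i. i \<in> K \<Longrightarrow> fin i (T i) (R i)" by metis
  have T: "finite (T i)" "T i \<subseteq> tvars (n i) (Y i) (A \<union> a ` X)" "dfn L U (T i) (R i)"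
    "\<And>v. v ` tvars (n i) (Y i) (A \<union> a ` X) \<subseteq> Dom U \<Longrightarrow> P i v = R i v" if "i \<in> K" for i
    using TR[OF that] unfolding fin_def by simp_all
  define Y' where "Y' = (\<lambda>i. {y. \<exists>k. Inl (k, y) \<in> T i})"
  have Y'fin: "finite (Y' i)" if "i \<in> K" for i
  proof -
    have "Y' i \<subseteq> (\<lambda>x. case x of Inl (k, y) \<Rightarrow> y | Inr _ \<Rightarrow> undefined) ` T i" unfolding Y'_def by force
    then show ?thesis using T(1)[OF that] finite_surj by blast
  qed
  have Y'Y: "Y' i \<subseteq> Y i" if "i \<in> K" for i using T(2)[OF that] unfolding Y'_def by auto
  have sF: "s i k \<in> Field (fst (W i))" if "i \<in> K" "k < n i" for i k
    using sinc[OF that(1)] that(2) unfolding increasing_def by blast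
  have WD: "snd (W i) u y \<in> Dom U" if "i \<in> K" "u \<in> Field (fst (W i))" "y \<in> Y' i" for i u y
    using seqs(3)[OF that(1)] that(2,3) Y'Y[OF that(1)] unfolding is_seq_def tuples_def by blast
  define ev where "ev = (\<lambda>(i, k, y). snd (W i) (s i k) y)"
  define EV where "EV = {(i, k, y). i \<in> K \<and> k < n i \<and> k \<noteq> p i \<and> y \<in> Y' i}"
  define A' where "A' = A \<union> ev ` EV"
  have EVs: "|EV| <o \<mu>"
  proof -
    have "EV \<subseteq> (\<Union>i \<in> K. (\<lambda>(k, y). (i, k, y)) ` ({..<n i} \<times> Y' i))" unfolding EV_def by force
    moreover have "|\<Union>i \<in> K. (\<lambda>(k, y). (i, k, y)) ` ({..<n i} \<times> Y' i)| <o \<mu>"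
    proof (rule small_UN_countable[OF ksmall])
      fix i assume "i \<in> K"
      then show "|(\<lambda>(k, y). (i, k, y)) ` ({..<n i} \<times> Y' i)| \<le>o |UNIV :: nat set|"
        using Y'fin by (intro finite_ordLeq_nat finite_imageI finite_cartesian_product) auto
    qed
    ultimately show ?thesis using small_subset by blast
  qed
  have evD: "ev ` EV \<subseteq> Dom U" using WD sF by (auto simp: ev_def EV_def)
  have A'D: "A' \<subseteq> Dom U" using A_dom evD by (simp add: A'_def)
  have A's: "|A'| <o \<mu>" unfolding A'_def
    using small_subset[OF small(1) AB(1)] EVs by (intro small_Un small_image)
  have arr_small: "|arr K Y' (\<lambda>_. UNIV) :: ('u, 'c, 'k, rat) vr set| <o \<mu>"
  proof -
    have "arr K Y' (\<lambda>_. UNIV) \<subseteq> (\<Union>i \<in> K. (\<lambda>(q, y). Arr i q y) ` (UNIV \<times> Y' i) :: ('u, 'c, 'k, rat) vr set)"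
      unfolding arr_def by force
    moreover have "|\<Union>i \<in> K. (\<lambda>(q, y). Arr i q y) ` (UNIV \<times> Y' i) :: ('u, 'c, 'k, rat) vr set| <o \<mu>"
    proof (rule small_UN_countable[OF ksmall])
      fix i assume "i \<in> K"
      then have "countable ((\<lambda>(q, y). Arr i q y) ` (UNIV \<times> Y' i) :: ('u, 'c, 'k, rat) vr set)"
        using countable_finite[OF Y'fin] by (intro countable_image countable_SIGMA) auto
      then obtain g :: "_ \<Rightarrow> nat" where "inj_on g ((\<lambda>(q, y). Arr i q y) ` (UNIV \<times> Y' i) :: ('u, 'c, 'k, rat) vr set)"
        unfolding countable_def by blast
      then show "|(\<lambda>(q, y). Arr i q y) ` (UNIV \<times> Y' i) :: ('u, 'c, 'k, rat) vr set| \<le>o |UNIV :: nat set|"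
        by (rule card_of_ordLeqI) simp
    qed
    ultimately show ?thesis using small_subset by blast
  qed
  interpret ar: array_structure L U \<mu> K Y' by unfold_locales (rule arr_small)
  define xv where "xv = (\<lambda>c. SOME x. x \<in> X \<and> a x = c)"
  have xv: "xv c \<in> X" "a (xv c) = c" if "c \<in> a ` X" for c
  proof -
    have "\<exists>x. x \<in> X \<and> a x = c" using that by blast
    from someI_ex[OF this] show "xv c \<in> X" "a (xv c) = c" unfolding xv_def by blast+
  qed
  \<comment> \<open>The centre goes to position 0 of the array, other points of \<open>s i\<close>
    become parameters in \<open>A'\<close>, and parameters outside \<open>A\<close> become
    coordinates of the tuple.\<close>
  define mi :: "'k \<Rightarrow> nat \<times> 'c + 'u \<Rightarrow> ('u, 'c, 'k, rat) vr" where
    "mi = (\<lambda>i x. case x of Inl (k, y) \<Rightarrow> if k = p i then Arr i 0 y else Par (snd (W i) (s i k) y) |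
      Inr c \<Rightarrow> if c \<in> A then Par c else Xv (xv c))"
  define Q where "Q = (\<lambda>i v. R i (v \<circ> mi i))"
  have miT: "mi i ` T i \<subseteq> Par ` A' \<union> Xv ` X \<union> {Arr i 0 y | y. y \<in> Y' i}" if i: "i \<in> K" for i
  proof (rule image_subsetI)
    fix x assume x: "x \<in> T i"
    then have xt: "x \<in> tvars (n i) (Y i) (A \<union> a ` X)" using T(2)[OF i] by blast
    show "mi i x \<in> Par ` A' \<union> Xv ` X \<union> {Arr i 0 y | y. y \<in> Y' i}"
    proof (cases x)
      case (Inl ky)
      then obtain k y where ky: "ky = (k, y)" "k < n i" using xt by auto
      then have y: "y \<in> Y' i" using x Inl by (auto simp: Y'_def)
      show ?thesis
      proof (cases "k = p i")
        case False
        then have "(i, k, y) \<in> EV" using i ky y by (simp add: EV_def)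
        then have "ev (i, k, y) \<in> A'" unfolding A'_def by blast
        then show ?thesis using False Inl ky by (simp add: mi_def ev_def)
      qed (use Inl ky y in \<open>simp add: mi_def\<close>)
    next
      case (Inr c)
      then have "c \<in> A \<union> a ` X" using xt by blast
      then show ?thesis using Inr xv by (auto simp: mi_def A'_def)
    qed
  qed
  have dQ: "dfn L U (Par ` A' \<union> Xv ` X \<union> {Arr i 0 y | y. y \<in> Y' i}) (Q i)" if i: "i \<in> K" for i
    unfolding Q_def by (rule dfn_subst'[OF T(3)[OF i] miT[OF i]])
  have Qv: "Q i (asg a E) = P i (tup (W i) ((s i)(p i := c)))"
    if i: "i \<in> K" and E: "E i 0 = snd (W i) c" and c: "increasing (fst (W i)) (n i) ((s i)(p i := c))" for i E c
  proof -
    have dom: "tup (W i) ((s i)(p i := c)) ` tvars (n i) (Y i) (A \<union> a ` X) \<subseteq> Dom U"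
      by (rule tup_dom[OF seqs(3)[OF i] Aa_dom c])
    have "R i (tup (W i) ((s i)(p i := c))) = R i (asg a E \<circ> mi i)"
    proof (rule dfn_cong[OF T(3)[OF i] subset_trans[OF image_mono[OF T(2)[OF i]] dom]])
      fix x assume "x \<in> T i"
      then have xt: "x \<in> tvars (n i) (Y i) (A \<union> a ` X)" using T(2)[OF i] by blast
      show "tup (W i) ((s i)(p i := c)) x = (asg a E \<circ> mi i) x"
      proof (cases x)
        case (Inl ky)
        then show ?thesis using E by (cases ky) (auto simp: mi_def)
      next
        case (Inr c)
        then have "c \<in> A \<union> a ` X" using xt by blast
        then show ?thesis using Inr xv by (auto simp: mi_def)
      qed
    qed
    then show ?thesis unfolding Q_def using T(4)[OF i dom] by simp
  qed
  \<comment> \<open>The second kind of predicate evaluates \<open>Q i\<close> with the point at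
    position 1 in place of the centre.\<close>
  define \<Phi>2 where "\<Phi>2 = Q ` K \<union> (\<lambda>i v. \<not> Q i (v \<circ> ren (\<lambda>_ _. 1))) ` K"
  obtain D0 where D0: "ar.rmi UNIV (Par ` A') a D0" "ar.rmi (- {0}) (Par ` A' \<union> Xv ` X) a D0"
    "\<And>P. P \<in> \<Phi>2 \<Longrightarrow> P (asg a D0)"
  proof (rule ar.array_compactness[of A' X a \<Phi>2])
    show "A' \<subseteq> Dom U" "|A'| <o \<mu>" "|X| <o \<mu>" "a ` X \<subseteq> Dom U" using A'D A's small(2) aX_dom by auto
    show "dfn L U (Par ` A' \<union> Xv ` X \<union> ar.At UNIV) P" if "P \<in> \<Phi>2" for P
    proof -
      have sub: "Par ` A' \<union> Xv ` X \<union> {Arr i 0 y | y. y \<in> Y' i} \<subseteq> Par ` A' \<union> Xv ` X \<union> ar.At UNIV" if "i \<in> K" for i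
        using that by auto
      have rsub: "ren (\<lambda>_ _. 1) ` (Par ` A' \<union> Xv ` X \<union> ar.At UNIV) \<subseteq> Par ` A' \<union> Xv ` X \<union> ar.At UNIV"
        by (rule ren_Un_arr) auto
      from that consider i where "i \<in> K" "P = Q i" | i where "i \<in> K" "P = (\<lambda>v. \<not> Q i (v \<circ> ren (\<lambda>_ _. 1)))"
        unfolding \<Phi>2_def by blast
      then show ?thesis
      proof cases
        case 1
        then show ?thesis using dfn_mono[OF dQ sub] by simp
      next
        case 2
        show ?thesis unfolding 2(2) by (rule dfn_Not[OF dfn_subst'[OF dfn_mono[OF dQ[OF 2(1)] sub[OF 2(1)]] rsub]])
      qed
    qed
    fix R0 :: "rat set" assume fR0: "finite R0"
    \<comment> \<open>Position 1 is added because \<open>\<Phi>2\<close> refers to it.\<close>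
    let ?Fs = "squash ` insert 1 R0"
    have "finite ?Fs" "?Fs \<subseteq> {-1<..<1}" using fR0 squash_range by auto
    then obtain h where h: "\<And>i. i \<in> K \<Longrightarrow> smap (?Fs \<union> pts (n i) (p i)) (fst (W i)) (h i)"
      "\<And>i k. i \<in> K \<Longrightarrow> k < n i \<Longrightarrow> h i (of_int (int k - int (p i))) = s i k"
      "\<And>i q. i \<in> K \<Longrightarrow> q \<in> ?Fs \<Longrightarrow> q \<noteq> 0 \<Longrightarrow> h i q \<noteq> ctr"
      using exh[of _ ?Fs] by metis
    \<comment> \<open>Positions outside the sample receive the centre as a default, which keeps the
      values in the domain.\<close>
    define H where "H = (\<lambda>i q. if q = 0 \<or> q \<in> insert 1 R0 then h i (squash q) else ctr)"
    define E where "E = (\<lambda>i q. snd (W i) (H i q))"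
    have h0: "h i 0 = ctr" if "i \<in> K" for i using h(2)[OF that p[OF that]] sp[OF that] by simp
    have HF: "H i q \<in> Field (fst (W i))" if i: "i \<in> K" for i q
    proof (cases "q \<noteq> 0 \<and> q \<in> insert 1 R0")
      case True
      then show ?thesis using h(1)[OF i] unfolding smap_def H_def by auto
    next
      case False
      then have "H i q = ctr" using h0[OF i] by (auto simp: H_def)
      then show ?thesis by (simp add: Field_W)
    qed
    have Edom: "asg a E ` ar.At UNIV \<subseteq> Dom U" using WD HF by (auto simp: arr_def E_def)
    \<comment> \<open>Both kinds of indiscernibility at once: either \<open>S\<close> is empty or
      the centre is avoided. The points added in \<open>A'\<close> sit at nonzero integers of the
      sequences; a move inside the free interval that fixes these integers turns indiscernibility
      over \<open>A\<close> into indiscernibility over \<open>A'\<close>.\<close>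
    have key: "tpeq L U (Par ` A' \<union> S \<union> ar.Ar F) (asg a E) (asg a (\<lambda>i q. E i (f i q)))"
      if S: "S \<subseteq> Xv ` X" and FR: "\<And>i. i \<in> K \<Longrightarrow> F i \<subseteq> R0" and io: "ar.into R0 F f"
        and case_V: "S = {} \<or> (\<forall>i \<in> K. 0 \<notin> F i \<and> 0 \<notin> f i ` F i)" for S F f
    proof -
      \<comment> \<open>\<open>f\<close> transported to the free interval, and the identity at the
        integers outside it.\<close>
      define fh where "fh = (\<lambda>i q. if -1 < q \<and> q < 1 then squash (f i (inv squash q)) else q)"
      define G where "G = (\<lambda>i. squash ` F i \<union> (pts (n i) (p i) - {0}))"
      have fhs: "fh i (squash q) = squash (f i q)" for i q
        using squash_range[of q] inj_squash by (simp add: fh_def)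
      have fhp: "fh i q = q" if "q \<in> pts (n i) (p i) - {0}" for i q
        using pts_outside[of q "n i" "p i"] that by (auto simp: fh_def)
      have fR: "f i q \<in> R0" if "i \<in> K" "q \<in> F i" for i q using io that unfolding ar.into_def by blast
      have G1: "G i \<subseteq> ?Fs \<union> pts (n i) (p i)" if "i \<in> K" for i using FR[OF that] by (auto simp: G_def)
      have G2: "fh i q \<in> ?Fs \<union> pts (n i) (p i)" if "i \<in> K" "q \<in> G i" for i q
        using that fhs fhp fR by (auto simp: G_def)
      have Gmono: "fh i q < fh i q'" if i: "i \<in> K" and q: "q \<in> G i" "q' \<in> G i" "q < q'" for i q q'
      proof -
        have cl: "(\<exists>r \<in> F i. x = squash r \<and> fh i x = squash (f i r)) \<or> ((x \<le> -1 \<or> 1 \<le> x) \<and> fh i x = x)"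
          if "x \<in> G i" for x
          using that fhs fhp pts_outside unfolding G_def by blast
        have sr: "-1 < squash r" "squash r < 1" for r using squash_range[of r] by auto
        from cl[OF q(1)] cl[OF q(2)] show ?thesis
        proof (elim disjE bexE conjE)
          fix r r' assume r: "r \<in> F i" "r' \<in> F i" "q = squash r" "q' = squash r'" "fh i q = squash (f i r)"
            "fh i q' = squash (f i r')"
          then have "r < r'" using q(3) squash_less_iff by simp
          then have "f i r < f i r'" using io i r unfolding ar.into_def strict_mono_on_def by blast
          then show ?thesis using r squash_less_iff by simp
        qed (use q(3) sr in \<open>(metis less_le_trans less_trans le_less_trans not_less order.strict_trans1)+\<close>)
      qed
      have sm1: "smap (G i) (fst (W i)) (h i)" if "i \<in> K" for i
        by (rule smap_subset[OF h(1)[OF that] G1[OF that]])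
      have sm2: "smap (G i) (fst (W i)) (\<lambda>q. h i (fh i q))" if "i \<in> K" for i
        by (rule smap_comp[OF h(1)[OF that] G2[OF that] Gmono[OF that]])
      let ?w1 = "asg a (\<lambda>i q. snd (W i) (h i q))" and ?w2 = "asg a (\<lambda>i q. snd (W i) (h i (fh i q)))"
      \<comment> \<open>For empty \<open>S\<close> the full sequences \<open>W\<close> are used,
        otherwise the sequences \<open>V\<close> without centre, which are mutually indiscernible
        also over \<open>a\<close>.\<close>
      have base: "tpeq L U (Par ` A \<union> S \<union> arr K Y G) ?w1 ?w2"
      proof (cases "S = {}")
        case True
        have "tpeq L U (Par ` A \<union> Xv ` {} \<union> arr K Y G) ?w1 ?w2"
          using wit seqs(3) A_dom sm1 sm2 unfolding str_witness_def by (intro mutual_tpeq) auto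
        then show ?thesis using True by simp
      next
        case False
        then have n0: "0 \<notin> F i \<and> 0 \<notin> f i ` F i" if "i \<in> K" for i using case_V that by blast
        have sq0: "squash r = 0 \<longleftrightarrow> r = 0" for r using inj_squash squash_0 by (metis injD)
        have ctr1: "h i q \<noteq> ctr" if i: "i \<in> K" and q: "q \<in> ?Fs \<union> pts (n i) (p i)" "q \<noteq> 0" for i q
        proof (cases "q \<in> ?Fs")
          case False
          then obtain k where k: "k < n i" "q = of_int (int k - int (p i))" using q by (auto simp: pts_def)
          then have "k \<noteq> p i" using q by auto
          then have "s i k \<noteq> s i (p i)" using sinc[OF i] k(1) p[OF i] unfolding increasing_def
            by (metis linorder_neqE_nat)
          then show ?thesis using h(2)[OF i k(1)] k(2) sp[OF i] by simp
        qed (use h(3)[OF i] q in blast)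
        have G0: "q \<noteq> 0" if "i \<in> K" "q \<in> G i" for i q using that n0[OF that(1)] sq0 by (auto simp: G_def)
        have fG0: "fh i q \<noteq> 0" if "i \<in> K" "q \<in> G i" for i q
          using that n0[OF that(1)] sq0 fhs fhp by (auto simp: G_def)
        have c1: "h i q \<noteq> ctr" "h i (fh i q) \<noteq> ctr" if "i \<in> K" "q \<in> G i" for i q
          using ctr1[OF that(1)] G1[OF that(1)] G2[OF that] G0[OF that] fG0[OF that] that(2) by blast+
        have "tpeq L U (Par ` (A \<union> a ` X) \<union> Xv ` X \<union> arr K Y G) (asg a (\<lambda>i q. snd (V i) (une (h i q))))
          (asg a (\<lambda>i q. snd (V i) (une (h i (fh i q)))))"
          using wit seqs(4) Aa_dom smap_une[OF sm1] smap_une[OF sm2] c1 unfolding str_witness_def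
          by (intro mutual_tpeq) auto
        then have "tpeq L U (Par ` (A \<union> a ` X) \<union> Xv ` X \<union> arr K Y G) ?w1 ?w2"
        proof (rule tpeq_cong)
          fix x assume x: "x \<in> Par ` (A \<union> a ` X) \<union> Xv ` X \<union> arr K Y G"
          show "asg a (\<lambda>i q. snd (V i) (une (h i q))) x = ?w1 x"
            using x c1 snd_W by (cases x) auto
          show "asg a (\<lambda>i q. snd (V i) (une (h i (fh i q)))) x = ?w2 x"
            using x c1 snd_W by (cases x) auto
        qed
        then show ?thesis by (rule tpeq_mono) (use S in auto)
      qed
      define ec where "ec = (\<lambda>c. SOME t. t \<in> EV \<and> ev t = c)"
      have ec: "ec c \<in> EV" "ev (ec c) = c" if "c \<in> ev ` EV" for c
      proof -
        have "\<exists>t. t \<in> EV \<and> ev t = c" using that by blast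
        from someI_ex[OF this] show "ec c \<in> EV" "ev (ec c) = c" unfolding ec_def by blast+
      qed
      \<comment> \<open>A parameter in \<open>A'\<close> outside \<open>A\<close> is read at its
        integer position.\<close>
      define mm :: "('u, 'c, 'k, rat) vr \<Rightarrow> ('u, 'c, 'k, rat) vr" where
        "mm = (\<lambda>x. case x of Par c \<Rightarrow> if c \<in> A then Par c else
           (case ec c of (j, k, y) \<Rightarrow> Arr j (of_int (int k - int (p j))) y) | Xv x \<Rightarrow> Xv x |
           Arr i q y \<Rightarrow> Arr i (squash q) y)"
      have mmP: "mm x \<in> Par ` A \<union> S \<union> arr K Y G \<and> ?w1 (mm x) = asg a E x \<and>
          ?w2 (mm x) = asg a (\<lambda>i q. E i (f i q)) x" if x: "x \<in> Par ` A' \<union> S \<union> ar.Ar F" for x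
      proof (cases x)
        case (Par c)
        show ?thesis
        proof (cases "c \<in> A")
          case False
          have "c \<in> A'" using x Par S by auto
          then have c: "c \<in> ev ` EV" using False by (simp add: A'_def)
          obtain j k y where jk: "ec c = (j, k, y)" by (cases "ec c") auto
          then have J: "j \<in> K" "k < n j" "k \<noteq> p j" "y \<in> Y' j" "snd (W j) (s j k) y = c"
            using ec[OF c] by (auto simp: EV_def ev_def)
          let ?q = "of_int (int k - int (p j)) :: rat"
          have q: "?q \<in> pts (n j) (p j) - {0}" using J by (auto simp: pts_def)
          then have "Arr j ?q y \<in> arr K Y G" using J Y'Y[OF J(1)] by (auto simp: G_def)
          then show ?thesis using Par False jk h(2)[OF J(1,2)] fhp[OF q] J(5) by (simp add: mm_def)
        qed (use Par in \<open>simp add: mm_def\<close>)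
      next
        case (Xv z)
        then show ?thesis using x by (auto simp: mm_def)
      next
        case (Arr i q y)
        then have i: "i \<in> K" "q \<in> F i" "y \<in> Y' i" using x S by auto
        have "H i q = h i (squash q)" "H i (f i q) = h i (squash (f i q))"
          using FR[OF i(1)] fR[OF i(1,2)] i(2) by (auto simp: H_def)
        moreover have "squash q \<in> G i" using i by (simp add: G_def)
        ultimately show ?thesis using Arr i Y'Y[OF i(1)] fhs by (auto simp: mm_def E_def)
      qed
      have "tpeq L U (Par ` A' \<union> S \<union> ar.Ar F) (?w1 \<circ> mm) (?w2 \<circ> mm)"
        using base by (rule tpeq_subst) (use mmP in blast)
      then show ?thesis by (rule tpeq_cong) (use mmP in \<open>simp_all del: Un_iff\<close>)
    qed
    have "ar.rmi R0 (Par ` A') a E"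
      unfolding ar.rmi_def
    proof (intro allI impI, elim conjE)
      fix F f assume "\<forall>i \<in> K. F i \<subseteq> R0" "ar.into R0 F f"
      then show "tpeq L U (Par ` A' \<union> ar.Ar F) (asg a E) (asg a (\<lambda>i q. E i (f i q)))"
        using key[of "{}" F f] by simp
    qed
    moreover have "ar.rmi (R0 - {0}) (Par ` A' \<union> Xv ` X) a E"
      unfolding ar.rmi_def
    proof (intro allI impI, elim conjE)
      fix F f assume F: "\<forall>i \<in> K. F i \<subseteq> R0 - {0}" and f: "ar.into (R0 - {0}) F f"
      have "F i \<subseteq> R0" if "i \<in> K" for i using F that by blast
      moreover have "ar.into R0 F f" using f unfolding ar.into_def by blast
      moreover have "\<forall>i \<in> K. 0 \<notin> F i \<and> 0 \<notin> f i ` F i" using F f unfolding ar.into_def by blast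
      ultimately show "tpeq L U (Par ` A' \<union> Xv ` X \<union> ar.Ar F) (asg a E) (asg a (\<lambda>i q. E i (f i q)))"
        using key[of "Xv ` X" F f] by simp
    qed
    moreover have "\<forall>P \<in> \<Phi>2. P (asg a E)"
    proof
      fix P' assume "P' \<in> \<Phi>2"
      then consider i where "i \<in> K" "P' = Q i" | i where "i \<in> K" "P' = (\<lambda>v. \<not> Q i (v \<circ> ren (\<lambda>_ _. 1)))"
        unfolding \<Phi>2_def by blast
      then show "P' (asg a E)"
      proof cases
        case 1
        have e: "(s i)(p i := ctr) = s i" using sp[OF 1(1)] by auto
        have "Q i (asg a E) = P i (tup (W i) ((s i)(p i := ctr)))"
          using sinc[OF 1(1)] h0[OF 1(1)] by (intro Qv[OF 1(1)]) (auto simp: E_def H_def e)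
        then show ?thesis using 1 Ps[OF 1(1)] by (simp add: e)
      next
        case 2
        let ?c = "h i (squash 1)"
        have c: "?c \<noteq> ctr" using h(3)[OF 2(1), of "squash 1"] by (simp add: squash_def)
        have inc: "increasing (fst (W i)) (n i) ((s i)(p i := ?c))"
          using squash_range[of 1] by (intro increasing_replace[OF h(1)[OF 2(1)] h(2)[OF 2(1)]] p[OF 2(1)]) auto
        have "\<not> P i (tup (W i) ((s i)(p i := ?c)))"
        proof (rule Pt[OF 2(1) inc])
          fix k assume k: "k < n i"
          show "((s i)(p i := ?c)) k \<noteq> ctr"
          proof (cases "k = p i")
            case False
            then have "s i k \<noteq> s i (p i)" using sinc[OF 2(1)] k p[OF 2(1)] unfolding increasing_def
              by (metis linorder_neqE_nat)
            then show ?thesis using False sp[OF 2(1)] by simp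
          qed (use c in simp)
        qed
        moreover have "Q i (asg a (\<lambda>j q. E j 1)) = P i (tup (W i) ((s i)(p i := ?c)))"
          using inc by (intro Qv[OF 2(1)]) (auto simp: E_def H_def)
        ultimately show ?thesis unfolding 2(2) asg_ren by simp
      qed
    qed
    ultimately show "\<exists>E. ar.rmi R0 (Par ` A') a E \<and> ar.rmi (R0 - {0}) (Par ` A' \<union> Xv ` X) a E \<and>
      asg a E ` ar.At UNIV \<subseteq> Dom U \<and> (\<forall>P \<in> \<Phi>2. P (asg a E))"
      using Edom by (intro exI[of _ E] conjI)
  qed blast
  \<comment> \<open>The base has to contain \<open>A'\<close>, since \<open>Q i\<close> has
    parameters there.\<close>
  let ?B = "B \<union> A'"
  have BD: "?B \<subseteq> Dom U" and Bs: "|?B| <o \<mu>" using AB(2) A'D small(1) A's by (auto intro: small_Un)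
  obtain a' D where D: "tpeq L U (Par ` A' \<union> Xv ` X \<union> ar.At UNIV) (asg a D0) (asg a' D)"
    "ar.rmi UNIV (Par ` ?B) a' D" "ar.rmi (- {0}) (Par ` ?B \<union> Xv ` X) a' D"
    by (rule ar.base_change[OF _ BD Bs small(2) D0(1,2)]) auto
  \<comment> \<open>The type of the tuple over \<open>A'\<close> is kept, and the parameters of
    \<open>\<pi>\<close> lie in \<open>A\<close>.\<close>
  have real: "realizes U X a' \<pi>"
    unfolding realizes_def
  proof
    show "a' \<in> tuples U X" using tpeq_dom(2)[OF D(1)] by (simp add: tuples_def image_subset_iff ball_Un)
    show "\<forall>\<phi> \<in> \<pi>. psat U a' \<phi>"
    proof
      fix \<phi> assume \<phi>: "\<phi> \<in> \<pi>"
      let ?g = "case_sum Xv Par :: 'c + 'u \<Rightarrow> ('u, 'c, 'k, rat) vr"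
      have "wf_fm L \<phi>" "fv \<phi> \<subseteq> Inl ` X \<union> Inr ` A" using \<pi> \<phi> by (auto simp: pfms_def)
      then have "?g ` fv \<phi> \<subseteq> Par ` A' \<union> Xv ` X \<union> ar.At UNIV" by (fastforce simp: A'_def)
      then have "dfn L U (Par ` A' \<union> Xv ` X \<union> ar.At UNIV) (\<lambda>v. sat U (v \<circ> ?g) \<phi>)"
        by (rule dfn_formula[OF \<open>wf_fm L \<phi>\<close>])
      from tpeqD[OF D(1) this] have "sat U (asg a D0 \<circ> ?g) \<phi> = sat U (asg a' D \<circ> ?g) \<phi>" .
      moreover have "asg v E \<circ> ?g = case_sum v id" for v and E :: "'k \<Rightarrow> rat \<Rightarrow> 'c \<Rightarrow> 'u"
        by (auto simp: fun_eq_iff split: sum.split)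
      moreover have "psat U a \<phi>" using wit \<phi> unfolding str_witness_def realizes_def by blast
      ultimately show "psat U a' \<phi>" by (simp add: psat_def)
    qed
  qed
  have QD: "Q i (asg a' D)" "\<not> Q i (asg a' (\<lambda>j q. D j 1))" if i: "i \<in> K" for i
  proof -
    have sub: "Par ` A' \<union> Xv ` X \<union> {Arr i 0 y | y. y \<in> Y' i} \<subseteq> Par ` A' \<union> Xv ` X \<union> ar.At UNIV"
      using i by auto
    have rsub: "ren (\<lambda>_ _. 1) ` (Par ` A' \<union> Xv ` X \<union> ar.At UNIV) \<subseteq> Par ` A' \<union> Xv ` X \<union> ar.At UNIV"
      by (rule ren_Un_arr) auto
    have d: "dfn L U (Par ` A' \<union> Xv ` X \<union> ar.At UNIV) (Q i)" by (rule dfn_mono[OF dQ[OF i] sub])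
    have "Q i \<in> \<Phi>2" "(\<lambda>v. \<not> Q i (v \<circ> ren (\<lambda>_ _. 1))) \<in> \<Phi>2" using i unfolding \<Phi>2_def by blast+
    from D0(3)[OF this(1)] D0(3)[OF this(2)]
    show "Q i (asg a' D)" "\<not> Q i (asg a' (\<lambda>j q. D j 1))"
      using tpeqD[OF D(1) d] tpeqD[OF D(1) dfn_subst'[OF d rsub]] unfolding asg_ren by simp_all
  qed
  have dQB: "dfn L U (Par ` ?B \<union> Xv ` X \<union> {Arr i 0 y | y. y \<in> Y' i}) (Q i)" if "i \<in> K" for i
    by (rule dfn_mono[OF dQ[OF that]]) auto
  have "\<exists>I J b. str_witness L U \<mu> X \<pi> ?B \<kappa> a' Y' I J b"
    by (rule ar.array_str_witness[OF refl Y'fin BD D(2,3) real dQB QD])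
  then obtain I' J' b' where "str_witness L U \<mu> X \<pi> ?B \<kappa> a' Y' I' J' b'" by blast
  \<comment> \<open>The additional parameters \<open>A'\<close> return to the sequences as constant
    coordinates.\<close>
  from str_witness_restrict[OF _ BD Bs this, of B] show ?thesis by blast
qed

end

section \<open>Smallness of the index set\<close>

context saturated_structure
begin

lemma small_lists:
  assumes "|Z| <o \<mu>"
  shows "|lists Z| <o \<mu>"
proof -
  let ?Z = "Z <+> (UNIV :: nat set)"
  have inf: "\<not> finite ?Z" by (metis finite_Plus_iff infinite_UNIV_nat)
  have len: "|{xs \<in> lists Z. length xs = n}| \<le>o |?Z|" for n
  proof (induction n)
    case 0
    have "{xs \<in> lists Z. length xs = 0} = {[]}" by auto
    then show ?case using inf by (metis card_of_singl_ordLeq finite.emptyI)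
  next
    case (Suc n)
    have e: "{xs \<in> lists Z. length xs = Suc n} = (\<lambda>(x, xs). x # xs) ` (Z \<times> {xs \<in> lists Z. length xs = n})"
      by (auto simp: length_Suc_conv image_iff)
    have "|{xs \<in> lists Z. length xs = Suc n}| \<le>o |Z \<times> {xs \<in> lists Z. length xs = n}|"
      unfolding e by (rule card_of_image)
    moreover have "|Z \<times> {xs \<in> lists Z. length xs = n}| \<le>o |?Z|"
      using inf by (intro card_of_Times_ordLeq_infinite_Field[OF _ card_of_Plus1 Suc card_of_Card_order])
        (simp only: Field_card_of not_False_eq_True)
    ultimately show ?case by (rule ordLeq_transitive)
  qed
  have e: "lists Z = (\<Union>n. {xs \<in> lists Z. length xs = n})" by auto
  have "|lists Z| \<le>o |?Z|"
    by (subst e, rule card_of_UNION_ordLeq_infinite[OF inf card_of_Plus2]) (use len in blast)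
  moreover have "|?Z| <o \<mu>" using assms nat_small by (rule small_Plus)
  ultimately show ?thesis by (rule ordLeq_ordLess_trans)
qed

lemma small_Times:
  assumes "|A| <o \<mu>" "|B| <o \<mu>"
  shows "|A \<times> B| <o \<mu>"
proof -
  let ?Z = "(A <+> B) <+> (UNIV :: nat set)"
  have inf: "\<not> finite ?Z" by (metis finite_Plus_iff infinite_UNIV_nat)
  have "|A| \<le>o |?Z|" "|B| \<le>o |?Z|"
    by (rule ordLeq_transitive[OF card_of_Plus1 card_of_Plus1],
        rule ordLeq_transitive[OF card_of_Plus2 card_of_Plus1])
  then have "|A \<times> B| \<le>o |?Z|"
    using inf by (intro card_of_Times_ordLeq_infinite_Field[OF _ _ _ card_of_Card_order])
      (simp_all only: Field_card_of not_False_eq_True)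
  moreover have "|?Z| <o \<mu>" using assms nat_small by (intro small_Plus)
  ultimately show ?thesis by (rule ordLeq_ordLess_trans)
qed

end

context witness_structure
begin

text \<open>There are fewer than \<open>\<mu>\<close> combinations of a formula with the coordinates
  of \<open>a\<close> that it uses. If each occurred for finitely many \<open>i\<close> only, the
  index set would be small; so one occurs infinitely often. For these \<open>i\<close> a free choice
  between \<open>s i\<close> and \<open>t i\<close> is possible over \<open>A\<close>, and the
  single tuple \<open>a\<close> then realizes every pattern of truth values, against NIP.\<close>

lemma index_small:
  assumes X: "|X| <o \<mu>"
  shows "|K| <o \<mu>"
proof (rule ccontr)
  assume big: "\<not> |K| <o \<mu>"
  define wf where "wf = (\<lambda>i (\<phi> :: ('f, 'r, nat) fm) g n s t. wf_fm L \<phi> \<and> g ` fv \<phi> \<subseteq> tvars n (Y i) (A \<union> a ` X) \<and>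
    increasing (fst (W i)) n s \<and> increasing (fst (W i)) n t \<and>
    sat U (tup (W i) s \<circ> g) \<phi> \<and> \<not> sat U (tup (W i) t \<circ> g) \<phi>)"
  have "\<exists>\<phi> g n s t. wf i \<phi> g n s t" if i: "i \<in> K" for i
  proof -
    obtain n P s t where P: "dfn L U (tvars n (Y i) (A \<union> a ` X)) P" "increasing (fst (W i)) n s" "P (tup (W i) s)"
      "\<forall>t. increasing (fst (W i)) n t \<and> (\<forall>k < n. t k \<noteq> ctr) \<longrightarrow> \<not> P (tup (W i) t)"
      "increasing (fst (W i)) n t" "\<forall>k < n. t k \<noteq> ctr"
      using witness_formula[OF i] by (elim exE conjE) (rule that)
    obtain \<phi> :: "('f, 'r, nat) fm" and g where \<phi>: "wf_fm L \<phi>" "g ` fv \<phi> \<subseteq> tvars n (Y i) (A \<union> a ` X)"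
      "\<And>v. v ` tvars n (Y i) (A \<union> a ` X) \<subseteq> Dom U \<Longrightarrow> P v \<longleftrightarrow> sat U (v \<circ> g) \<phi>" using P(1) unfolding dfn_def by blast
    have "\<not> P (tup (W i) t)" using P(4-6) by blast
    then have "wf i \<phi> g n s t" unfolding wf_def using P(2,3,5) \<phi>(1,2)
      \<phi>(3)[OF tup_dom[OF seqs(3)[OF i] Aa_dom P(2)]] \<phi>(3)[OF tup_dom[OF seqs(3)[OF i] Aa_dom P(5)]] by simp
    then show ?thesis by (intro exI)
  qed
  then obtain \<phi> :: "'k \<Rightarrow> ('f, 'r, nat) fm" and g n s t where
    wf: "\<And>i. i \<in> K \<Longrightarrow> wf i (\<phi> i) (g i) (n i) (s i) (t i)" by metis
  have d: "wf_fm L (\<phi> i)" "g i ` fv (\<phi> i) \<subseteq> tvars (n i) (Y i) (A \<union> a ` X)"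
    "increasing (fst (W i)) (n i) (s i)" "increasing (fst (W i)) (n i) (t i)"
    "sat U (tup (W i) (s i) \<circ> g i) (\<phi> i)" "\<not> sat U (tup (W i) (t i) \<circ> g i) (\<phi> i)" if "i \<in> K" for i
    using wf[OF that] unfolding wf_def by simp_all
  define xv where "xv = (\<lambda>c. SOME x. x \<in> X \<and> a x = c)"
  have xv: "xv c \<in> X" "a (xv c) = c" if "c \<in> a ` X" for c
  proof -
    have "\<exists>x. x \<in> X \<and> a x = c" using that by blast
    from someI_ex[OF this] show "xv c \<in> X" "a (xv c) = c" unfolding xv_def by blast+
  qed
  \<comment> \<open>The class of \<open>i\<close> fixes the formula and, for each free variable, the
    coordinate of the tuple it stands for, if any. Parameters from \<open>A\<close> and points of
    the sequence may vary inside a class; they belong to the points that get shattered.\<close>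
  define xp where "xp = (\<lambda>i j. case g i j of Inl _ \<Rightarrow> None | Inr c \<Rightarrow> if c \<in> A then None else Some (xv c))"
  define cl where "cl = (\<lambda>i. (\<phi> i, map (xp i) (sorted_list_of_set (fv (\<phi> i)))))"
  have gA: "c \<in> A \<union> a ` X" if "i \<in> K" "j \<in> fv (\<phi> i)" "g i j = Inr c" for i j c
  proof -
    have "g i j \<in> tvars (n i) (Y i) (A \<union> a ` X)" using d(2)[OF that(1)] that(2) by blast
    then show ?thesis using that(3) by auto
  qed
  have cl: "cl i \<in> {\<phi>. wf_fm L \<phi>} \<times> lists (insert None (Some ` X))" if i: "i \<in> K" for i
  proof -
    have "xp i j \<in> insert None (Some ` X)" if "j \<in> fv (\<phi> i)" for j
      using gA[OF i that] xv(1) by (auto simp: xp_def split: sum.split)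
    then show ?thesis using d(1)[OF i] finite_fv[of "\<phi> i"] by (auto simp: cl_def in_lists_conv_set)
  qed
  have "|insert None (Some ` X)| <o \<mu>"
    using small_Un[OF small_finite[of "{None}"] small_image[OF X, of Some]] by simp
  then have "|{\<phi> :: ('f, 'r, nat) fm. wf_fm L \<phi>} \<times> lists (insert None (Some ` X))| <o \<mu>"
    by (intro small_Times formulas_small small_lists)
  then have cls: "|cl ` K| <o \<mu>" by (rule small_subset) (use cl in blast)
  have "\<exists>c. infinite {i \<in> K. cl i = c}"
  proof (rule ccontr)
    assume "\<not> ?thesis"
    then have "finite {i \<in> K. cl i = c}" for c by blast
    then have "|{i \<in> K. cl i = c}| \<le>o |UNIV :: nat set|" for c by (rule finite_ordLeq_nat)
    then have "|\<Union>c \<in> cl ` K. {i \<in> K. cl i = c}| <o \<mu>" by (intro small_UN_countable[OF cls])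
    moreover have "(\<Union>c \<in> cl ` K. {i \<in> K. cl i = c}) = K" by auto
    ultimately show False using big by simp
  qed
  then obtain c where c: "infinite {i \<in> K. cl i = c}" by blast
  define i0 where "i0 = (SOME i. i \<in> K \<and> cl i = c)"
  have "{i \<in> K. cl i = c} \<noteq> {}" using c by (rule infinite_imp_nonempty)
  then have "\<exists>i. i \<in> K \<and> cl i = c" by blast
  then have i0: "i0 \<in> K" "cl i0 = c" unfolding i0_def using someI_ex by (metis (mono_tags, lifting))+
  define \<psi> where "\<psi> = \<phi> i0"
  have same: "\<phi> i = \<psi>" "\<And>j. j \<in> fv \<psi> \<Longrightarrow> xp i j = xp i0 j" if "i \<in> K" "cl i = c" for i
  proof -
    have e: "cl i = cl i0" using that i0 by simp
    then show "\<phi> i = \<psi>" by (simp add: cl_def \<psi>_def)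
    then have "map (xp i) (sorted_list_of_set (fv \<psi>)) = map (xp i0) (sorted_list_of_set (fv \<psi>))"
      using e by (simp add: cl_def \<psi>_def)
    then show "xp i j = xp i0 j" if "j \<in> fv \<psi>" for j using that finite_fv[of \<psi>] by simp
  qed
  \<comment> \<open>The variables that stand for coordinates of the tuple: these are quantified in
    the shattering.\<close>
  define Z0 where "Z0 = {j \<in> fv \<psi>. xp i0 j \<noteq> None}"
  have wf\<psi>: "wf_fm L \<psi>" using d(1)[OF i0(1)] by (simp add: \<psi>_def)
  have "dfn L U (fv \<psi>) (\<lambda>v. sat U (v \<circ> id) \<psi>)" by (rule dfn_formula[OF wf\<psi>]) simp
  then obtain N where N: "nip_bound U (fv \<psi>) Z0 (\<lambda>v. sat U v \<psi>) N" using ex_nip_bound by (simp add: o_def) blast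
  obtain \<Lambda> where \<Lambda>: "finite \<Lambda>" "card \<Lambda> = N" "\<Lambda> \<subseteq> {i \<in> K. cl i = c}"
    using infinite_arbitrarily_large[OF c, of N] by blast
  have \<Lambda>K: "i \<in> K" "cl i = c" if "i \<in> \<Lambda>" for i using \<Lambda>(3) that by auto
  \<comment> \<open>Array positions are now the places in the tuples \<open>s i\<close> and
    \<open>t i\<close>.\<close>
  define Mp :: "'k \<Rightarrow> nat \<Rightarrow> ('u, 'c, 'k, nat) vr" where
    "Mp = (\<lambda>i j. case g i j of Inl (k, y) \<Rightarrow> Arr i k y | Inr c \<Rightarrow> if c \<in> A then Par c else Xv (xv c))"
  define Xs :: "('u, 'c, 'k, nat) vr set" where "Xs = (\<lambda>j. Xv (the (xp i0 j))) ` Z0"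
  have finXs: "finite Xs" using finite_fv[of \<psi>] by (simp add: Xs_def Z0_def)
  have MpZ: "Mp i j = Xv (the (xp i0 j))" if "i \<in> \<Lambda>" "j \<in> Z0" for i j
  proof -
    have "xp i j = xp i0 j" "xp i0 j \<noteq> None" using same(2)[OF \<Lambda>K[OF that(1)]] that(2) by (auto simp: Z0_def)
    then show ?thesis by (auto simp: Mp_def xp_def split: sum.splits if_splits)
  qed
  have MpN: "Mp i j \<in> Par ` A \<union> arr K Y (\<lambda>i. {..<n i})" if "i \<in> \<Lambda>" "j \<in> fv \<psi>" "j \<notin> Z0" for i j
  proof -
    have xn: "xp i j = None" using same(2)[OF \<Lambda>K[OF that(1)]] that(2,3) by (auto simp: Z0_def)
    have "g i j \<in> tvars (n i) (Y i) (A \<union> a ` X)"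
      using d(2)[OF \<Lambda>K(1)[OF that(1)]] same(1)[OF \<Lambda>K[OF that(1)]] that(2) by blast
    then show ?thesis using xn \<Lambda>K(1)[OF that(1)] by (auto simp: Mp_def xp_def split: if_splits)
  qed
  have Mpv: "asg a (\<lambda>i k. snd (W i) (r i k)) (Mp i j) = (tup (W i) (r i) \<circ> g i) j"
    if "i \<in> \<Lambda>" "j \<in> fv \<psi>" for i j r
    using gA[OF \<Lambda>K(1)[OF that(1)], of j] same(1)[OF \<Lambda>K[OF that(1)]] that(2) xv(2)
    by (auto simp: Mp_def split: sum.split)
  have "shatters U Z0 (\<lambda>v. sat U v \<psi>) (\<lambda>i. tup (W i) (t i) \<circ> g i) \<Lambda>"
    unfolding shatters_def
  proof (intro allI impI)
    fix T assume T: "T \<subseteq> \<Lambda>"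
    define r where "r = (\<lambda>i. if i \<in> T then s i else t i)"
    let ?\<Psi> = "\<lambda>v. \<exists>z. z ` Xs \<subseteq> Dom U \<and> (\<forall>i \<in> \<Lambda>. sat U (override_on v z Xs \<circ> Mp i) \<psi> = (i \<in> T))"
    let ?F = "\<lambda>i. {..<n i}"
    have sub: "Mp i ` fv \<psi> \<subseteq> Par ` A \<union> arr K Y ?F \<union> Xs" if "i \<in> \<Lambda>" for i
    proof (rule image_subsetI)
      fix j assume "j \<in> fv \<psi>"
      then show "Mp i j \<in> Par ` A \<union> arr K Y ?F \<union> Xs"
        using MpZ[OF that, of j] MpN[OF that, of j] by (cases "j \<in> Z0") (auto simp: Xs_def)
    qed
    have "dfn L U (Par ` A \<union> arr K Y ?F \<union> Xs) (\<lambda>v. sat U (v \<circ> Mp i) \<psi> = (i \<in> T))" if "i \<in> \<Lambda>" for i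
      using dfn_formula[OF wf\<psi> sub[OF that], of U] dfn_Not by (cases "i \<in> T") auto
    then have "dfn L U (Par ` A \<union> arr K Y ?F \<union> Xs) (\<lambda>v. \<forall>i \<in> \<Lambda>. sat U (v \<circ> Mp i) \<psi> = (i \<in> T))"
      by (intro dfn_Ball[OF \<Lambda>(1)])
    then have "dfn L U (Par ` A \<union> arr K Y ?F \<union> Xs - Xs) ?\<Psi>" by (rule dfn_Ex_finite[OF finXs])
    then have d\<Psi>: "dfn L U (Par ` A \<union> Xv ` {} \<union> arr K Y ?F) ?\<Psi>" by (rule dfn_mono) auto
    have sm: "smap {..<n i} (fst (W i)) u" if "increasing (fst (W i)) (n i) u" for i u
      using that unfolding smap_def increasing_def by auto
    \<comment> \<open>Each row takes \<open>s i\<close> or \<open>t i\<close>, independently of the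
      other rows.\<close>
    have eq: "tpeq L U (Par ` A \<union> Xv ` {} \<union> arr K Y ?F) (asg a (\<lambda>i k. snd (W i) (r i k)))
        (asg a (\<lambda>i k. snd (W i) (t i k)))"
      using wit seqs(3) A_dom d(3,4) sm unfolding str_witness_def by (intro mutual_tpeq) (auto simp: r_def)
    let ?w = "asg a (\<lambda>i k. snd (W i) (r i k)) :: ('u, 'c, 'k, nat) vr \<Rightarrow> 'u"
    have XsX: "Xs \<subseteq> Xv ` X"
    proof
      fix x assume "x \<in> Xs"
      then obtain j where j: "j \<in> Z0" "x = Xv (the (xp i0 j))" by (auto simp: Xs_def)
      obtain c where "g i0 j = Inr c" "c \<notin> A" "xp i0 j = Some (xv c)"
        using j(1) by (auto simp: Z0_def xp_def split: sum.splits if_splits)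
      moreover have "c \<in> A \<union> a ` X" using gA[OF i0(1), of j c] j(1) calculation(1) by (simp add: Z0_def \<psi>_def)
      ultimately show "x \<in> Xv ` X" using xv(1) j(2) by auto
    qed
    have "sat U (override_on ?w ?w Xs \<circ> Mp i) \<psi> = (i \<in> T)" if i: "i \<in> \<Lambda>" for i
    proof -
      have "sat U (override_on ?w ?w Xs \<circ> Mp i) \<psi> = sat U (tup (W i) (r i) \<circ> g i) \<psi>"
        using Mpv[OF i] by (intro sat_cong) (simp add: override_on_def)
      then show ?thesis using d(5,6)[OF \<Lambda>K(1)[OF i]] same(1)[OF \<Lambda>K[OF i]] by (simp add: r_def)
    qed
    moreover have "?w ` Xs \<subseteq> Dom U" using XsX aX_dom by fastforce
    ultimately have "?\<Psi> ?w" by (intro exI[of _ ?w] conjI ballI)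
    then have "?\<Psi> (asg a (\<lambda>i k. snd (W i) (t i k)))" using tpeqD[OF eq d\<Psi>] by simp
    then obtain z where z: "z ` Xs \<subseteq> Dom U" "\<forall>i \<in> \<Lambda>. sat U (override_on (asg a (\<lambda>i k. snd (W i) (t i k))) z Xs \<circ> Mp i) \<psi> = (i \<in> T)"
      by (elim exE conjE) (rule that)
    let ?z = "\<lambda>j. z (Xv (the (xp i0 j)))"
    have "sat U (override_on (tup (W i) (t i) \<circ> g i) ?z Z0) \<psi> = (i \<in> T)" if i: "i \<in> \<Lambda>" for i
    proof -
      have "sat U (override_on (tup (W i) (t i) \<circ> g i) ?z Z0) \<psi> =
        sat U (override_on (asg a (\<lambda>i k. snd (W i) (t i k))) z Xs \<circ> Mp i) \<psi>"
      proof (rule sat_cong)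
        fix j assume j: "j \<in> fv \<psi>"
        show "override_on (tup (W i) (t i) \<circ> g i) ?z Z0 j =
          (override_on (asg a (\<lambda>i k. snd (W i) (t i k))) z Xs \<circ> Mp i) j"
        proof (cases "j \<in> Z0")
          case True
          then show ?thesis using MpZ[OF i True] by (simp add: override_on_def Xs_def)
        next
          case False
          then have "Mp i j \<notin> Xs" using MpN[OF i j False] XsX by auto
          then show ?thesis using False Mpv[OF i j, of t] by (simp add: override_on_def)
        qed
      qed
      then show ?thesis using z(2) i by blast
    qed
    moreover have "?z ` Z0 \<subseteq> Dom U" using z(1) by (auto simp: Xs_def)
    ultimately show "\<exists>z. z ` Z0 \<subseteq> Dom U \<and>
        (\<forall>i \<in> \<Lambda>. sat U (override_on (tup (W i) (t i) \<circ> g i) z Z0) \<psi> = (i \<in> T))"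
      by (intro exI[of _ ?z] conjI ballI)
  qed
  moreover have "(tup (W i) (t i) \<circ> g i) ` fv \<psi> \<subseteq> Dom U" if i: "i \<in> \<Lambda>" for i
  proof -
    have "(tup (W i) (t i) \<circ> g i) ` fv \<psi> = tup (W i) (t i) ` g i ` fv \<psi>" by (simp only: image_comp)
    also have "\<dots> \<subseteq> tup (W i) (t i) ` tvars (n i) (Y i) (A \<union> a ` X)"
      using d(2)[OF \<Lambda>K(1)[OF i]] same(1)[OF \<Lambda>K[OF i]] by (intro image_mono) simp
    also note tup_dom[OF seqs(3)[OF \<Lambda>K(1)[OF i]] Aa_dom d(4)[OF \<Lambda>K(1)[OF i]]]
    finally show ?thesis .
  qed
  ultimately have "card \<Lambda> < N" by (rule nip_bound_card[OF N \<Lambda>(1)])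
  then show False using \<Lambda>(2) by simp
qed

end

section \<open>Independence of the base set\<close>

theorem lemma6p3:
  fixes L :: "('f, 'r) lang" and T :: "('f, 'r, nat) fm set"
    and U :: "('f, 'r, 'u) struct" and \<mu> :: "'c rel"
    and A B :: "'u set" and X :: "'c set" and \<pi> :: "('f, 'r, 'c + 'u) fm set"
    and \<kappa> :: "'k rel"
  assumes "complete_theory L T"
    and "monster_model L T U \<mu>"
    and "NIP L U"
    and "A \<subseteq> B" and "B \<subseteq> Dom U" and "|B| <o \<mu>"
    and "|X| <o \<mu>"
    and "partial_type L U X A \<pi>"
    and "Card_order \<kappa>"
  shows "str_less L U \<mu> X \<pi> A \<kappa> \<longleftrightarrow> str_less L U \<mu> X \<pi> B \<kappa>"
proof -
  interpret nip_structure L U \<mu>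
    using assms(2,3) by unfold_locales (simp_all add: monster_model_def models_def)
  have "\<exists>a Y I J b. str_witness L U \<mu> X \<pi> B \<kappa> a Y I J b" if "str_witness L U \<mu> X \<pi> A \<kappa> a Y I J b" for a Y I J b
  proof -
    interpret witness_structure L U \<mu> X \<pi> A \<kappa> a Y I J b
      using that assms(4,5) by unfold_locales auto
    show ?thesis
      using base_change_small[OF index_small[OF assms(7)] assms(4-7)] assms(8) by (simp add: partial_type_def)
  qed
  moreover have "\<exists>a Y I J b. str_witness L U \<mu> X \<pi> A \<kappa> a Y I J b"
    if "str_witness L U \<mu> X \<pi> B \<kappa> a Y I J b" for a Y I J b
    using str_witness_restrict[OF assms(4-6) that] by blast
  ultimately show ?thesis unfolding str_less_witness by blast
qed

end
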